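(* There exist absolute constants $0<c<C<\infty$ such that \[ c\Bigl(R_\ast+\inf_{\mu\in\Delta(T)}\Phi_{\mu,\ast}\Bigr)\le \mathbb E\sup_{x\in T}X_x\le C\Bigl(R_\ast+\inf_{\mu\in\Delta(T)}\Phi_{\mu,\ast}\Bigr). \] Moreover $\mathbb E\sup_{x\in T}|X_x|\asymp\mathbb E\sup_{x\in T}X_x$, and therefore \[ \mathbb E\sup_{x\in T}|X_x|\asymp R_\ast+\inf_{\mu\in\Delta(T)}\Phi_{\mu,\ast}. \]
   Context: $T$ is a finite set and $\{X_x\}_{x\in T}$ is a centered Gaussian process. Fix an anchor $x_0\in T$ with $X_{x_0}=0$ almost surely. Define \[ d(x,y):=(\mathbb E|X_x-X_y|^2)^{1/2},\quad \sigma(x):=(\mathbb E X_x^2)^{1/2}=d(x,x_0),\quad R_\ast:=\sup_{x\in T}\sigma(x),\quad B_d(x,\varepsilon):=\{y\in T: d(x,y)\le\varepsilon\}. \] $\Delta(T)$ is the set of probability measures on $T$. For $\mu\in\Delta(T)$, \[ \Phi_\mu(x):=\int_0^{4\sigma(x)}\sqrt{\log\frac1{\mu(B_d(x,\varepsilon))}}\,d\varepsilon,\qquad \Phi_{\mu,\ast}:=\sup_{x\in T}\Phi_\mu(x) \] (with $\log(1/0)=+\infty$). $a\asymp b$ means that $a$ and $b$ are within absolute positive multiplicative constants of each other (not depending on the process or on $T$). *)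

theory Defs
  imports "HOL-Probability.Probability"
begin

section \<open>Centered Gaussian processes\<close>

text \<open>The law \<open>N(0, s\<^sup>2)\<close>; \<^const>\<open>normal_density\<close> is only a density for \<open>s > 0\<close>, so the
  degenerate case is the point mass at 0.\<close>

definition centered_normal :: "real \<Rightarrow> real measure" where
  "centered_normal s =
    (if s = 0 then return borel 0 else density lborel (\<lambda>t. ennreal (normal_density 0 s t)))"

definition centered_gaussian_process ::
    "'a measure \<Rightarrow> 'i set \<Rightarrow> ('i \<Rightarrow> 'a \<Rightarrow> real) \<Rightarrow> bool" where
  "centered_gaussian_process M T X \<longleftrightarrow>
    prob_space M \<and>
    (\<forall>x\<in>T. X x \<in> borel_measurable M) \<and>
    (\<forall>F a. finite F \<and> F \<subseteq> T \<longrightarrow>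
      (\<exists>s\<ge>0. distr M borel (\<lambda>\<omega>. \<Sum>x\<in>F. a x * X x \<omega>) = centered_normal s))"

definition anchored_gaussian_process ::
    "'a measure \<Rightarrow> 'i set \<Rightarrow> ('i \<Rightarrow> 'a \<Rightarrow> real) \<Rightarrow> 'i \<Rightarrow> bool" where
  "anchored_gaussian_process M T X x0 \<longleftrightarrow>
    finite T \<and> x0 \<in> T \<and> centered_gaussian_process M T X \<and> (AE \<omega> in M. X x0 \<omega> = 0)"

definition gp_dist :: "'a measure \<Rightarrow> ('i \<Rightarrow> 'a \<Rightarrow> real) \<Rightarrow> 'i \<Rightarrow> 'i \<Rightarrow> real" where
  "gp_dist M X x y = sqrt (\<integral>\<omega>. \<bar>X x \<omega> - X y \<omega>\<bar>\<^sup>2 \<partial>M)"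

definition gp_sd :: "'a measure \<Rightarrow> ('i \<Rightarrow> 'a \<Rightarrow> real) \<Rightarrow> 'i \<Rightarrow> real" where
  "gp_sd M X x = sqrt (\<integral>\<omega>. (X x \<omega>)\<^sup>2 \<partial>M)"

definition gp_radius :: "'a measure \<Rightarrow> 'i set \<Rightarrow> ('i \<Rightarrow> 'a \<Rightarrow> real) \<Rightarrow> real" where
  "gp_radius M T X = (SUP x\<in>T. gp_sd M X x)"

definition gp_ball ::
    "'a measure \<Rightarrow> 'i set \<Rightarrow> ('i \<Rightarrow> 'a \<Rightarrow> real) \<Rightarrow> 'i \<Rightarrow> real \<Rightarrow> 'i set" where
  "gp_ball M T X x \<epsilon> = {y \<in> T. gp_dist M X x y \<le> \<epsilon>}"

section \<open>The anchored majorizing measure functional\<close>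

text \<open>Probability measures on the finite set \<open>T\<close>, as discrete distributions supported in \<open>T\<close>.\<close>

definition prob_measures_on :: "'i set \<Rightarrow> 'i pmf set" where
  "prob_measures_on T = {\<mu>. set_pmf \<mu> \<subseteq> T}"

text \<open>The integrand \<open>sqrt (log (1 / p))\<close>, with \<open>log (1 / 0) = \<infinity>\<close>.\<close>

definition sqrt_log_inv :: "real \<Rightarrow> ennreal" where
  "sqrt_log_inv p = (if p = 0 then \<infinity> else ennreal (sqrt (ln (1 / p))))"

definition gp_Phi ::
    "'a measure \<Rightarrow> 'i set \<Rightarrow> ('i \<Rightarrow> 'a \<Rightarrow> real) \<Rightarrow> 'i pmf \<Rightarrow> 'i \<Rightarrow> ennreal" where
  "gp_Phi M T X \<mu> x =
    (\<integral>\<^sup>+\<epsilon>\<in>{0..4 * gp_sd M X x}. sqrt_log_inv (measure_pmf.prob \<mu> (gp_ball M T X x \<epsilon>)) \<partial>lborel)"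

definition gp_Phi_sup ::
    "'a measure \<Rightarrow> 'i set \<Rightarrow> ('i \<Rightarrow> 'a \<Rightarrow> real) \<Rightarrow> 'i pmf \<Rightarrow> ennreal" where
  "gp_Phi_sup M T X \<mu> = (SUP x\<in>T. gp_Phi M T X \<mu> x)"

definition radius_plus_inf_Phi ::
    "'a measure \<Rightarrow> 'i set \<Rightarrow> ('i \<Rightarrow> 'a \<Rightarrow> real) \<Rightarrow> ennreal" where
  "radius_plus_inf_Phi M T X =
    ennreal (gp_radius M T X) + (INF \<mu>\<in>prob_measures_on T. gp_Phi_sup M T X \<mu>)"

section \<open>Expected suprema and absolute constants\<close>

text \<open>For an anchored Gaussian process both suprema below are integrable with nonnegative
  expectation (the supremum is at least \<open>X x0 = 0\<close> almost surely), so the truncation in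
  \<^const>\<open>ennreal\<close> does not change their values.\<close>

definition expected_sup ::
    "'a measure \<Rightarrow> 'i set \<Rightarrow> ('i \<Rightarrow> 'a \<Rightarrow> real) \<Rightarrow> ennreal" where
  "expected_sup M T X = ennreal (\<integral>\<omega>. (SUP x\<in>T. X x \<omega>) \<partial>M)"

definition expected_sup_abs ::
    "'a measure \<Rightarrow> 'i set \<Rightarrow> ('i \<Rightarrow> 'a \<Rightarrow> real) \<Rightarrow> ennreal" where
  "expected_sup_abs M T X = ennreal (\<integral>\<omega>. (SUP x\<in>T. \<bar>X x \<omega>\<bar>) \<partial>M)"

text \<open>\<open>c F \<le> G \<le> C F\<close> for all anchored Gaussian processes with sample points in \<open>'a\<close> and
  indices in \<open>'i\<close>. HOL cannot quantify over types below \<open>\<exists>c C\<close>, so constants that do not depend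
  on the process are expressed in two steps. They exist for \<open>'a = nat \<Rightarrow> real\<close> and \<open>'i = nat\<close>,
  a closed statement about types that realise the law of every finite process; and whatever
  constants work for these types work for arbitrary \<open>'a\<close> and \<open>'i\<close>.\<close>

definition comparable ::
    "'a itself \<Rightarrow> 'i itself \<Rightarrow> real \<Rightarrow> real \<Rightarrow>
     ('a measure \<Rightarrow> 'i set \<Rightarrow> ('i \<Rightarrow> 'a \<Rightarrow> real) \<Rightarrow> ennreal) \<Rightarrow>
     ('a measure \<Rightarrow> 'i set \<Rightarrow> ('i \<Rightarrow> 'a \<Rightarrow> real) \<Rightarrow> ennreal) \<Rightarrow> bool" where
  "comparable _ _ c C F G \<longleftrightarrow>
    (\<forall>M T X x0. anchored_gaussian_process M T X x0 \<longrightarrow>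
      ennreal c * F M T X \<le> G M T X \<and> G M T X \<le> ennreal C * F M T X)"

end

theory Submission
  imports Defs "HOL-Real_Asymp.Real_Asymp"
begin

text \<open>Lower bound on the expected supremum. Comparing the process with recentred pieces plus an
  independent Gaussian process on a discrete cube, the Sudakov-Fernique inequality shows that
  \<open>2 ^ n\<close> small pieces with centres at mutual distance at least \<open>e\<close> have a union whose expected
  maximum exceeds that of the worst piece by at least \<open>e * sqrt n / 5\<close>. Cutting \<open>T\<close> greedily into
  cells of radius \<open>r\<close>, \<open>r / 8\<close>, \<open>r / 64\<close>, \<open>\<dots>\<close>, always removing the cell around the point whose
  neighbourhood one scale further down has the largest expected maximum, the \<open>i\<close>-th cell gains a
  multiple of its radius times \<open>sqrt (ln i)\<close>. Giving the \<open>i\<close>-th cell mass of order \<open>1 / i\<^sup>2\<close> makes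
  the gains along any branch of the tree pay for the entropy integral. A multiple of the radius is
  bounded by the expected supremum through a single pair \<open>X x, X x0\<close>.

  Upper bound. Telescope \<open>X x\<close> through its \<open>\<mu>\<close>-averages over the balls of radius
  \<open>4 \<sigma>(x) / 2 ^ k\<close>. Each increment is at most the radius times the entropy term plus one random
  variable of bounded expectation that is common to all \<open>x\<close> and \<open>k\<close>; this controls the supremum
  of \<open>\<bar>X x\<bar>\<close>.\<close>

section \<open>Centered Gaussian random variables\<close>

text \<open>A Gaussian process is given only through the one-dimensional laws of its linear
  combinations, while comparing two processes needs conditioning and independent copies. The bridge
  is that the characteristic functions of all linear combinations determine the joint law; Gaussian
  integration by parts rests on this, and the comparison inequality on integration by parts.

  The ratio 8 between scales leaves room in the comparison: points within \<open>e / 8\<close> of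
  centres at distance \<open>e\<close> stay \<open>3 / 4 * e\<close> apart, which pays both for
  recentring the pieces and for the cube. Finiteness of \<open>T\<close> lets the recursion over
  scales start below the smallest positive distance, where a point mass has entropy zero.

  In the upper bound the common random variable is a \<open>\<mu>\<close>-average of terms
  \<open>exp (D\<^sup>2 / (4 * s\<^sup>2))\<close>, where \<open>D\<close> is an increment or a
  value of the process and \<open>s\<close> its standard deviation. Each term has mean at most
  \<open>sqrt 2\<close>, so the size of \<open>T\<close> never enters. The anchor serves at the
  largest radius \<open>4 * \<sigma>(x)\<close>: points of that ball have standard deviation at most
  \<open>5 * \<sigma>(x)\<close>, and their average is compared with 0 directly.\<close>

lemma centered_normal_eq_distr:
  assumes "0 \<le> s"
  shows "centered_normal s = distr std_normal_distribution borel (\<lambda>x. s * x)"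
proof (cases "s = 0")
  case True
  interpret real_distribution std_normal_distribution by (rule real_dist_normal_dist)
  have "distr std_normal_distribution borel (\<lambda>x. 0) = return borel (0::real)"
    by (rule measure_eqI) (auto simp: emeasure_distr emeasure_space_1[simplified] split: split_indicator)
  then show ?thesis using True by (simp add: centered_normal_def)
next
  case False
  interpret real_distribution std_normal_distribution by (rule real_dist_normal_dist)
  have "distributed std_normal_distribution lborel (\<lambda>x. x) (\<lambda>x. ennreal (std_normal_density x))"
    unfolding distributed_def by (auto simp: distr_id2 cong: distr_cong)
  then have "distributed std_normal_distribution lborel (\<lambda>x. 0 + s * x)
      (normal_density (0 + s * 0) (\<bar>s\<bar> * 1))"
    by (rule normal_density_affine) (use False in auto)
  then have "distr std_normal_distribution lborel (\<lambda>x. s * x) = density lborel (normal_density 0 s)"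
    using assms by (auto simp: distributed_def)
  moreover have "distr std_normal_distribution lborel (\<lambda>x. s * x)
      = distr std_normal_distribution borel (\<lambda>x. s * x)"
    by (rule distr_cong) auto
  ultimately show ?thesis using False by (simp add: centered_normal_def)
qed

text \<open>The scale stays existential: it is always the root of the second moment of
  \<open>V\<close>, and all later formulas for the law are written with that moment, so the
  degenerate law needs no separate notation.\<close>

definition gaussian_rv :: "'a measure \<Rightarrow> ('a \<Rightarrow> real) \<Rightarrow> bool" where
  "gaussian_rv M V \<longleftrightarrow> V \<in> borel_measurable M \<and> (\<exists>s\<ge>0. distr M borel V = centered_normal s)"

lemma integrable_std_normal_power [simp]: "integrable std_normal_distribution (\<lambda>x. x ^ k)"
  by (rule integrable_std_normal_distribution_moment)

lemma std_normal_second_moment: "(\<integral>x. x\<^sup>2 \<partial>std_normal_distribution) = 1"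
  using std_normal_distribution_even_moments(1)[of 1] by (simp add: fact_numeral)

lemma std_normal_first_abs_moment:
  "has_bochner_integral std_normal_distribution (\<lambda>x. \<bar>x\<bar>) (sqrt (2 / pi))"
  using std_normal_distribution_odd_moments_abs[of 0] integrable_abs[OF integrable_std_normal_power[of 1]]
  by (auto simp: has_bochner_integral_iff)

lemma gaussian_rv_distr:
  assumes "gaussian_rv M V"
  shows "distr M borel V = distr std_normal_distribution borel (\<lambda>x. sqrt (\<integral>\<omega>. (V \<omega>)\<^sup>2 \<partial>M) * x)"
proof -
  obtain s where s: "s \<ge> 0" "distr M borel V = centered_normal s" and [measurable]: "V \<in> borel_measurable M"
    using assms by (auto simp: gaussian_rv_def)
  have "(\<integral>\<omega>. (V \<omega>)\<^sup>2 \<partial>M) = (\<integral>x. x\<^sup>2 \<partial>distr M borel V)" by (subst integral_distr) auto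
  also have "\<dots> = (\<integral>x. (s * x)\<^sup>2 \<partial>std_normal_distribution)"
    unfolding s(2) centered_normal_eq_distr[OF s(1)] by (subst integral_distr) auto
  also have "\<dots> = s\<^sup>2" by (simp add: power_mult_distrib std_normal_second_moment)
  finally show ?thesis using s centered_normal_eq_distr by simp
qed

lemma
  fixes f :: "real \<Rightarrow> 'b::{banach, second_countable_topology}"
  assumes V: "gaussian_rv M V" and [measurable]: "f \<in> borel_measurable borel"
  shows gaussian_rv_integral: "(\<integral>\<omega>. f (V \<omega>) \<partial>M)
      = (\<integral>x. f (sqrt (\<integral>\<omega>. (V \<omega>)\<^sup>2 \<partial>M) * x) \<partial>std_normal_distribution)"
    and gaussian_rv_integrable: "integrable M (\<lambda>\<omega>. f (V \<omega>))
      \<longleftrightarrow> integrable std_normal_distribution (\<lambda>x. f (sqrt (\<integral>\<omega>. (V \<omega>)\<^sup>2 \<partial>M) * x))"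
proof -
  have [measurable]: "V \<in> borel_measurable M" using V by (auto simp: gaussian_rv_def)
  note d = gaussian_rv_distr[OF V]
  show "(\<integral>\<omega>. f (V \<omega>) \<partial>M) = (\<integral>x. f (sqrt (\<integral>\<omega>. (V \<omega>)\<^sup>2 \<partial>M) * x) \<partial>std_normal_distribution)"
    using arg_cong[OF d, of "\<lambda>N. integral\<^sup>L N f"] by (simp add: integral_distr)
  show "integrable M (\<lambda>\<omega>. f (V \<omega>))
      \<longleftrightarrow> integrable std_normal_distribution (\<lambda>x. f (sqrt (\<integral>\<omega>. (V \<omega>)\<^sup>2 \<partial>M) * x))"
    using arg_cong[OF d, of "\<lambda>N. integrable N f"] by (simp add: integrable_distr_eq)
qed

lemma gaussian_rv_nn_integral:
  assumes V: "gaussian_rv M V" and [measurable]: "f \<in> borel_measurable borel"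
  shows "(\<integral>\<^sup>+\<omega>. f (V \<omega>) \<partial>M)
      = (\<integral>\<^sup>+x. f (sqrt (\<integral>\<omega>. (V \<omega>)\<^sup>2 \<partial>M) * x) \<partial>std_normal_distribution)"
proof -
  have [measurable]: "V \<in> borel_measurable M" using V by (auto simp: gaussian_rv_def)
  show ?thesis
    using arg_cong[OF gaussian_rv_distr[OF V], of "\<lambda>N. integral\<^sup>N N f"] by (simp add: nn_integral_distr)
qed

lemma gaussian_rv_measurable [measurable_dest]: "gaussian_rv M V \<Longrightarrow> V \<in> borel_measurable M"
  by (simp add: gaussian_rv_def)

lemma gaussian_rv_integrable_power:
  assumes "gaussian_rv M V"
  shows "integrable M (\<lambda>\<omega>. (V \<omega>) ^ k)"
  by (subst gaussian_rv_integrable[OF assms]) (auto simp: power_mult_distrib)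

lemma gaussian_rv_integrable_self: "gaussian_rv M V \<Longrightarrow> integrable M V"
  using gaussian_rv_integrable_power[of M V 1] by simp

lemma gaussian_rv_mean:
  assumes "gaussian_rv M V"
  shows "(\<integral>\<omega>. V \<omega> \<partial>M) = 0"
  using std_normal_distribution_even_moments integral_std_normal_distribution_moment_odd[of 1]
  by (subst gaussian_rv_integral[OF assms]) auto

lemma gaussian_rv_abs_mean:
  assumes "gaussian_rv M V"
  shows "(\<integral>\<omega>. \<bar>V \<omega>\<bar> \<partial>M) = sqrt (2 / pi) * sqrt (\<integral>\<omega>. (V \<omega>)\<^sup>2 \<partial>M)"
  using std_normal_first_abs_moment
  by (subst gaussian_rv_integral[OF assms]) (auto simp: abs_mult has_bochner_integral_iff)

lemma three_fifths_le_sqrt_2_over_pi: "3 / 5 \<le> sqrt (2 / pi)"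
proof (rule real_le_rsqrt)
  show "(3 / 5)\<^sup>2 \<le> 2 / pi" using pi_less_4 pi_gt_zero by (simp add: field_simps power2_eq_square)
qed

lemma gaussian_rv_char:
  assumes V: "gaussian_rv M V"
  shows "(CLINT \<omega>|M. iexp (t * V \<omega>)) = of_real (exp (- (t\<^sup>2 * (\<integral>\<omega>. (V \<omega>)\<^sup>2 \<partial>M)) / 2))"
proof -
  let ?s = "sqrt (\<integral>\<omega>. (V \<omega>)\<^sup>2 \<partial>M)"
  have "(CLINT \<omega>|M. iexp (t * V \<omega>)) = (CLINT x|std_normal_distribution. iexp (t * (?s * x)))"
    by (rule gaussian_rv_integral[OF V]) measurable
  also have "\<dots> = char std_normal_distribution (t * ?s)"
    by (simp add: char_def mult.assoc)
  also have "\<dots> = of_real (exp (- ((t * ?s)\<^sup>2) / 2))"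
    by (simp add: char_std_normal_distribution)
  also have "(t * ?s)\<^sup>2 = t\<^sup>2 * (\<integral>\<omega>. (V \<omega>)\<^sup>2 \<partial>M)" by (simp add: power_mult_distrib)
  finally show ?thesis .
qed

text \<open>Levy uniqueness identifies the law. This is how sums of independent Gaussian variables
  are recognised as Gaussian without convolving densities.\<close>

lemma gaussian_rvI_char:
  assumes "prob_space M" and [measurable]: "V \<in> borel_measurable M" and v: "0 \<le> v"
    and ch: "\<And>t. (CLINT \<omega>|M. iexp (t * V \<omega>)) = of_real (exp (- (t\<^sup>2 * v) / 2))"
  shows "gaussian_rv M V"
proof -
  interpret prob_space M by fact
  interpret S: real_distribution std_normal_distribution by (rule real_dist_normal_dist)
  have "distr M borel V = distr std_normal_distribution borel (\<lambda>x. sqrt v * x)"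
  proof (rule Levy_uniqueness)
    show "char (distr M borel V) = char (distr std_normal_distribution borel (\<lambda>x. sqrt v * x))"
    proof
      fix t
      have "char (distr std_normal_distribution borel (\<lambda>x. sqrt v * x)) t
          = char std_normal_distribution (t * sqrt v)"
        unfolding char_def by (subst integral_distr) (auto simp: mult.assoc)
      also have "\<dots> = of_real (exp (- (t\<^sup>2 * v) / 2))"
        using v by (simp add: char_std_normal_distribution power_mult_distrib)
      also have "\<dots> = char (distr M borel V) t"
        unfolding ch[symmetric] char_def by (subst integral_distr) auto
      finally show "char (distr M borel V) t
          = char (distr std_normal_distribution borel (\<lambda>x. sqrt v * x)) t" by simp
    qed
  qed auto
  then show ?thesis
    using v unfolding gaussian_rv_def by (auto intro!: exI[of _ "sqrt v"] simp: centered_normal_eq_distr)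
qed

text \<open>The factor \<open>exp (x\<^sup>2 / 4)\<close> halves the exponent of the density of N(0,
  1) and so turns it into \<open>sqrt 2\<close> times the density of N(0, 2).\<close>

lemma std_normal_exp_quarter_square:
  "(\<integral>\<^sup>+x. ennreal (exp (x\<^sup>2 / 4)) \<partial>std_normal_distribution) = ennreal (sqrt 2)"
proof -
  have "(\<integral>\<^sup>+x. ennreal (exp (x\<^sup>2 / 4)) \<partial>std_normal_distribution)
      = (\<integral>\<^sup>+x. ennreal (std_normal_density x) * ennreal (exp (x\<^sup>2 / 4)) \<partial>lborel)"
    by (subst nn_integral_density) auto
  also have "\<dots> = (\<integral>\<^sup>+x. ennreal (sqrt 2) * ennreal (normal_density 0 (sqrt 2) x) \<partial>lborel)"
  proof (rule nn_integral_cong)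
    fix x :: real
    have "std_normal_density x * exp (x\<^sup>2 / 4) = sqrt 2 * normal_density 0 (sqrt 2) x"
      by (simp add: normal_density_def real_sqrt_mult field_simps flip: exp_add)
    then show "ennreal (std_normal_density x) * ennreal (exp (x\<^sup>2 / 4))
        = ennreal (sqrt 2) * ennreal (normal_density 0 (sqrt 2) x)"
      by (simp flip: ennreal_mult'')
  qed
  also have "\<dots> = ennreal (sqrt 2)"
    by (subst nn_integral_cmult) (auto simp: nn_integral_eq_integral)
  finally show ?thesis .
qed

lemma gaussian_rv_exp_square:
  assumes V: "gaussian_rv M V" and "prob_space M"
  shows "(\<integral>\<^sup>+\<omega>. ennreal (exp ((V \<omega>)\<^sup>2 / (4 * (\<integral>\<omega>. (V \<omega>)\<^sup>2 \<partial>M)))) \<partial>M) \<le> ennreal (sqrt 2)"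
proof -
  interpret prob_space M by fact
  define v where "v = (\<integral>\<omega>. (V \<omega>)\<^sup>2 \<partial>M)"
  have v0: "v \<ge> 0" by (simp add: v_def)
  show ?thesis
  proof (cases "v = 0")
    \<comment> \<open>Division by zero yields 0, so the exponent vanishes and the integral is the
      total mass 1.\<close>
    case True
    then show ?thesis unfolding v_def[symmetric] by (simp add: emeasure_space_1)
  next
    case False
    have "(\<integral>\<^sup>+\<omega>. ennreal (exp ((V \<omega>)\<^sup>2 / (4 * v))) \<partial>M)
        = (\<integral>\<^sup>+x. ennreal (exp ((sqrt v * x)\<^sup>2 / (4 * v))) \<partial>std_normal_distribution)"
      unfolding v_def by (subst gaussian_rv_nn_integral[OF V]) (auto simp flip: v_def)
    also have "\<dots> = (\<integral>\<^sup>+x. ennreal (exp (x\<^sup>2 / 4)) \<partial>std_normal_distribution)"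
      using v0 False by (simp add: power_mult_distrib field_simps)
    finally show ?thesis unfolding v_def[symmetric] by (simp add: std_normal_exp_quarter_square)
  qed
qed

lemma gaussian_rv_AE_0:
  assumes V: "gaussian_rv M V" and "(\<integral>\<omega>. (V \<omega>)\<^sup>2 \<partial>M) = 0"
  shows "AE \<omega> in M. V \<omega> = 0"
proof -
  have "AE \<omega> in M. (V \<omega>)\<^sup>2 = 0"
    using assms(2) gaussian_rv_integrable_power[OF V, of 2]
    by (subst (asm) integral_nonneg_eq_0_iff_AE) auto
  then show ?thesis by auto
qed

section \<open>Linear images and independent sums of Gaussian families\<close>

lemma cgp_gaussian_rv:
  assumes "centered_gaussian_process M T X" "finite T"
  shows "gaussian_rv M (\<lambda>\<omega>. \<Sum>x\<in>T. a x * X x \<omega>)"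
proof -
  have [measurable]: "\<And>x. x \<in> T \<Longrightarrow> X x \<in> borel_measurable M"
    using assms by (auto simp: centered_gaussian_process_def)
  show ?thesis using assms by (auto simp: gaussian_rv_def centered_gaussian_process_def)
qed

lemma cgpI:
  assumes "prob_space M" "finite T" and m: "\<And>x. x \<in> T \<Longrightarrow> X x \<in> borel_measurable M"
    and g: "\<And>a. gaussian_rv M (\<lambda>\<omega>. \<Sum>x\<in>T. a x * X x \<omega>)"
  shows "centered_gaussian_process M T X"
  unfolding centered_gaussian_process_def
proof (intro conjI ballI allI impI)
  fix F a assume F: "finite F \<and> F \<subseteq> T"
  have "(\<Sum>x\<in>T. (if x \<in> F then a x else 0) * X x \<omega>) = (\<Sum>x\<in>F. a x * X x \<omega>)" for \<omega>
    using F assms(2) by (intro sum.mono_neutral_cong_right) auto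
  then show "\<exists>s\<ge>0. distr M borel (\<lambda>\<omega>. \<Sum>x\<in>F. a x * X x \<omega>) = centered_normal s"
    using g[of "\<lambda>x. if x \<in> F then a x else 0"] by (simp add: gaussian_rv_def)
qed (use assms in auto)

lemma cgp_linear:
  assumes X: "centered_gaussian_process M T X" "finite T" "finite P"
    and Y: "\<And>p \<omega>. p \<in> P \<Longrightarrow> Y p \<omega> = (\<Sum>x\<in>T. L p x * X x \<omega>)"
  shows "centered_gaussian_process M P Y"
proof (rule cgpI)
  show "prob_space M" using X by (auto simp: centered_gaussian_process_def)
  have g: "gaussian_rv M (\<lambda>\<omega>. \<Sum>p\<in>P. a p * Y p \<omega>)" for a
  proof -
    have "(\<Sum>p\<in>P. a p * Y p \<omega>) = (\<Sum>x\<in>T. (\<Sum>p\<in>P. a p * L p x) * X x \<omega>)" for \<omega>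
      using Y by (simp add: sum_distrib_left sum_distrib_right mult.assoc sum.swap[of _ T P])
    then show ?thesis using cgp_gaussian_rv[OF X(1,2), of "\<lambda>x. \<Sum>p\<in>P. a p * L p x"] by simp
  qed
  then show "gaussian_rv M (\<lambda>\<omega>. \<Sum>p\<in>P. a p * Y p \<omega>)" for a .
  show "Y p \<in> borel_measurable M" if "p \<in> P" for p
  proof -
    have "(\<Sum>q\<in>P. (if q = p then 1 else 0) * Y q \<omega>) = Y p \<omega>" for \<omega>
      using that X(3) by (simp add: if_distrib[of "\<lambda>x. x * _"] cong: if_cong)
    then show ?thesis using g[of "\<lambda>q. if q = p then 1 else 0"] by (simp add: gaussian_rv_def)
  qed
qed (use assms in auto)

text \<open>Characteristic functions of independent summands multiply. The exponent of the product
  already contains the variance, so the second moment is read off by comparing both expressions at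
  \<open>t = 1\<close> instead of expanding the square.\<close>

lemma gaussian_rv_indep_sum:
  assumes A: "gaussian_rv M A" "prob_space M" and B: "gaussian_rv N B" "prob_space N"
  shows "gaussian_rv (M \<Otimes>\<^sub>M N) (\<lambda>(\<omega>, \<xi>). A \<omega> + B \<xi>)"
    and "(\<integral>p. (A (fst p) + B (snd p))\<^sup>2 \<partial>(M \<Otimes>\<^sub>M N)) = (\<integral>\<omega>. (A \<omega>)\<^sup>2 \<partial>M) + (\<integral>\<xi>. (B \<xi>)\<^sup>2 \<partial>N)"
proof -
  interpret M: prob_space M by fact
  interpret N: prob_space N by fact
  interpret P: pair_prob_space M N ..
  have [measurable]: "A \<in> borel_measurable M" "B \<in> borel_measurable N"
    using A B by (auto simp: gaussian_rv_def)
  let ?a = "\<integral>\<omega>. (A \<omega>)\<^sup>2 \<partial>M" and ?b = "\<integral>\<xi>. (B \<xi>)\<^sup>2 \<partial>N"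
  have [measurable]: "(\<lambda>(\<omega>, \<xi>). A \<omega> + B \<xi>) \<in> borel_measurable (M \<Otimes>\<^sub>M N)" by measurable
  have ch: "(CLINT p|(M \<Otimes>\<^sub>M N). iexp (t * (case p of (\<omega>, \<xi>) \<Rightarrow> A \<omega> + B \<xi>)))
      = of_real (exp (- (t\<^sup>2 * (?a + ?b)) / 2))" for t
  proof -
    have "(CLINT p|(M \<Otimes>\<^sub>M N). iexp (t * (case p of (\<omega>, \<xi>) \<Rightarrow> A \<omega> + B \<xi>)))
        = (CLINT p|(M \<Otimes>\<^sub>M N). (case p of (\<omega>, \<xi>) \<Rightarrow> iexp (t * A \<omega>) * iexp (t * B \<xi>)))"
      by (intro Bochner_Integration.integral_cong) (auto simp: field_simps simp flip: exp_add)
    also have "\<dots> = (CLINT \<omega>|M. CLINT \<xi>|N. iexp (t * A \<omega>) * iexp (t * B \<xi>))"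
      by (rule P.integral_fst[symmetric]) (auto intro!: P.integrable_const_bound[where B=1] simp: norm_mult)
    also have "\<dots> = (CLINT \<omega>|M. iexp (t * A \<omega>)) * (CLINT \<xi>|N. iexp (t * B \<xi>))"
      by simp
    also have "\<dots> = of_real (exp (- (t\<^sup>2 * (?a + ?b)) / 2))"
      by (simp add: gaussian_rv_char[OF A(1)] gaussian_rv_char[OF B(1)] algebra_simps add_divide_distrib diff_divide_distrib
          flip: of_real_mult exp_add)
    finally show ?thesis .
  qed
  show g: "gaussian_rv (M \<Otimes>\<^sub>M N) (\<lambda>(\<omega>, \<xi>). A \<omega> + B \<xi>)"
    by (rule gaussian_rvI_char[OF _ _ _ ch]) (unfold_locales, auto)
  let ?c = "\<integral>p. (case p of (\<omega>, \<xi>) \<Rightarrow> A \<omega> + B \<xi>)\<^sup>2 \<partial>(M \<Otimes>\<^sub>M N)"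
  have "complex_of_real (exp (- (?a + ?b) / 2)) = complex_of_real (exp (- ?c / 2))"
    using ch[of 1] gaussian_rv_char[OF g, of 1] by simp
  then have "?a + ?b = ?c" by (simp only: of_real_eq_iff exp_inj_iff) simp
  then show "(\<integral>p. (A (fst p) + B (snd p))\<^sup>2 \<partial>(M \<Otimes>\<^sub>M N)) = ?a + ?b"
    by (simp add: case_prod_beta)
qed

section \<open>Joint laws and characteristic functions\<close>

text \<open>The measure with density \<open>w\<close>, pushed forward by \<open>X\<close>, is finite
  but not normalised. Its Fourier transform at 0 is its mass, so both sides have the same mass
  \<open>m\<close>. Dividing by \<open>m\<close> reduces the claim to Levy uniqueness for
  probability laws; for \<open>m = 0\<close> both integrals vanish.\<close>

lemma weighted_char_unique:
  fixes w X :: "'a \<Rightarrow> real" and w' X' :: "'b \<Rightarrow> real"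
  assumes "prob_space M" "prob_space N"
    and [measurable]: "w \<in> borel_measurable M" "X \<in> borel_measurable M"
      "w' \<in> borel_measurable N" "X' \<in> borel_measurable N"
    and w: "\<And>\<omega>. 0 \<le> w \<omega>" "\<And>\<omega>. w \<omega> \<le> B" and w': "\<And>\<omega>. 0 \<le> w' \<omega>" "\<And>\<omega>. w' \<omega> \<le> B"
    and eq: "\<And>t. (CLINT \<omega>|M. of_real (w \<omega>) * iexp (t * X \<omega>)) = (CLINT \<omega>|N. of_real (w' \<omega>) * iexp (t * X' \<omega>))"
    and A[measurable]: "A \<in> sets borel"
  shows "(\<integral>\<omega>. w \<omega> * indicator A (X \<omega>) \<partial>M) = (\<integral>\<omega>. w' \<omega> * indicator A (X' \<omega>) \<partial>N)"
proof -
  define m where "m = (\<integral>\<omega>. w \<omega> \<partial>M)"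
  \<comment> \<open>Stated for a space over a type of its own, so that one argument serves both
    \<open>M\<close> and \<open>N\<close>.\<close>
  have key: "prob_space K \<Longrightarrow> v \<in> borel_measurable K \<Longrightarrow> Z \<in> borel_measurable K \<Longrightarrow> (\<And>\<omega>. 0 \<le> v \<omega>) \<Longrightarrow> (\<And>\<omega>. v \<omega> \<le> B) \<Longrightarrow>
      (\<integral>\<omega>. v \<omega> \<partial>K) = m \<Longrightarrow> integrable K v \<and>
      (m = 0 \<longrightarrow> (\<integral>\<omega>. v \<omega> * indicator A (Z \<omega>) \<partial>K) = 0) \<and>
      (m > 0 \<longrightarrow> real_distribution (distr (density K (\<lambda>\<omega>. v \<omega> / m)) borel Z) \<and>
        (\<integral>\<omega>. v \<omega> * indicator A (Z \<omega>) \<partial>K) = m * measure (distr (density K (\<lambda>\<omega>. v \<omega> / m)) borel Z) A \<and>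
        (\<forall>t. char (distr (density K (\<lambda>\<omega>. v \<omega> / m)) borel Z) t = (CLINT \<omega>|K. of_real (v \<omega>) * iexp (t * Z \<omega>)) / m))"
    for K :: "'c measure" and v Z :: "'c \<Rightarrow> real"
  proof (intro conjI impI)
    assume "prob_space K" and [measurable]: "v \<in> borel_measurable K" "Z \<in> borel_measurable K"
      and v0: "\<And>\<omega>. 0 \<le> v \<omega>" and vB: "\<And>\<omega>. v \<omega> \<le> B" and vm: "(\<integral>\<omega>. v \<omega> \<partial>K) = m"
    interpret prob_space K by fact
    show vi: "integrable K v" by (rule integrable_const_bound[where B=B]) (auto simp: v0 vB)
    have "(\<integral>\<omega>. v \<omega> * indicator A (Z \<omega>) \<partial>K) \<le> (\<integral>\<omega>. v \<omega> \<partial>K)"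
      by (rule integral_mono[OF _ vi]) (auto intro!: Bochner_Integration.integrable_bound[OF vi] simp: v0 split: split_indicator)
    moreover have "0 \<le> (\<integral>\<omega>. v \<omega> * indicator A (Z \<omega>) \<partial>K)" by (simp add: v0)
    ultimately show "(\<integral>\<omega>. v \<omega> * indicator A (Z \<omega>) \<partial>K) = 0" if "m = 0" using vm that by simp
    assume m: "m > 0"
    let ?D = "density K (\<lambda>\<omega>. ennreal (v \<omega> / m))"
    have D: "prob_space ?D"
    proof
      have "emeasure ?D (space ?D) = (\<integral>\<^sup>+\<omega>. ennreal (v \<omega> / m) \<partial>K)"
        by (subst emeasure_density) (auto intro!: nn_integral_cong split: split_indicator)
      also have "\<dots> = ennreal (\<integral>\<omega>. v \<omega> / m \<partial>K)"
        using vi m v0 by (intro nn_integral_eq_integral) auto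
      finally show "emeasure ?D (space ?D) = 1" using vm m by simp
    qed
    then interpret D: prob_space ?D .
    show "real_distribution (distr ?D borel Z)" by simp
    then interpret R: real_distribution "distr ?D borel Z" .
    have "measure (distr ?D borel Z) A = (\<integral>x. indicator A x \<partial>distr ?D borel Z)" by simp
    also have "\<dots> = (\<integral>\<omega>. indicator A (Z \<omega>) \<partial>?D)" by (subst integral_distr) auto
    also have "\<dots> = (\<integral>\<omega>. (v \<omega> / m) * indicator A (Z \<omega>) \<partial>K)"
      using m v0 by (subst integral_density) auto
    also have "\<dots> = (\<integral>\<omega>. v \<omega> * indicator A (Z \<omega>) \<partial>K) / m"
      by (subst integral_divide_zero[symmetric]) simp
    finally show "(\<integral>\<omega>. v \<omega> * indicator A (Z \<omega>) \<partial>K) = m * measure (distr ?D borel Z) A" using m by simp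
    show "\<forall>t. char (distr ?D borel Z) t = (CLINT \<omega>|K. of_real (v \<omega>) * iexp (t * Z \<omega>)) / m"
    proof
      fix t
      have "char (distr ?D borel Z) t = (CLINT \<omega>|?D. iexp (t * Z \<omega>))"
        unfolding char_def by (subst integral_distr) auto
      also have "\<dots> = (CLINT \<omega>|K. (v \<omega> / m) *\<^sub>R iexp (t * Z \<omega>))"
        using m v0 by (subst integral_density) auto
      also have "\<dots> = (CLINT \<omega>|K. of_real (v \<omega>) * iexp (t * Z \<omega>) / m)"
        by (simp add: scaleR_conv_of_real)
      finally show "char (distr ?D borel Z) t = (CLINT \<omega>|K. of_real (v \<omega>) * iexp (t * Z \<omega>)) / m"
        by simp
    qed
  qed
  have m': "(\<integral>\<omega>. w' \<omega> \<partial>N) = m"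
  proof -
    have "complex_of_real m = of_real (\<integral>\<omega>. w' \<omega> \<partial>N)"
      using eq[of 0] by (simp add: m_def)
    then show ?thesis by simp
  qed
  have K1: "prob_space M" "w \<in> borel_measurable M" "X \<in> borel_measurable M" "(\<integral>\<omega>. w \<omega> \<partial>M) = m"
   and K2: "prob_space N" "w' \<in> borel_measurable N" "X' \<in> borel_measurable N"
    using assms by (auto simp: m_def)
  note k1 = key[OF K1(1-3) w K1(4)] and k2 = key[OF K2 w' m']
  have "m \<ge> 0" by (simp add: m_def w)
  then consider "m = 0" | "m > 0" by linarith
  then show ?thesis
  proof cases
    case 1 then show ?thesis using k1 k2 by simp
  next
    case 2
    have "distr (density M (\<lambda>\<omega>. w \<omega> / m)) borel X = distr (density N (\<lambda>\<omega>. w' \<omega> / m)) borel X'"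
    proof (rule Levy_uniqueness)
      show "char (distr (density M (\<lambda>\<omega>. w \<omega> / m)) borel X) = char (distr (density N (\<lambda>\<omega>. w' \<omega> / m)) borel X')"
        using k1 k2 2 eq by (intro ext) auto
    qed (use k1 k2 2 in auto)
    then show ?thesis using k1 k2 2 by simp
  qed
qed

text \<open>The coordinates are turned from frequencies into indicators one at a time. Weights of the form
  \<open>1 + cos\<close> keep the measures nonnegative, so that the one-dimensional uniqueness theorem applies.\<close>

lemma char_family_partial:
  fixes X :: "'i \<Rightarrow> 'a \<Rightarrow> real" and Y :: "'i \<Rightarrow> 'b \<Rightarrow> real"
  assumes "prob_space M" "prob_space N" "finite T"
    and X: "\<And>x. x \<in> T \<Longrightarrow> X x \<in> borel_measurable M" and Y: "\<And>x. x \<in> T \<Longrightarrow> Y x \<in> borel_measurable N"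
    and eq: "\<And>a. (CLINT \<omega>|M. iexp (\<Sum>x\<in>T. a x * X x \<omega>)) = (CLINT \<omega>|N. iexp (\<Sum>x\<in>T. a x * Y x \<omega>))"
    and A: "\<And>x. A x \<in> sets borel" and "S \<subseteq> T"
  shows "(CLINT \<omega>|M. of_real (\<Prod>x\<in>S. indicator (A x) (X x \<omega>)) * iexp (\<Sum>x\<in>T - S. a x * X x \<omega>))
    = (CLINT \<omega>|N. of_real (\<Prod>x\<in>S. indicator (A x) (Y x \<omega>)) * iexp (\<Sum>x\<in>T - S. a x * Y x \<omega>))"
proof -
  note [measurable] = A
  interpret M: prob_space M by fact
  interpret N: prob_space N by fact
  have "finite S" using assms finite_subset by blast
  from this \<open>S \<subseteq> T\<close> show ?thesis
  proof (induction S arbitrary: a)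
    case empty then show ?case using eq[of a] by simp
  next
    case (insert x S)
    then have xT: "x \<in> T" and ST: "S \<subseteq> T" and [measurable]: "X x \<in> borel_measurable M" "Y x \<in> borel_measurable N"
      using X Y by auto
    have Tx: "T - S = insert x (T - insert x S)" using xT insert by auto
    define I where "I \<omega> = (\<Prod>x\<in>S. indicator (A x) (X x \<omega>) :: real)" for \<omega>
    define J where "J \<omega> = (\<Prod>x\<in>S. indicator (A x) (Y x \<omega>) :: real)" for \<omega>
    have IJ: "I \<omega> \<in> {0..1}" "J \<omega>' \<in> {0..1}" for \<omega> \<omega>'
      unfolding I_def J_def by (auto intro!: prod_nonneg prod_le_1 split: split_indicator)
    define p where "p a \<omega> = (\<Sum>x\<in>T - insert x S. a x * X x \<omega>)" for a \<omega>
    define q where "q a \<omega> = (\<Sum>x\<in>T - insert x S. a x * Y x \<omega>)" for a \<omega>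
    have [measurable]: "I \<in> borel_measurable M" "J \<in> borel_measurable N"
      "p a \<in> borel_measurable M" "q a \<in> borel_measurable N" for a
      unfolding I_def J_def p_def[abs_def] q_def[abs_def] using ST X Y
      by (auto intro!: borel_measurable_prod borel_measurable_sum)
    have IHraw: "(CLINT \<omega>|M. of_real (I \<omega>) * iexp (t * X x \<omega> + p a \<omega>))
        = (CLINT \<omega>|N. of_real (J \<omega>) * iexp (t * Y x \<omega> + q a \<omega>))" for t a
    proof -
      have "(\<Sum>y\<in>T - S. (a(x := t)) y * X y \<omega>) = t * X x \<omega> + (\<Sum>y\<in>T - insert x S. a y * X y \<omega>)" for \<omega>
        unfolding Tx using assms(3) by (subst sum.insert) (auto intro!: sum.cong)
      moreover have "(\<Sum>y\<in>T - S. (a(x := t)) y * Y y \<omega>) = t * Y x \<omega> + (\<Sum>y\<in>T - insert x S. a y * Y y \<omega>)" for \<omega>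
        unfolding Tx using assms(3) by (subst sum.insert) (auto intro!: sum.cong)
      ultimately show ?thesis
        using insert.IH[OF ST, of "a(x := t)"] by (simp only: I_def J_def p_def q_def)
    qed
    have int_M: "integrable M (\<lambda>\<omega>. of_real (I \<omega>) * iexp (f \<omega>))" if [measurable]: "f \<in> borel_measurable M" for f
      using IJ(1) by (intro M.integrable_const_bound[where B=1]) (auto simp: norm_mult)
    have int_N: "integrable N (\<lambda>\<omega>. of_real (J \<omega>) * iexp (f \<omega>))" if [measurable]: "f \<in> borel_measurable N" for f
      using IJ(2) by (intro N.integrable_const_bound[where B=1]) (auto simp: norm_mult)
    \<comment> \<open>The cosine weight is a combination of the three frequencies 0,
      \<open>\<theta>\<close> and \<open>- \<theta>\<close>. With
      \<open>\<theta> = p a \<omega>\<close> these belong to the coefficient vectors 0,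
      \<open>a\<close> and \<open>- a\<close>, all covered by the induction hypothesis.\<close>
    have cos_exp: "of_real (i * (1 + cos (\<theta> - \<phi>))) * iexp u
        = of_real i * iexp (u + 0) + iexp (-\<phi>) / 2 * (of_real i * iexp (u + \<theta>))
          + iexp \<phi> / 2 * (of_real i * iexp (u + - \<theta>))" for i \<theta> \<phi> u :: real
      by (simp add: cos_exp_eq algebra_simps add_divide_distrib diff_divide_distrib
          flip: exp_add cos_of_real)
    have p0: "p (\<lambda>_. 0) \<omega> = 0" "p (\<lambda>y. - a y) \<omega> = - p a \<omega>"
      "q (\<lambda>_. 0) \<omega>' = 0" "q (\<lambda>y. - a y) \<omega>' = - q a \<omega>'" for \<omega> \<omega>' a
      by (simp_all add: p_def q_def sum_negf)
    have lin: "(CLINT \<omega>|K. f \<omega> + c * g \<omega> + d * h \<omega>) = (CLINT \<omega>|K. f \<omega>) + c * (CLINT \<omega>|K. g \<omega>) + d * (CLINT \<omega>|K. h \<omega>)"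
      if "complex_integrable K f" "complex_integrable K g" "complex_integrable K h" for K :: "'c measure" and f g h c d
      using that by simp
    \<comment> \<open>Here the coordinate \<open>x\<close> passes from a frequency to an indicator:
      the weight takes values in \<open>[0, 2]\<close>, and its transform in \<open>t\<close> agrees
      for the two families.\<close>
    have W: "(\<integral>\<omega>. I \<omega> * (1 + cos (p a \<omega> - \<phi>)) * indicator (A x) (X x \<omega>) \<partial>M)
        = (\<integral>\<omega>. J \<omega> * (1 + cos (q a \<omega> - \<phi>)) * indicator (A x) (Y x \<omega>) \<partial>N)" for \<phi> a
    proof (rule weighted_char_unique[where B=2])
      fix t
      have "(CLINT \<omega>|M. of_real (I \<omega> * (1 + cos (p a \<omega> - \<phi>))) * iexp (t * X x \<omega>))
          = (CLINT \<omega>|M. of_real (I \<omega>) * iexp (t * X x \<omega> + p (\<lambda>_. 0) \<omega>))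
          + iexp (-\<phi>) / 2 * (CLINT \<omega>|M. of_real (I \<omega>) * iexp (t * X x \<omega> + p a \<omega>))
          + iexp \<phi> / 2 * (CLINT \<omega>|M. of_real (I \<omega>) * iexp (t * X x \<omega> + p (\<lambda>y. - a y) \<omega>))"
        unfolding cos_exp p0
        by (rule lin) (intro int_M; measurable)+
      also have "\<dots> = (CLINT \<omega>|N. of_real (J \<omega>) * iexp (t * Y x \<omega> + q (\<lambda>_. 0) \<omega>))
          + iexp (-\<phi>) / 2 * (CLINT \<omega>|N. of_real (J \<omega>) * iexp (t * Y x \<omega> + q a \<omega>))
          + iexp \<phi> / 2 * (CLINT \<omega>|N. of_real (J \<omega>) * iexp (t * Y x \<omega> + q (\<lambda>y. - a y) \<omega>))"
        by (simp only: IHraw)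
      also have "\<dots> = (CLINT \<omega>|N. of_real (J \<omega> * (1 + cos (q a \<omega> - \<phi>))) * iexp (t * Y x \<omega>))"
        unfolding cos_exp p0
        by (rule lin[symmetric]) (intro int_N; measurable)+
      finally show "(CLINT \<omega>|M. of_real (I \<omega> * (1 + cos (p a \<omega> - \<phi>))) * iexp (t * X x \<omega>))
        = (CLINT \<omega>|N. of_real (J \<omega> * (1 + cos (q a \<omega> - \<phi>))) * iexp (t * Y x \<omega>))" .
    next
      have b: "0 \<le> i * (1 + cos u)" "i * (1 + cos u) \<le> 2" if "i \<in> {0..1}" for i u :: real
      proof -
        have "0 \<le> 1 + cos u" "1 + cos u \<le> 2" using cos_ge_minus_one[of u] cos_le_one[of u] by linarith+
        then show "0 \<le> i * (1 + cos u)" "i * (1 + cos u) \<le> 2"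
          using that mult_mono[of i 1 "1 + cos u" 2] by auto
      qed
      show "0 \<le> I \<omega> * (1 + cos (p a \<omega> - \<phi>))" "I \<omega> * (1 + cos (p a \<omega> - \<phi>)) \<le> 2"
        "0 \<le> J \<omega>' * (1 + cos (q a \<omega>' - \<phi>))" "J \<omega>' * (1 + cos (q a \<omega>' - \<phi>)) \<le> 2" for \<omega> \<omega>'
        using b[OF IJ(1)] b[OF IJ(2)] by auto
    qed (use assms(1,2) in measurable)
    define K where "K \<omega> = I \<omega> * indicator (A x) (X x \<omega>)" for \<omega>
    define L where "L \<omega> = J \<omega> * indicator (A x) (Y x \<omega>)" for \<omega>
    have [measurable]: "K \<in> borel_measurable M" "L \<in> borel_measurable N"
      unfolding K_def[abs_def] L_def[abs_def] by measurable
    have KL: "K \<omega> \<in> {0..1}" "L \<omega>' \<in> {0..1}" for \<omega> \<omega>'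
      using IJ(1)[of \<omega>] IJ(2)[of \<omega>'] by (auto simp: K_def L_def split: split_indicator)
    have iM: "integrable M (\<lambda>\<omega>. K \<omega> * cos (f \<omega>))" if [measurable]: "f \<in> borel_measurable M" for f
      using KL(1) by (intro M.integrable_const_bound[where B=1]) (auto simp: abs_mult intro!: mult_le_one)
    have iN: "integrable N (\<lambda>\<omega>. L \<omega> * cos (f \<omega>))" if [measurable]: "f \<in> borel_measurable N" for f
      using KL(2) by (intro N.integrable_const_bound[where B=1]) (auto simp: abs_mult intro!: mult_le_one)
    have iM0: "integrable M K" and iN0: "integrable N L"
      using iM[of "\<lambda>_. 0"] iN[of "\<lambda>_. 0"] by auto
    \<comment> \<open>At the zero vector and phase 0 the weight \<open>1 + cos\<close> is the
      constant 2. The resulting equality of masses is subtracted below to isolate the cosine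
      term.\<close>
    have "(\<integral>\<omega>. K \<omega> \<partial>M) = (\<integral>\<omega>. L \<omega> \<partial>N)"
    proof -
      have "I \<omega> * (1 + cos (p (\<lambda>_. 0) \<omega> - 0)) * indicator (A x) (X x \<omega>) = 2 * K \<omega>"
        "J \<omega>' * (1 + cos (q (\<lambda>_. 0) \<omega>' - 0)) * indicator (A x) (Y x \<omega>') = 2 * L \<omega>'" for \<omega> \<omega>'
        by (simp_all add: p0 K_def L_def)
      then have "(\<integral>\<omega>. 2 * K \<omega> \<partial>M) = (\<integral>\<omega>. 2 * L \<omega> \<partial>N)"
        using W[of "\<lambda>_. 0" 0] by (simp only:)
      then show ?thesis by simp
    qed
    moreover have "(\<integral>\<omega>. K \<omega> + K \<omega> * cos (p a \<omega> - \<phi>) \<partial>M) = (\<integral>\<omega>. L \<omega> + L \<omega> * cos (q a \<omega> - \<phi>) \<partial>N)" for \<phi>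
      using W[of a \<phi>] by (simp add: K_def L_def algebra_simps)
    ultimately have C: "(\<integral>\<omega>. K \<omega> * cos (p a \<omega> - \<phi>) \<partial>M) = (\<integral>\<omega>. L \<omega> * cos (q a \<omega> - \<phi>) \<partial>N)" for \<phi>
      using iM0 iN0 iM iN by simp
    have split: "complex_of_real k * iexp u = of_real (k * cos u) + \<i> * of_real (k * sin u)" for k u
      by (simp add: exp_Euler algebra_simps flip: cos_of_real sin_of_real)
    \<comment> \<open>The phases 0 and \<open>pi / 2\<close> give the real and the imaginary part of
      the complex exponential.\<close>
    have c: "(\<integral>\<omega>. K \<omega> * cos (p a \<omega>) \<partial>M) = (\<integral>\<omega>. L \<omega> * cos (q a \<omega>) \<partial>N)"
      and s: "(\<integral>\<omega>. K \<omega> * sin (p a \<omega>) \<partial>M) = (\<integral>\<omega>. L \<omega> * sin (q a \<omega>) \<partial>N)"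
      using C[of 0] C[of "pi / 2"] by (simp_all add: cos_diff)
    have i: "integrable M (\<lambda>\<omega>. K \<omega> * cos (p a \<omega>))" "integrable M (\<lambda>\<omega>. K \<omega> * sin (p a \<omega>))"
      "integrable N (\<lambda>\<omega>. L \<omega> * cos (q a \<omega>))" "integrable N (\<lambda>\<omega>. L \<omega> * sin (q a \<omega>))"
      using iM[of "p a"] iM[of "\<lambda>\<omega>. p a \<omega> - pi / 2"] iN[of "q a"] iN[of "\<lambda>\<omega>. q a \<omega> - pi / 2"]
      by (simp_all add: cos_diff)
    have "(CLINT \<omega>|M. of_real (K \<omega>) * iexp (p a \<omega>)) = (CLINT \<omega>|N. of_real (L \<omega>) * iexp (q a \<omega>))"
      unfolding split using i by (simp add: c s del: of_real_mult)
    then show ?case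
      using insert by (simp add: K_def L_def I_def J_def p_def q_def mult_ac)
  qed
qed

text \<open>The Cramer-Wold principle. Once every coordinate is converted by
  \<open>char_family_partial\<close>, no frequencies are left and the identity compares
  probabilities of boxes, which generate the product sigma-algebra and are stable under
  intersection.\<close>

lemma distr_family_eqI_char:
  fixes X :: "'i \<Rightarrow> 'a \<Rightarrow> real" and Y :: "'i \<Rightarrow> 'b \<Rightarrow> real"
  assumes "prob_space M" "prob_space N" "finite T"
    and X: "\<And>x. x \<in> T \<Longrightarrow> X x \<in> borel_measurable M" and Y: "\<And>x. x \<in> T \<Longrightarrow> Y x \<in> borel_measurable N"
    and eq: "\<And>a. (CLINT \<omega>|M. iexp (\<Sum>x\<in>T. a x * X x \<omega>)) = (CLINT \<omega>|N. iexp (\<Sum>x\<in>T. a x * Y x \<omega>))"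
  shows "distr M (PiM T (\<lambda>_. borel)) (\<lambda>\<omega>. \<lambda>x\<in>T. X x \<omega>) = distr N (PiM T (\<lambda>_. borel)) (\<lambda>\<omega>. \<lambda>x\<in>T. Y x \<omega>)"
    (is "?D = ?E")
proof (rule measure_eqI_PiM_finite[OF \<open>finite T\<close>, where A="\<lambda>_. \<Pi>\<^sub>E x\<in>T. UNIV"])
  interpret M: prob_space M by fact
  interpret N: prob_space N by fact
  have [measurable]: "(\<lambda>\<omega>. \<lambda>x\<in>T. X x \<omega>) \<in> M \<rightarrow>\<^sub>M PiM T (\<lambda>_. borel)"
    "(\<lambda>\<omega>. \<lambda>x\<in>T. Y x \<omega>) \<in> N \<rightarrow>\<^sub>M PiM T (\<lambda>_. borel)"
    using X Y by (auto intro!: measurable_restrict)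
  show "sets ?D = PiM T (\<lambda>_. borel)" "sets ?E = PiM T (\<lambda>_. borel)" by auto
  have box: "prob_space K \<Longrightarrow> (\<And>x. x \<in> T \<Longrightarrow> Z x \<in> borel_measurable K) \<Longrightarrow> (\<And>x. A x \<in> sets borel) \<Longrightarrow>
     complex_of_real (measure (distr K (PiM T (\<lambda>_. borel)) (\<lambda>\<omega>. \<lambda>x\<in>T. Z x \<omega>)) (Pi\<^sub>E T A))
     = (CLINT \<omega>|K. of_real (\<Prod>x\<in>T. indicator (A x) (Z x \<omega>)) * iexp (\<Sum>x\<in>T - T. 0 * Z x \<omega>))"
    for K :: "'c measure" and Z :: "'i \<Rightarrow> 'c \<Rightarrow> real" and A
  proof -
    assume "prob_space K" and Z: "\<And>x. x \<in> T \<Longrightarrow> Z x \<in> borel_measurable K" and [measurable]: "\<And>x. A x \<in> sets borel"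
    interpret prob_space K by fact
    have [measurable]: "(\<lambda>\<omega>. \<lambda>x\<in>T. Z x \<omega>) \<in> K \<rightarrow>\<^sub>M PiM T (\<lambda>_. borel)"
      using Z by (auto intro!: measurable_restrict)
    have PA: "Pi\<^sub>E T A \<in> sets (PiM T (\<lambda>_. borel))" using \<open>finite T\<close> by (intro sets_PiM_I_finite) auto
    let ?S = "(\<lambda>\<omega>. \<lambda>x\<in>T. Z x \<omega>) -` Pi\<^sub>E T A \<inter> space K"
    have "measure (distr K (PiM T (\<lambda>_. borel)) (\<lambda>\<omega>. \<lambda>x\<in>T. Z x \<omega>)) (Pi\<^sub>E T A) = prob ?S"
      by (rule measure_distr) (use PA in auto)
    also have "\<dots> = (\<integral>\<omega>. indicator ?S \<omega> \<partial>K)" by simp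
    also have "\<dots> = (\<integral>\<omega>. (\<Prod>x\<in>T. indicator (A x) (Z x \<omega>)) \<partial>K)"
    proof (rule Bochner_Integration.integral_cong[OF refl])
      fix \<omega> assume w: "\<omega> \<in> space K"
      have "(\<Prod>x\<in>T. indicator (A x) (Z x \<omega>)) = (of_bool (\<forall>x\<in>T. Z x \<omega> \<in> A x) :: real)"
        using \<open>finite T\<close> by (auto simp: indicator_def)
      also have "\<dots> = indicator ?S \<omega>" using w by (auto simp: PiE_iff indicator_def)
      finally show "indicator ?S \<omega> = (\<Prod>x\<in>T. indicator (A x) (Z x \<omega>) :: real)" by simp
    qed
    finally show ?thesis by (simp del: of_real_prod)
  qed
  interpret D: prob_space ?D by (rule M.prob_space_distr) measurable
  interpret E: prob_space ?E by (rule N.prob_space_distr) measurable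
  fix A :: "'i \<Rightarrow> real set" assume A: "\<And>i. i \<in> T \<Longrightarrow> A i \<in> sets borel"
  \<comment> \<open>\<open>A\<close> is known to be Borel only on \<open>T\<close>, while the
    conversion asks for a Borel set at every index.\<close>
  define A' where "A' i = (if i \<in> T then A i else {})" for i
  have A': "A' i \<in> sets borel" for i using A by (simp add: A'_def)
  have "complex_of_real (measure ?D (Pi\<^sub>E T A')) = of_real (measure ?E (Pi\<^sub>E T A'))"
    using char_family_partial[where S=T and a="\<lambda>_. 0", OF assms(1-3) X Y eq A' subset_refl]
      box[OF assms(1) X A'] box[OF assms(2) Y A'] by simp
  moreover have "Pi\<^sub>E T A' = Pi\<^sub>E T A" by (rule PiE_cong) (simp add: A'_def)
  ultimately show "emeasure ?D (Pi\<^sub>E T A) = emeasure ?E (Pi\<^sub>E T A)"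
    by (simp add: D.emeasure_eq_measure E.emeasure_eq_measure)
next
  interpret M: prob_space M by fact
  interpret D: prob_space ?D by (rule M.prob_space_distr) (use X in \<open>auto intro!: measurable_restrict\<close>)
  show "range (\<lambda>_::nat. \<Pi>\<^sub>E x\<in>T. UNIV) \<subseteq> prod_algebra T (\<lambda>_. borel)"
    using \<open>finite T\<close> by (auto intro!: prod_algebraI_finite)
  show "(\<Union>i::nat. \<Pi>\<^sub>E x\<in>T. UNIV) = space (Pi\<^sub>M T (\<lambda>_. borel))" by (simp add: space_PiM)
  show "emeasure ?D (\<Pi>\<^sub>E x\<in>T. UNIV) \<noteq> \<infinity>" for i :: nat by (simp add: D.emeasure_eq_measure)
qed

section \<open>Gaussian integration by parts\<close>

lemma DERIV_std_normal_density:
  "(std_normal_density has_real_derivative - x * std_normal_density x) (at x)"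
proof -
  have "((\<lambda>x. (1 / sqrt (2 * pi)) * exp (- x\<^sup>2 / 2)) has_real_derivative
      (1 / sqrt (2 * pi)) * (exp (- x\<^sup>2 / 2) * (- x))) (at x)"
    by (rule DERIV_cmult) (auto intro!: derivative_eq_intros)
  then show ?thesis by (simp add: std_normal_density_def[abs_def] mult_ac)
qed

lemma std_normal_density_tendsto_0:
  "(std_normal_density \<longlongrightarrow> 0) at_top" "(std_normal_density \<longlongrightarrow> 0) at_bot"
proof -
  have e: "std_normal_density = (\<lambda>x. (1 / sqrt (2 * pi)) * exp (- (1 / 2 * x\<^sup>2)))"
    by (auto simp: std_normal_density_def)
  show "(std_normal_density \<longlongrightarrow> 0) at_top" "(std_normal_density \<longlongrightarrow> 0) at_bot"
    unfolding e by real_asymp+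
qed

text \<open>Stein's identity. The derivative of \<open>std_normal_density x * \<phi> x\<close> is
  the density times \<open>\<phi>' x - x * \<phi> x\<close>, and boundedness of
  \<open>\<phi>\<close> makes the boundary terms at both infinities vanish.\<close>

lemma std_normal_ibp:
  fixes \<phi> :: "real \<Rightarrow> real"
  assumes d: "\<And>x. (\<phi> has_real_derivative \<phi>' x) (at x)" and c: "\<And>x. isCont \<phi>' x"
    and B: "\<And>x. \<bar>\<phi> x\<bar> \<le> B" and B': "\<And>x. \<bar>\<phi>' x\<bar> \<le> B'"
  shows "(\<integral>x. x * \<phi> x \<partial>std_normal_distribution) = (\<integral>x. \<phi>' x \<partial>std_normal_distribution)"
proof -
  interpret real_distribution std_normal_distribution by (rule real_dist_normal_dist)
  have [measurable]: "\<phi> \<in> borel_measurable borel" "\<phi>' \<in> borel_measurable borel"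
    using d c by (auto intro!: borel_measurable_continuous_onI continuous_at_imp_continuous_on dest: DERIV_isCont)
  let ?F = "\<lambda>x. std_normal_density x * \<phi> x"
  let ?f = "\<lambda>x. std_normal_density x * (\<phi>' x - x * \<phi> x)"
  have i1: "integrable std_normal_distribution (\<lambda>x. x * \<phi> x)"
  proof (rule Bochner_Integration.integrable_bound)
    show "integrable std_normal_distribution (\<lambda>x. x * B)" using integrable_std_normal_power[of 1] by simp
    have "\<bar>x * \<phi> x\<bar> \<le> \<bar>x * B\<bar>" for x
      using B[of x] by (auto simp: abs_mult intro!: mult_left_mono)
    then show "AE x in std_normal_distribution. norm (x * \<phi> x) \<le> norm (x * B)" by simp
  qed measurable
  moreover have i2: "integrable std_normal_distribution \<phi>'"
    by (rule integrable_const_bound[where B=B']) (use B' in auto)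
  ultimately have i: "integrable std_normal_distribution (\<lambda>x. x * \<phi> x)" "integrable std_normal_distribution \<phi>'" .
  then have "integrable std_normal_distribution (\<lambda>x. \<phi>' x - x * \<phi> x)" by auto
  then have fi: "integrable lborel ?f" by (subst (asm) integrable_density) auto
  have "(LBINT x=-\<infinity>..\<infinity>. ?f x) = 0 - 0"
  proof (rule interval_integral_FTC_integrable)
    show "(?F has_vector_derivative ?f x) (at x)" for x
      unfolding has_real_derivative_iff_has_vector_derivative[symmetric]
      by (auto intro!: derivative_eq_intros DERIV_std_normal_density d simp: algebra_simps)
    show "isCont ?f x" for x
      using c DERIV_isCont[OF DERIV_std_normal_density] DERIV_isCont[OF d] by (auto intro!: continuous_intros)
    show "set_integrable lborel (einterval (- \<infinity>) \<infinity>) ?f"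
      using fi by (simp add: set_integrable_def)
    have "(?F \<longlongrightarrow> 0) K" if "(std_normal_density \<longlongrightarrow> 0) K" for K
    proof (rule Lim_null_comparison)
      show "\<forall>\<^sub>F x in K. norm (?F x) \<le> std_normal_density x * B"
        using B by (intro always_eventually allI) (simp add: abs_mult mult_left_mono)
      show "((\<lambda>x. std_normal_density x * B) \<longlongrightarrow> 0) K" using that by (rule tendsto_mult_left_zero)
    qed
    then have "(?F \<longlongrightarrow> 0) at_top" "(?F \<longlongrightarrow> 0) at_bot" using std_normal_density_tendsto_0 by blast+
    then show "((?F \<circ> real_of_ereal) \<longlongrightarrow> 0) (at_right (- \<infinity>))" "((?F \<circ> real_of_ereal) \<longlongrightarrow> 0) (at_left \<infinity>)"
      by (simp_all only: ereal_tendsto_simps)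
  qed auto
  then have "(\<integral>x. ?f x \<partial>lborel) = 0"
    by (simp add: interval_lebesgue_integral_def set_lebesgue_integral_def)
  then have "(\<integral>x. \<phi>' x - x * \<phi> x \<partial>std_normal_distribution) = 0"
    by (subst integral_density) auto
  then show ?thesis using i by simp
qed

section \<open>Moments and increments of a finite Gaussian process\<close>

lemma cgp_measurable: "centered_gaussian_process M T X \<Longrightarrow> x \<in> T \<Longrightarrow> X x \<in> borel_measurable M"
  by (auto simp: centered_gaussian_process_def)

lemma cgp_prob_space: "centered_gaussian_process M T X \<Longrightarrow> prob_space M"
  by (auto simp: centered_gaussian_process_def)

lemma cgp_gaussian_rv_one:
  assumes "centered_gaussian_process M T X" "finite T" "x \<in> T"
  shows "gaussian_rv M (X x)"
proof -
  have "(\<Sum>y\<in>T. (if y = x then 1 else 0) * X y \<omega>) = X x \<omega>" for \<omega>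
    using assms by (simp add: if_distrib[of "\<lambda>x. x * _"] cong: if_cong)
  then show ?thesis using cgp_gaussian_rv[OF assms(1,2), of "\<lambda>y. if y = x then 1 else 0"] by simp
qed

lemma cgp_gaussian_diff:
  assumes X: "centered_gaussian_process M T X" "finite T" and xy: "x \<in> T" "y \<in> T"
  shows "gaussian_rv M (\<lambda>\<omega>. X x \<omega> - X y \<omega>)"
proof -
  have "(\<Sum>z\<in>T. ((if z = x then 1 else 0) - (if z = y then 1 else 0)) * X z \<omega>) = X x \<omega> - X y \<omega>" for \<omega>
    using X(2) xy by (simp add: left_diff_distrib sum_subtractf if_distrib[of "\<lambda>x. x * _"] cong: if_cong)
  then show ?thesis
    using cgp_gaussian_rv[OF X, of "\<lambda>z. (if z = x then 1 else 0) - (if z = y then 1 else 0)"] by simp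
qed

lemma square_integrable_mult:
  fixes f g :: "'a \<Rightarrow> real"
  assumes [measurable]: "f \<in> borel_measurable M" "g \<in> borel_measurable M"
    and "integrable M (\<lambda>x. (f x)\<^sup>2)" "integrable M (\<lambda>x. (g x)\<^sup>2)"
  shows "integrable M (\<lambda>x. f x * g x)"
proof (rule Bochner_Integration.integrable_bound)
  show "integrable M (\<lambda>x. (f x)\<^sup>2 + (g x)\<^sup>2)" using assms by simp
  have "\<bar>a * b\<bar> \<le> a\<^sup>2 + b\<^sup>2" for a b :: real
  proof -
    have "0 \<le> \<bar>a\<bar> * \<bar>b\<bar>" by simp
    then have "\<bar>a\<bar> * \<bar>b\<bar> \<le> \<bar>a\<bar>\<^sup>2 + \<bar>b\<bar>\<^sup>2"
      using sum_squares_bound[of "\<bar>a\<bar>" "\<bar>b\<bar>"] by linarith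
    then show ?thesis by (simp add: abs_mult)
  qed
  then show "AE x in M. norm (f x * g x) \<le> norm ((f x)\<^sup>2 + (g x)\<^sup>2)" by (auto simp: abs_mult)
qed measurable

lemma cgp_integrable_mult:
  assumes "centered_gaussian_process M T X" "finite T" "x \<in> T" "y \<in> T"
  shows "integrable M (\<lambda>\<omega>. X x \<omega> * X y \<omega>)"
  using assms cgp_gaussian_rv_one[OF assms(1,2)]
  by (intro square_integrable_mult gaussian_rv_integrable_power) (auto simp: cgp_measurable)

text \<open>Conditioning on \<open>U = X None\<close>: the family has the same law as
  \<open>(U, c U / v + (X' - c U' / v))\<close> with an independent copy \<open>(U', X')\<close>, which reduces the
  identity to the one-dimensional case.\<close>

lemma gaussian_ibp:
  fixes M :: "'a measure" and X :: "'i option \<Rightarrow> 'a \<Rightarrow> real" and F F' :: "('i \<Rightarrow> real) \<Rightarrow> real" and T :: "'i set"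
  defines "J \<equiv> insert None (Some ` T)"
  defines "c \<equiv> \<lambda>y. \<integral>\<omega>. X None \<omega> * X (Some y) \<omega> \<partial>M"
  assumes X: "centered_gaussian_process M J X" and T: "finite T"
    and [measurable]: "F \<in> borel_measurable (PiM T (\<lambda>_. borel))" "F' \<in> borel_measurable (PiM T (\<lambda>_. borel))"
    and FT: "\<And>z. F (restrict z T) = F z" "\<And>z. F' (restrict z T) = F' z"
    and d: "\<And>z t. ((\<lambda>t. F (\<lambda>y. z y + t * c y)) has_real_derivative F' (\<lambda>y. z y + t * c y)) (at t)"
    and cont: "\<And>z t. isCont (\<lambda>t. F' (\<lambda>y. z y + t * c y)) t"
    and B: "\<And>z. \<bar>F z\<bar> \<le> B" "\<And>z. \<bar>F' z\<bar> \<le> B'"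
  shows "(\<integral>\<omega>. X None \<omega> * F (\<lambda>y. X (Some y) \<omega>) \<partial>M) = (\<integral>\<omega>. F' (\<lambda>y. X (Some y) \<omega>) \<partial>M)"
proof -
  interpret prob_space M by (rule cgp_prob_space[OF X])
  have J: "finite J" "None \<in> J" "\<And>y. y \<in> T \<Longrightarrow> Some y \<in> J" using T by (auto simp: J_def)
  define U where "U = X None"
  have U: "gaussian_rv M U" unfolding U_def by (rule cgp_gaussian_rv_one[OF X J(1,2)])
  note [measurable] = gaussian_rv_measurable[OF U]
  have mX[measurable]: "X x \<in> borel_measurable M" if "x \<in> J" for x using X that by (rule cgp_measurable)
  define v where "v = (\<integral>\<omega>. (U \<omega>)\<^sup>2 \<partial>M)"
  have "v \<ge> 0" by (simp add: v_def)
  then consider "v = 0" | "v > 0" by linarith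
  then show ?thesis
  proof cases
    \<comment> \<open>A degenerate \<open>U\<close> has zero covariance with every coordinate in
      \<open>T\<close>, so \<open>F\<close> is constant in direction \<open>c\<close> and its
      derivative \<open>F'\<close> is zero.\<close>
    case 1
    have U0: "AE \<omega> in M. U \<omega> = 0" by (rule gaussian_rv_AE_0[OF U]) (use 1 in \<open>simp add: v_def\<close>)
    have c0: "c y = 0" if "y \<in> T" for y
    proof -
      have "c y = (\<integral>\<omega>. 0 \<partial>M)"
        unfolding c_def U_def[symmetric] using U0 J(3)[OF that] by (intro integral_cong_AE) auto
      then show ?thesis by simp
    qed
    have "F' z = 0" for z
    proof -
      have "F (\<lambda>y. z y + t * c y) = F z" for t
      proof -
        have "restrict (\<lambda>y. z y + t * c y) T = restrict z T" using c0 by (auto simp: restrict_def)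
        then show ?thesis by (metis FT(1))
      qed
      then have "((\<lambda>t. F z) has_real_derivative F' z) (at 0)" using d[of z 0] by simp
      then show ?thesis using DERIV_unique DERIV_const by blast
    qed
    moreover have "(\<integral>\<omega>. X None \<omega> * F (\<lambda>y. X (Some y) \<omega>) \<partial>M) = (\<integral>\<omega>. 0 \<partial>M)"
    proof (intro integral_cong_AE)
      have "(\<lambda>\<omega>. X None \<omega> * F (\<lambda>y\<in>T. X (Some y) \<omega>)) \<in> borel_measurable M"
        using J by (auto intro!: borel_measurable_times measurable_compose[OF measurable_restrict])
      then show "(\<lambda>\<omega>. X None \<omega> * F (\<lambda>y. X (Some y) \<omega>)) \<in> borel_measurable M" by (simp add: FT)
    qed (use U0 in \<open>auto simp: U_def\<close>)
    ultimately show ?thesis by simp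
  next
    case 2
    interpret PP: pair_prob_space M M ..
    define Y where "Y x p = (case x of None \<Rightarrow> U (fst p)
        | Some y \<Rightarrow> (c y / v) * U (fst p) + (X (Some y) (snd p) - (c y / v) * U (snd p)))" for x p
    have mY: "Y x \<in> borel_measurable (M \<Otimes>\<^sub>M M)" if "x \<in> J" for x
      using that J unfolding Y_def[abs_def] by (cases x) auto
    have char: "(CLINT \<omega>|M. iexp (\<Sum>x\<in>J. a x * X x \<omega>)) = (CLINT p|(M \<Otimes>\<^sub>M M). iexp (\<Sum>x\<in>J. a x * Y x p))" for a
    proof -
      \<comment> \<open>The regression coefficient of \<open>S\<close> on \<open>U\<close>, that is,
        the mean of \<open>U * S\<close> is \<open>\<kappa> * v\<close>. It makes
        \<open>S - \<kappa> * U\<close> uncorrelated with \<open>U\<close>, whence the variances of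
        \<open>?A\<close> and \<open>?B\<close> add up to that of
        \<open>a None * U + S\<close>.\<close>
      define \<kappa> where "\<kappa> = (\<Sum>y\<in>T. a (Some y) * (c y / v))"
      define S where "S \<omega> = (\<Sum>y\<in>T. a (Some y) * X (Some y) \<omega>)" for \<omega>
      have sumJ: "(\<Sum>x\<in>J. f x) = f None + (\<Sum>y\<in>T. f (Some y))" for f :: "'i option \<Rightarrow> real"
        using T unfolding J_def by (subst sum.insert) (auto simp: sum.reindex)
      let ?A = "\<lambda>\<omega>. (a None + \<kappa>) * U \<omega>" and ?B = "\<lambda>\<omega>. S \<omega> - \<kappa> * U \<omega>"
      have gX: "gaussian_rv M (\<lambda>\<omega>. b * U \<omega> + d * S \<omega>)" for b d
        using cgp_gaussian_rv[OF X J(1), of "\<lambda>x. case x of None \<Rightarrow> b | Some y \<Rightarrow> d * a (Some y)"]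
        by (simp add: sumJ S_def U_def sum_distrib_left mult.assoc)
      have A: "gaussian_rv M ?A" using gX[of "a None + \<kappa>" 0] by simp
      have B: "gaussian_rv M ?B" using gX[of "-\<kappa>" 1] by (simp add: algebra_simps)
      have S: "gaussian_rv M S" using gX[of 0 1] by simp
      note [measurable] = gaussian_rv_measurable[OF S]
      have i: "integrable M (\<lambda>\<omega>. (U \<omega>)\<^sup>2)" "integrable M (\<lambda>\<omega>. (S \<omega>)\<^sup>2)" "integrable M (\<lambda>\<omega>. U \<omega> * S \<omega>)"
        using gaussian_rv_integrable_power[OF U] gaussian_rv_integrable_power[OF S]
        by (auto intro!: square_integrable_mult)
      have US: "(\<integral>\<omega>. U \<omega> * S \<omega> \<partial>M) = \<kappa> * v"
      proof -
        have "(\<integral>\<omega>. U \<omega> * S \<omega> \<partial>M) = (\<integral>\<omega>. (\<Sum>y\<in>T. a (Some y) * (X None \<omega> * X (Some y) \<omega>)) \<partial>M)"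
          by (simp add: S_def sum_distrib_left U_def mult_ac)
        also have "\<dots> = (\<Sum>y\<in>T. a (Some y) * c y)"
          using J cgp_integrable_mult[OF X J(1)]
          by (subst Bochner_Integration.integral_sum) (auto simp: c_def)
        finally show ?thesis using 2 by (simp add: \<kappa>_def sum_distrib_right)
      qed
      have q: "(\<integral>\<omega>. (b * U \<omega> + d * S \<omega>)\<^sup>2 \<partial>M) = b\<^sup>2 * v + 2 * b * d * (\<kappa> * v) + d\<^sup>2 * (\<integral>\<omega>. (S \<omega>)\<^sup>2 \<partial>M)" for b d
      proof -
        have "(b * U \<omega> + d * S \<omega>)\<^sup>2 = b\<^sup>2 * (U \<omega>)\<^sup>2 + (2 * b * d * (U \<omega> * S \<omega>) + d\<^sup>2 * (S \<omega>)\<^sup>2)" for \<omega>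
          by (simp add: power2_eq_square algebra_simps)
        then show ?thesis using i US by (simp add: v_def)
      qed
      have "(\<Sum>x\<in>J. a x * Y x (\<omega>, \<omega>')) = ?A \<omega> + ?B \<omega>'" for \<omega> \<omega>'
      proof -
        have "\<kappa> * u = (\<Sum>y\<in>T. a (Some y) * ((c y / v) * u))" for u
          by (simp add: \<kappa>_def sum_distrib_right mult.assoc)
        then show ?thesis
          by (simp only: sumJ Y_def S_def option.case fst_conv snd_conv distrib_left distrib_right
              right_diff_distrib sum.distrib sum_subtractf)
      qed
      then have "(CLINT p|(M \<Otimes>\<^sub>M M). iexp (\<Sum>x\<in>J. a x * Y x p))
          = (CLINT p|(M \<Otimes>\<^sub>M M). iexp (1 * (case p of (\<omega>, \<xi>) \<Rightarrow> ?A \<omega> + ?B \<xi>)))"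
        by (intro Bochner_Integration.integral_cong) (simp_all only: split_paired_all prod.case mult_1)
      also have "\<dots> = of_real (exp (- (1\<^sup>2 * ((\<integral>\<omega>. (?A \<omega>)\<^sup>2 \<partial>M) + (\<integral>\<omega>. (?B \<omega>)\<^sup>2 \<partial>M))) / 2))"
        by (subst gaussian_rv_char[OF gaussian_rv_indep_sum(1)[OF A prob_space_axioms B prob_space_axioms]])
           (use gaussian_rv_indep_sum(2)[OF A prob_space_axioms B prob_space_axioms] in \<open>simp add: split_beta\<close>)
      also have "(\<integral>\<omega>. (?A \<omega>)\<^sup>2 \<partial>M) + (\<integral>\<omega>. (?B \<omega>)\<^sup>2 \<partial>M) = (\<integral>\<omega>. (a None * U \<omega> + S \<omega>)\<^sup>2 \<partial>M)"
        using q[of "a None + \<kappa>" 0] q[of "-\<kappa>" 1] q[of "a None" 1]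
        by (simp add: algebra_simps power2_eq_square)
      also have "of_real (exp (- (1\<^sup>2 * \<dots>) / 2)) = (CLINT \<omega>|M. iexp (1 * (a None * U \<omega> + S \<omega>)))"
        using gX[of "a None" 1] by (subst gaussian_rv_char) auto
      also have "\<dots> = (CLINT \<omega>|M. iexp (\<Sum>x\<in>J. a x * X x \<omega>))"
        by (simp add: sumJ S_def U_def)
      finally show ?thesis by simp
    qed
    have law: "distr M (PiM J (\<lambda>_. borel)) (\<lambda>\<omega>. \<lambda>x\<in>J. X x \<omega>) = distr (M \<Otimes>\<^sub>M M) (PiM J (\<lambda>_. borel)) (\<lambda>p. \<lambda>x\<in>J. Y x p)"
      by (rule distr_family_eqI_char[OF prob_space_axioms _ J(1) mX mY char]) unfold_locales
    have transfer: "(\<integral>\<omega>. G (\<lambda>x\<in>J. X x \<omega>) \<partial>M) = (\<integral>p. G (\<lambda>x\<in>J. Y x p) \<partial>(M \<Otimes>\<^sub>M M))"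
      if [measurable]: "G \<in> borel_measurable (PiM J (\<lambda>_. borel))" for G :: "_ \<Rightarrow> real"
    proof -
      have [measurable]: "(\<lambda>\<omega>. \<lambda>x\<in>J. X x \<omega>) \<in> M \<rightarrow>\<^sub>M PiM J (\<lambda>_. borel)"
        "(\<lambda>p. \<lambda>x\<in>J. Y x p) \<in> M \<Otimes>\<^sub>M M \<rightarrow>\<^sub>M PiM J (\<lambda>_. borel)"
        using mY by (auto intro!: measurable_restrict)
      show ?thesis using arg_cong[OF law, of "\<lambda>N. integral\<^sup>L N G"] by (simp add: integral_distr)
    qed
    have mT: "(\<lambda>z. \<lambda>y\<in>T. z (Some y)) \<in> PiM J (\<lambda>_. borel) \<rightarrow>\<^sub>M PiM T (\<lambda>_. borel::real measure)"
      using J by (intro measurable_restrict) auto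
    have [measurable]: "(\<lambda>z. F (\<lambda>y\<in>T. z (Some y))) \<in> borel_measurable (PiM J (\<lambda>_. borel))"
      "(\<lambda>z. F' (\<lambda>y\<in>T. z (Some y))) \<in> borel_measurable (PiM J (\<lambda>_. borel))"
      by (rule measurable_compose[OF mT]; measurable)+
    have rJ: "(\<lambda>y\<in>T. (\<lambda>x\<in>J. f x) (Some y)) = (\<lambda>y\<in>T. f (Some y))" for f :: "'i option \<Rightarrow> real"
      using J by (auto simp: restrict_def)
    define R where "R y \<omega> = X (Some y) \<omega> - (c y / v) * U \<omega>" for y \<omega>
    have Yz: "F (\<lambda>y\<in>T. Y (Some y) (\<omega>, \<omega>')) = F (\<lambda>y. R y \<omega>' + (U \<omega> / v) * c y)"
        "F' (\<lambda>y\<in>T. Y (Some y) (\<omega>, \<omega>')) = F' (\<lambda>y. R y \<omega>' + (U \<omega> / v) * c y)" for \<omega> \<omega>'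
      by (simp_all add: FT Y_def R_def algebra_simps)
    have mFY[measurable]: "(\<lambda>p. F (\<lambda>y\<in>T. Y (Some y) p)) \<in> borel_measurable (M \<Otimes>\<^sub>M M)"
      "(\<lambda>p. F' (\<lambda>y\<in>T. Y (Some y) p)) \<in> borel_measurable (M \<Otimes>\<^sub>M M)"
      using mY J by (auto intro!: measurable_compose[OF measurable_restrict])
    have Ui: "integrable (M \<Otimes>\<^sub>M M) (\<lambda>p. U (fst p))"
    proof -
      have "gaussian_rv M (\<lambda>_. 0)" using cgp_gaussian_rv[OF X J(1), of "\<lambda>_. 0"] by simp
      from gaussian_rv_integrable_self[OF gaussian_rv_indep_sum(1)[OF U prob_space_axioms this prob_space_axioms]]
      show ?thesis by (simp add: split_beta')
    qed
    have i1: "integrable (M \<Otimes>\<^sub>M M) (\<lambda>(\<omega>, \<omega>'). U \<omega> * F (\<lambda>y\<in>T. Y (Some y) (\<omega>, \<omega>')))"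
    proof (rule Bochner_Integration.integrable_bound)
      show "integrable (M \<Otimes>\<^sub>M M) (\<lambda>p. B * U (fst p))" using Ui by simp
      show "AE p in M \<Otimes>\<^sub>M M. norm (case p of (\<omega>, \<omega>') \<Rightarrow> U \<omega> * F (\<lambda>y\<in>T. Y (Some y) (\<omega>, \<omega>'))) \<le> norm (B * U (fst p))"
      proof (rule AE_I2)
        fix p :: "'a \<times> 'a"
        have "\<bar>U (fst p) * F z\<bar> \<le> \<bar>B * U (fst p)\<bar>" for z
          using mult_left_mono[OF order_trans[OF B(1)[of z] abs_ge_self], of "\<bar>U (fst p)\<bar>"]
          by (simp add: abs_mult mult.commute)
        then show "norm (case p of (\<omega>, \<omega>') \<Rightarrow> U \<omega> * F (\<lambda>y\<in>T. Y (Some y) (\<omega>, \<omega>'))) \<le> norm (B * U (fst p))"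
          by (simp add: split_beta)
      qed
    qed (unfold split_beta prod.collapse, measurable)
    have i2: "integrable (M \<Otimes>\<^sub>M M) (\<lambda>(\<omega>, \<omega>'). F' (\<lambda>y\<in>T. Y (Some y) (\<omega>, \<omega>')))"
      by (rule PP.integrable_const_bound[where B=B']) (auto simp: B(2) split_beta)
    \<comment> \<open>With \<open>\<omega>'\<close> fixed the residuals are constants, and
      \<open>U\<close> moves the argument along a line in direction \<open>c\<close> at parameter
      \<open>U / v\<close>. Substituting \<open>U = sqrt v * x\<close> brings one factor
      \<open>sqrt v\<close> from \<open>U\<close> and one factor \<open>sqrt v / v\<close> from the
      chain rule; their product is 1, so Stein's identity applies with no leftover constant.\<close>
    have inner: "(\<integral>\<omega>. U \<omega> * F (\<lambda>y. R y \<omega>' + (U \<omega> / v) * c y) \<partial>M) = (\<integral>\<omega>. F' (\<lambda>y. R y \<omega>' + (U \<omega> / v) * c y) \<partial>M)" for \<omega>'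
    proof -
      define z where "z y = R y \<omega>'" for y
      define \<phi> where "\<phi> t = F (\<lambda>y. z y + t * c y)" for t
      define \<phi>' where "\<phi>' t = F' (\<lambda>y. z y + t * c y)" for t
      have d\<phi>: "(\<phi> has_real_derivative \<phi>' t) (at t)" and c\<phi>: "isCont \<phi>' t" for t
        using d[where z=z and t=t] cont[where z=z and t=t] by (auto simp: \<phi>_def[abs_def] \<phi>'_def[abs_def])
      have [measurable]: "\<phi> \<in> borel_measurable borel" "\<phi>' \<in> borel_measurable borel"
        using d\<phi> c\<phi> by (auto intro!: borel_measurable_continuous_onI continuous_at_imp_continuous_on dest: DERIV_isCont)
      have v: "sqrt v > 0" "v = sqrt v * sqrt v" using 2 by auto
      let ?\<psi> = "\<lambda>x. \<phi> (sqrt v * x / v)" and ?\<psi>' = "\<lambda>x. \<phi>' (sqrt v * x / v) * (sqrt v / v)"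
      have "(\<integral>x. x * ?\<psi> x \<partial>std_normal_distribution) = (\<integral>x. ?\<psi>' x \<partial>std_normal_distribution)"
      proof (rule std_normal_ibp)
        show "(?\<psi> has_real_derivative ?\<psi>' x) (at x)" for x
          by (rule DERIV_chain2[OF d\<phi>]) (use 2 in \<open>auto intro!: derivative_eq_intros\<close>)
        show "isCont ?\<psi>' x" for x
          using 2 by (intro continuous_intros isCont_o2[OF _ c\<phi>]) auto
        show "\<bar>?\<psi> x\<bar> \<le> B" for x using B by (simp add: \<phi>_def)
        show "\<bar>?\<psi>' x\<bar> \<le> B' * (sqrt v / v)" for x
          using B 2 by (simp add: \<phi>'_def abs_mult mult_right_mono divide_right_mono)
      qed
      then have "sqrt v * (\<integral>x. x * ?\<psi> x \<partial>std_normal_distribution) = (sqrt v * (sqrt v / v)) * (\<integral>x. \<phi>' (sqrt v * x / v) \<partial>std_normal_distribution)"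
        by simp
      also have "sqrt v * (sqrt v / v) = 1" using 2 by (simp add: field_simps)
      finally have *: "(\<integral>x. sqrt v * x * ?\<psi> x \<partial>std_normal_distribution) = (\<integral>x. \<phi>' (sqrt v * x / v) \<partial>std_normal_distribution)"
        by (simp add: mult.assoc)
      have "(\<integral>\<omega>. U \<omega> * \<phi> (U \<omega> / v) \<partial>M) = (\<integral>\<omega>. \<phi>' (U \<omega> / v) \<partial>M)"
        using * gaussian_rv_integral[OF U, of "\<lambda>u. u * \<phi> (u / v)"] gaussian_rv_integral[OF U, of "\<lambda>u. \<phi>' (u / v)"]
        by (simp add: v_def)
      then show ?thesis by (simp add: \<phi>_def \<phi>'_def z_def)
    qed
    have "(\<integral>\<omega>. X None \<omega> * F (\<lambda>y. X (Some y) \<omega>) \<partial>M)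
        = (\<integral>p. U (fst p) * F (\<lambda>y\<in>T. Y (Some y) p) \<partial>(M \<Otimes>\<^sub>M M))"
    proof -
      have "(\<lambda>z. z None * F (\<lambda>y\<in>T. z (Some y))) \<in> borel_measurable (PiM J (\<lambda>_. borel))"
        using J(2) by (intro borel_measurable_times) auto
      from transfer[OF this] show ?thesis using J by (simp only: rJ) (simp add: FT Y_def)
    qed
    also have "\<dots> = (\<integral>\<omega>'. (\<integral>\<omega>. U \<omega> * F (\<lambda>y\<in>T. Y (Some y) (\<omega>, \<omega>')) \<partial>M) \<partial>M)"
      using PP.integral_snd[OF i1] by (simp add: split_beta')
    also have "\<dots> = (\<integral>\<omega>'. (\<integral>\<omega>. F' (\<lambda>y\<in>T. Y (Some y) (\<omega>, \<omega>')) \<partial>M) \<partial>M)"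
      unfolding Yz inner ..
    also have "\<dots> = (\<integral>p. F' (\<lambda>y\<in>T. Y (Some y) p) \<partial>(M \<Otimes>\<^sub>M M))"
      using PP.integral_snd[OF i2] by (simp add: split_beta')
    also have "\<dots> = (\<integral>\<omega>. F' (\<lambda>y. X (Some y) \<omega>) \<partial>M)"
    proof -
      have "(\<lambda>z. F' (\<lambda>y\<in>T. z (Some y))) \<in> borel_measurable (PiM J (\<lambda>_. borel))" by measurable
      from transfer[OF this] show ?thesis by (simp only: rJ) (simp add: FT)
    qed
    finally show ?thesis .
  qed
qed

section \<open>The Sudakov-Fernique inequality\<close>

lemma (in pair_sigma_finite)
  fixes f g :: "_ \<Rightarrow> real"
  assumes f: "integrable M1 f" and g: "integrable M2 g"
  shows integrable_times_fst_snd: "integrable (M1 \<Otimes>\<^sub>M M2) (\<lambda>p. f (fst p) * g (snd p))"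
    and integral_times_fst_snd: "(\<integral>p. f (fst p) * g (snd p) \<partial>(M1 \<Otimes>\<^sub>M M2)) = (\<integral>x. f x \<partial>M1) * (\<integral>y. g y \<partial>M2)"
proof -
  have [measurable]: "f \<in> borel_measurable M1" "g \<in> borel_measurable M2" using f g by auto
  show i: "integrable (M1 \<Otimes>\<^sub>M M2) (\<lambda>p. f (fst p) * g (snd p))"
  proof (rule Fubini_integrable)
    show "integrable M1 (\<lambda>x. \<integral>y. norm (f (fst (x, y)) * g (snd (x, y))) \<partial>M2)"
      using f by (simp add: abs_mult)
    show "AE x in M1. integrable M2 (\<lambda>y. f (fst (x, y)) * g (snd (x, y)))" using g by simp
  qed measurable
  show "(\<integral>p. f (fst p) * g (snd p) \<partial>(M1 \<Otimes>\<^sub>M M2)) = (\<integral>x. f x \<partial>M1) * (\<integral>y. g y \<partial>M2)"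
    using integral_fst'[OF i] by simp
qed

lemma (in pair_prob_space)
  fixes f g :: "_ \<Rightarrow> real"
  shows integrable_fst_component: "integrable M1 f \<Longrightarrow> integrable (M1 \<Otimes>\<^sub>M M2) (\<lambda>p. f (fst p))"
    and integral_fst_component: "integrable M1 f \<Longrightarrow> (\<integral>p. f (fst p) \<partial>(M1 \<Otimes>\<^sub>M M2)) = (\<integral>x. f x \<partial>M1)"
    and integrable_snd_component: "integrable M2 g \<Longrightarrow> integrable (M1 \<Otimes>\<^sub>M M2) (\<lambda>p. g (snd p))"
    and integral_snd_component: "integrable M2 g \<Longrightarrow> (\<integral>p. g (snd p) \<partial>(M1 \<Otimes>\<^sub>M M2)) = (\<integral>y. g y \<partial>M2)"
  using integrable_times_fst_snd[of f "\<lambda>_. 1"] integral_times_fst_snd[of f "\<lambda>_. 1"]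
    integrable_times_fst_snd[of "\<lambda>_. 1" g] integral_times_fst_snd[of "\<lambda>_. 1" g]
  by (simp_all add: M1.prob_space M2.prob_space)

lemma integrable_Max:
  fixes X :: "'i \<Rightarrow> 'a \<Rightarrow> real"
  assumes "finite T" "T \<noteq> {}" and "\<And>x. x \<in> T \<Longrightarrow> integrable M (X x)"
  shows "integrable M (\<lambda>\<omega>. Max ((\<lambda>x. X x \<omega>) ` T))"
  using assms
proof (induction T rule: finite_ne_induct)
  case (insert x F)
  have "Max ((\<lambda>x. X x \<omega>) ` insert x F) = max (X x \<omega>) (Max ((\<lambda>x. X x \<omega>) ` F))" for \<omega>
    using insert by simp
  then show ?case using insert by (auto intro!: integrable_max)
qed simp

section \<open>The smoothed maximum and its Gibbs weights\<close>

definition log_sum_exp :: "real \<Rightarrow> 'i set \<Rightarrow> ('i \<Rightarrow> real) \<Rightarrow> real" where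
  "log_sum_exp \<beta> T z = ln (\<Sum>x\<in>T. exp (\<beta> * z x)) / \<beta>"

text \<open>Gibbs weights at inverse temperature \<open>\<beta>\<close>. They form the gradient of
  \<open>log_sum_exp\<close> and a probability vector on a finite nonempty \<open>T\<close>.\<close>

definition soft_weight :: "real \<Rightarrow> 'i set \<Rightarrow> 'i \<Rightarrow> ('i \<Rightarrow> real) \<Rightarrow> real" where
  "soft_weight \<beta> T x z = exp (\<beta> * z x) / (\<Sum>y\<in>T. exp (\<beta> * z y))"

lemma sum_exp_pos:
  fixes f :: "'i \<Rightarrow> real"
  assumes "finite T" "T \<noteq> {}"
  shows "(\<Sum>y\<in>T. exp (f y)) > 0"
  using assms by (auto intro!: sum_pos)

lemma soft_weight_nonneg: "0 \<le> soft_weight \<beta> T x z"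
  by (auto simp: soft_weight_def intro!: divide_nonneg_nonneg sum_nonneg)

lemma soft_weight_sum: "finite T \<Longrightarrow> T \<noteq> {} \<Longrightarrow> (\<Sum>x\<in>T. soft_weight \<beta> T x z) = 1"
  using sum_exp_pos[of T "\<lambda>x. \<beta> * z x"] by (simp add: soft_weight_def flip: sum_divide_distrib)

lemma soft_weight_le_1: "finite T \<Longrightarrow> x \<in> T \<Longrightarrow> soft_weight \<beta> T x z \<le> 1"
  using member_le_sum[of x T "\<lambda>x. soft_weight \<beta> T x z"] soft_weight_sum[of T \<beta> z] soft_weight_nonneg[of \<beta> T _ z]
  by force

lemma log_sum_exp_bounds:
  assumes T: "finite T" "T \<noteq> {}" and \<beta>: "\<beta> > 0"
  shows "Max (z ` T) \<le> log_sum_exp \<beta> T z" "log_sum_exp \<beta> T z \<le> Max (z ` T) + ln (card T) / \<beta>"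
proof -
  have "Max (z ` T) \<in> z ` T" using T by (intro Max_in) auto
  then obtain x where x: "x \<in> T" "z x = Max (z ` T)" by auto
  have "exp (\<beta> * Max (z ` T)) \<le> (\<Sum>y\<in>T. exp (\<beta> * z y))"
    using member_le_sum[of x T "\<lambda>y. exp (\<beta> * z y)"] x T by auto
  then have "\<beta> * Max (z ` T) \<le> ln (\<Sum>y\<in>T. exp (\<beta> * z y))"
    using sum_exp_pos[OF T] by (subst ln_ge_iff) auto
  then show "Max (z ` T) \<le> log_sum_exp \<beta> T z" using \<beta> by (simp add: log_sum_exp_def field_simps)
  have "(\<Sum>y\<in>T. exp (\<beta> * z y)) \<le> card T * exp (\<beta> * Max (z ` T))"
    using T \<beta> by (intro sum_bounded_above) auto
  then have "ln (\<Sum>y\<in>T. exp (\<beta> * z y)) \<le> ln (card T * exp (\<beta> * Max (z ` T)))"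
    using sum_exp_pos[OF T] by (subst ln_le_cancel_iff) (auto simp: card_gt_0_iff T)
  also have "\<dots> = ln (card T) + \<beta> * Max (z ` T)" using T by (subst ln_mult) (auto simp: card_gt_0_iff)
  finally show "log_sum_exp \<beta> T z \<le> Max (z ` T) + ln (card T) / \<beta>"
    using \<beta> by (simp add: log_sum_exp_def field_simps)
qed

lemma DERIV_log_sum_exp:
  assumes T: "finite T" "T \<noteq> {}" and \<beta>: "\<beta> > 0"
    and d: "\<And>x. x \<in> T \<Longrightarrow> ((\<lambda>\<theta>. z \<theta> x) has_real_derivative z' x) (at t)"
  shows "((\<lambda>\<theta>. log_sum_exp \<beta> T (z \<theta>)) has_real_derivative (\<Sum>x\<in>T. soft_weight \<beta> T x (z t) * z' x)) (at t)"
proof -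
  let ?S = "\<lambda>\<theta>. \<Sum>x\<in>T. exp (\<beta> * z \<theta> x)"
  have "(?S has_real_derivative (\<Sum>x\<in>T. exp (\<beta> * z t x) * (\<beta> * z' x))) (at t)"
    by (intro DERIV_sum DERIV_chain2[OF DERIV_exp] DERIV_cmult d)
  then have "((\<lambda>\<theta>. ln (?S \<theta>) / \<beta>) has_real_derivative (inverse (?S t) * (\<Sum>x\<in>T. exp (\<beta> * z t x) * (\<beta> * z' x))) / \<beta>) (at t)"
    by (intro DERIV_cdivide DERIV_chain2[OF DERIV_ln]) (use sum_exp_pos[OF T] in auto)
  moreover have "(inverse (?S t) * (\<Sum>x\<in>T. exp (\<beta> * z t x) * (\<beta> * z' x))) / \<beta> = (\<Sum>x\<in>T. soft_weight \<beta> T x (z t) * z' x)"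
  proof -
    have "(\<Sum>x\<in>T. exp (\<beta> * z t x) * (\<beta> * z' x)) = \<beta> * (\<Sum>x\<in>T. exp (\<beta> * z t x) * z' x)"
      by (simp add: sum_distrib_left mult_ac)
    moreover have "(\<Sum>x\<in>T. soft_weight \<beta> T x (z t) * z' x) = (\<Sum>x\<in>T. exp (\<beta> * z t x) * z' x) / ?S t"
      by (simp add: soft_weight_def sum_divide_distrib)
    ultimately show ?thesis using \<beta> by (simp add: divide_inverse)
  qed
  ultimately show ?thesis by (simp add: log_sum_exp_def)
qed

text \<open>The derivative is written as a function of the moved point, the shape in which
  \<open>gaussian_ibp\<close> takes the pair \<open>F\<close>, \<open>F'\<close>. The bracket is the
  deviation of \<open>c x\<close> from its Gibbs average.\<close>

lemma DERIV_soft_weight: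
  assumes T: "finite T" "x \<in> T"
  shows "((\<lambda>t. soft_weight \<beta> T x (\<lambda>y. z y + t * c y)) has_real_derivative
    (\<lambda>u. \<beta> * soft_weight \<beta> T x u * (c x - (\<Sum>y\<in>T. soft_weight \<beta> T y u * c y))) (\<lambda>y. z y + t * c y)) (at t)"
proof -
  let ?u = "\<lambda>t y. z y + t * c y"
  let ?S = "\<lambda>t. \<Sum>y\<in>T. exp (\<beta> * ?u t y)"
  have ne: "?S t \<noteq> 0" using sum_exp_pos[of T "\<lambda>y. \<beta> * ?u t y"] T by force
  have e: "((\<lambda>t. exp (\<beta> * ?u t y)) has_real_derivative exp (\<beta> * ?u t y) * (\<beta> * c y)) (at t)" for y
    by (auto intro!: derivative_eq_intros)
  have "((\<lambda>t. exp (\<beta> * ?u t x) / ?S t) has_real_derivative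
      (exp (\<beta> * ?u t x) * (\<beta> * c x) * ?S t - exp (\<beta> * ?u t x) * (\<Sum>y\<in>T. exp (\<beta> * ?u t y) * (\<beta> * c y))) / (?S t * ?S t)) (at t)"
    by (intro DERIV_divide DERIV_sum e ne)
  moreover have "(\<Sum>y\<in>T. exp (\<beta> * ?u t y) * (\<beta> * c y)) = \<beta> * ?S t * (\<Sum>y\<in>T. soft_weight \<beta> T y (?u t) * c y)"
  proof -
    have "(\<Sum>y\<in>T. exp (\<beta> * ?u t y) * (\<beta> * c y)) = \<beta> * (\<Sum>y\<in>T. exp (\<beta> * ?u t y) * c y)"
      by (simp add: sum_distrib_left mult_ac)
    moreover have "(\<Sum>y\<in>T. soft_weight \<beta> T y (?u t) * c y) = (\<Sum>y\<in>T. exp (\<beta> * ?u t y) * c y) / ?S t"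
      by (simp add: soft_weight_def sum_divide_distrib)
    ultimately show ?thesis using ne by simp
  qed
  moreover have "(E * (\<beta> * b) * S - E * (\<beta> * S * W)) / (S * S) = \<beta> * (E / S) * (b - W)" if "S \<noteq> 0" for E S W b :: real
    using that by (simp add: field_simps)
  ultimately show ?thesis using ne by (simp only: soft_weight_def[of \<beta> T x] not_False_eq_True)
qed

text \<open>Exchanging the two summation indices and averaging turns the form into half the double
  sum of the weights times \<open>H x x + H y y - H x y - H y x\<close>. In the application
  \<open>H\<close> is a difference of covariances, and this bracket is the difference of the squared
  increments of the two processes.\<close>

lemma soft_weight_quadratic_nonneg:
  assumes T: "finite T" "T \<noteq> {}" and H: "\<And>x y. x \<in> T \<Longrightarrow> y \<in> T \<Longrightarrow> H x y + H y x \<le> H x x + H y y"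
  shows "0 \<le> (\<Sum>x\<in>T. soft_weight \<beta> T x z * (H x x - (\<Sum>y\<in>T. soft_weight \<beta> T y z * H x y)))"
proof -
  let ?p = "\<lambda>x. soft_weight \<beta> T x z"
  have s: "(\<Sum>x\<in>T. ?p x) = 1" using T by (rule soft_weight_sum)
  have 1: "(\<Sum>x\<in>T. ?p x * (H x x - (\<Sum>y\<in>T. ?p y * H x y))) = (\<Sum>x\<in>T. \<Sum>y\<in>T. ?p x * ?p y * (H x x - H x y))"
  proof (rule sum.cong[OF refl])
    fix x assume "x \<in> T"
    have "(\<Sum>y\<in>T. ?p x * ?p y * (H x x - H x y)) = ?p x * ((\<Sum>y\<in>T. ?p y) * H x x - (\<Sum>y\<in>T. ?p y * H x y))"
      by (simp add: sum_distrib_left sum_distrib_right sum_subtractf algebra_simps)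
    then show "?p x * (H x x - (\<Sum>y\<in>T. ?p y * H x y)) = (\<Sum>y\<in>T. ?p x * ?p y * (H x x - H x y))"
      by (simp add: s)
  qed
  have 2: "(\<Sum>x\<in>T. \<Sum>y\<in>T. ?p x * ?p y * (H x x - H x y)) = (\<Sum>x\<in>T. \<Sum>y\<in>T. ?p x * ?p y * (H y y - H y x))"
    by (subst sum.swap) (simp add: mult_ac)
  have "0 \<le> (\<Sum>x\<in>T. \<Sum>y\<in>T. ?p x * ?p y * (H x x + H y y - H x y - H y x))"
    using H by (intro sum_nonneg mult_nonneg_nonneg soft_weight_nonneg) (auto simp: algebra_simps)
  also have "\<dots> = (\<Sum>x\<in>T. \<Sum>y\<in>T. ?p x * ?p y * (H x x - H x y)) + (\<Sum>x\<in>T. \<Sum>y\<in>T. ?p x * ?p y * (H y y - H y x))"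
    by (simp add: sum.distrib[symmetric] algebra_simps)
  finally show ?thesis using 1 2 by simp
qed

lemma measurable_soft_weight_PiM [measurable]:
  "x \<in> T \<Longrightarrow> soft_weight \<beta> T x \<in> borel_measurable (PiM T (\<lambda>_. borel))"
  unfolding soft_weight_def[abs_def] by measurable

text \<open>Along the path \<open>cos \<theta> X + sin \<theta> Y\<close> between independent copies of the two processes, the
  smoothed maximum has nonnegative expected derivative.\<close>

lemma sudakov_fernique_smooth:
  fixes X :: "'i \<Rightarrow> 'a \<Rightarrow> real" and Y :: "'i \<Rightarrow> 'b \<Rightarrow> real"
  assumes X: "centered_gaussian_process M T X" and Y: "centered_gaussian_process N T Y"
    and T: "finite T" "T \<noteq> {}" and \<beta>: "\<beta> > 0"
    and dist: "\<And>x y. x \<in> T \<Longrightarrow> y \<in> T \<Longrightarrow> (\<integral>\<omega>. (X x \<omega> - X y \<omega>)\<^sup>2 \<partial>M) \<le> (\<integral>\<xi>. (Y x \<xi> - Y y \<xi>)\<^sup>2 \<partial>N)"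
  shows "integrable M (\<lambda>\<omega>. log_sum_exp \<beta> T (\<lambda>x. X x \<omega>))" "integrable N (\<lambda>\<xi>. log_sum_exp \<beta> T (\<lambda>x. Y x \<xi>))"
    "(\<integral>\<omega>. log_sum_exp \<beta> T (\<lambda>x. X x \<omega>) \<partial>M) \<le> (\<integral>\<xi>. log_sum_exp \<beta> T (\<lambda>x. Y x \<xi>) \<partial>N)"
proof -
  interpret M: prob_space M by (rule cgp_prob_space[OF X])
  interpret N: prob_space N by (rule cgp_prob_space[OF Y])
  interpret P: pair_prob_space M N ..
  let ?P = "M \<Otimes>\<^sub>M N"
  have mX[measurable]: "x \<in> T \<Longrightarrow> X x \<in> borel_measurable M" and mY[measurable]: "x \<in> T \<Longrightarrow> Y x \<in> borel_measurable N" for x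
    using X Y cgp_measurable by metis+
  have gX: "x \<in> T \<Longrightarrow> gaussian_rv M (X x)" and gY: "x \<in> T \<Longrightarrow> gaussian_rv N (Y x)" for x
    using X Y T cgp_gaussian_rv_one by metis+
  have iX: "x \<in> T \<Longrightarrow> integrable M (X x)" and iY: "x \<in> T \<Longrightarrow> integrable N (Y x)" for x
    using gX gY gaussian_rv_integrable_self by blast+
  have lse_int: "integrable K (\<lambda>\<omega>. log_sum_exp \<beta> T (\<lambda>x. Z x \<omega>))"
    if "prob_space K" and Z: "\<And>x. x \<in> T \<Longrightarrow> integrable K (Z x)" for K :: "'c measure" and Z
  proof -
    interpret prob_space K by fact
    have [measurable]: "x \<in> T \<Longrightarrow> Z x \<in> borel_measurable K" for x using Z by auto
    have m: "(\<lambda>\<omega>. log_sum_exp \<beta> T (\<lambda>x. Z x \<omega>)) \<in> borel_measurable K"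
      unfolding log_sum_exp_def by measurable
    have "integrable K (\<lambda>\<omega>. \<bar>Max ((\<lambda>x. Z x \<omega>) ` T)\<bar> + ln (card T) / \<beta>)"
      using integrable_Max[OF T Z] by simp
    then show ?thesis
    proof (rule Bochner_Integration.integrable_bound[OF _ m], intro AE_I2)
      fix \<omega>
      have "\<bar>log_sum_exp \<beta> T (\<lambda>x. Z x \<omega>)\<bar> \<le> \<bar>Max ((\<lambda>x. Z x \<omega>) ` T)\<bar> + ln (card T) / \<beta>"
      proof -
        have "0 \<le> ln (real (card T)) / \<beta>" using \<beta> T by (simp add: card_gt_0_iff Suc_le_eq)
        then show ?thesis using log_sum_exp_bounds[OF T \<beta>, of "\<lambda>x. Z x \<omega>"] by linarith
      qed
      then show "norm (log_sum_exp \<beta> T (\<lambda>x. Z x \<omega>)) \<le> norm (\<bar>Max ((\<lambda>x. Z x \<omega>) ` T)\<bar> + ln (card T) / \<beta>)"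
        by simp
    qed
  qed
  show lX: "integrable M (\<lambda>\<omega>. log_sum_exp \<beta> T (\<lambda>x. X x \<omega>))" and lY: "integrable N (\<lambda>\<xi>. log_sum_exp \<beta> T (\<lambda>x. Y x \<xi>))"
    using lse_int[OF M.prob_space_axioms iX] lse_int[OF N.prob_space_axioms iY] by auto

  define C where "C x y = (\<integral>\<omega>. X x \<omega> * X y \<omega> \<partial>M)" for x y
  define D where "D x y = (\<integral>\<xi>. Y x \<xi> * Y y \<xi> \<partial>N)" for x y
  define H where "H x y = D x y - C x y" for x y
  have H: "H x y + H y x \<le> H x x + H y y" if xy: "x \<in> T" "y \<in> T" for x y
  proof -
    have expand: "(\<integral>\<omega>. (Z x \<omega> - Z y \<omega>)\<^sup>2 \<partial>K) = (\<integral>\<omega>. Z x \<omega> * Z x \<omega> \<partial>K) + (\<integral>\<omega>. Z y \<omega> * Z y \<omega> \<partial>K)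
        - (\<integral>\<omega>. Z x \<omega> * Z y \<omega> \<partial>K) - (\<integral>\<omega>. Z y \<omega> * Z x \<omega> \<partial>K)"
      if Z: "centered_gaussian_process K T Z" for K :: "'c measure" and Z :: "'i \<Rightarrow> 'c \<Rightarrow> real"
    proof -
      have "(\<integral>\<omega>. (Z x \<omega> - Z y \<omega>)\<^sup>2 \<partial>K) = (\<integral>\<omega>. Z x \<omega> * Z x \<omega> + Z y \<omega> * Z y \<omega> - Z x \<omega> * Z y \<omega> - Z y \<omega> * Z x \<omega> \<partial>K)"
        by (simp add: power2_eq_square algebra_simps)
      also have "\<dots> = (\<integral>\<omega>. Z x \<omega> * Z x \<omega> \<partial>K) + (\<integral>\<omega>. Z y \<omega> * Z y \<omega> \<partial>K)
          - (\<integral>\<omega>. Z x \<omega> * Z y \<omega> \<partial>K) - (\<integral>\<omega>. Z y \<omega> * Z x \<omega> \<partial>K)"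
        by (simp only: Bochner_Integration.integral_diff Bochner_Integration.integral_add
            Bochner_Integration.integrable_add Bochner_Integration.integrable_diff cgp_integrable_mult[OF Z T(1)] xy)
      finally show ?thesis .
    qed
    show ?thesis using dist[OF xy] expand[OF X] expand[OF Y] by (simp add: H_def C_def D_def)
  qed

  \<comment> \<open>\<open>Z' \<theta>\<close> is the derivative of \<open>Z \<theta>\<close> in
    \<open>\<theta>\<close>, which makes \<open>G\<close> the derivative of the smoothed maximum
    along the path.\<close>
  define Z where "Z \<theta> x p = cos \<theta> * X x (fst p) + sin \<theta> * Y x (snd p)" for \<theta> x p
  define Z' where "Z' \<theta> x p = cos \<theta> * Y x (snd p) - sin \<theta> * X x (fst p)" for \<theta> x p
  define G where "G \<theta> p = (\<Sum>x\<in>T. soft_weight \<beta> T x (\<lambda>y. Z \<theta> y p) * Z' \<theta> x p)" for \<theta> p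

  have G_int: "integrable ?P (\<lambda>p. soft_weight \<beta> T x (\<lambda>y. Z \<theta> y p) * Z' \<theta> x p)" if x: "x \<in> T" for x \<theta>
  proof -
    have Z'i: "integrable ?P (Z' \<theta> x)"
      unfolding Z'_def[abs_def] using iX[OF x] iY[OF x]
      by (auto intro!: P.integrable_fst_component P.integrable_snd_component)
    show ?thesis
    proof (rule Bochner_Integration.integrable_bound[OF Z'i])
      show "(\<lambda>p. soft_weight \<beta> T x (\<lambda>y. Z \<theta> y p) * Z' \<theta> x p) \<in> borel_measurable ?P"
        unfolding soft_weight_def Z_def Z'_def using x by measurable
      have "\<bar>soft_weight \<beta> T x u * a\<bar> \<le> \<bar>a\<bar>" for u a
        using soft_weight_nonneg[of \<beta> T x u] soft_weight_le_1[OF T(1) x, of \<beta> u]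
        by (simp add: abs_mult mult_left_le_one_le)
      then show "AE p in ?P. norm (soft_weight \<beta> T x (\<lambda>y. Z \<theta> y p) * Z' \<theta> x p) \<le> norm (Z' \<theta> x p)" by simp
    qed
  qed

  have nonneg: "0 \<le> (\<integral>p. G \<theta> p \<partial>?P)" if \<theta>: "\<theta> \<in> {0..pi/2}" for \<theta>
  proof -
    define \<kappa> where "\<kappa> = sin \<theta> * cos \<theta>"
    have \<kappa>: "\<kappa> \<ge> 0" using \<theta> by (auto simp: \<kappa>_def intro!: mult_nonneg_nonneg sin_ge_zero cos_ge_zero)
    define B where "B x u = \<beta> * soft_weight \<beta> T x u * (\<kappa> * H x x - (\<Sum>y\<in>T. soft_weight \<beta> T y u * (\<kappa> * H x y)))" for x u
    have Bbound: "\<bar>B x u\<bar> \<le> \<beta> * (\<bar>\<kappa> * H x x\<bar> + (\<Sum>y\<in>T. \<bar>\<kappa> * H x y\<bar>))" if x: "x \<in> T" for x u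
    proof -
      have w: "soft_weight \<beta> T y u * a \<le> a" if "y \<in> T" "a \<ge> 0" for y a
        using soft_weight_le_1[OF T(1) that(1), of \<beta> u] that by (simp add: mult_left_le_one_le soft_weight_nonneg)
      have "\<bar>B x u\<bar> = \<beta> * (soft_weight \<beta> T x u * \<bar>\<kappa> * H x x - (\<Sum>y\<in>T. soft_weight \<beta> T y u * (\<kappa> * H x y))\<bar>)"
        unfolding B_def using \<beta> soft_weight_nonneg[of \<beta> T x u] by (simp add: abs_mult mult.assoc)
      also have "\<dots> \<le> \<beta> * \<bar>\<kappa> * H x x - (\<Sum>y\<in>T. soft_weight \<beta> T y u * (\<kappa> * H x y))\<bar>"
        using \<beta> by (intro mult_left_mono w x) auto
      also have "\<dots> \<le> \<beta> * (\<bar>\<kappa> * H x x\<bar> + (\<Sum>y\<in>T. \<bar>soft_weight \<beta> T y u * (\<kappa> * H x y)\<bar>))"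
        using \<beta> by (intro mult_left_mono order_trans[OF abs_triangle_ineq4] add_left_mono sum_abs) auto
      also have "\<dots> \<le> \<beta> * (\<bar>\<kappa> * H x x\<bar> + (\<Sum>y\<in>T. \<bar>\<kappa> * H x y\<bar>))"
      proof (intro mult_left_mono add_left_mono sum_mono)
        fix y assume "y \<in> T"
        then show "\<bar>soft_weight \<beta> T y u * (\<kappa> * H x y)\<bar> \<le> \<bar>\<kappa> * H x y\<bar>"
          using w[of y "\<bar>\<kappa> * H x y\<bar>"] by (subst abs_mult) (simp add: soft_weight_nonneg)
      qed (use \<beta> in auto)
      finally show ?thesis .
    qed
    have ibp: "(\<integral>p. soft_weight \<beta> T x (\<lambda>y. Z \<theta> y p) * Z' \<theta> x p \<partial>?P) = (\<integral>p. B x (\<lambda>y. Z \<theta> y p) \<partial>?P)" if x: "x \<in> T" for x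
    proof -
      \<comment> \<open>\<open>None\<close> carries the linear factor that integration by parts
        removes, \<open>Some y\<close> the arguments of the Gibbs weight.\<close>
      define W where "W i = (case i of None \<Rightarrow> Z' \<theta> x | Some y \<Rightarrow> Z \<theta> y)" for i
      have W: "centered_gaussian_process ?P (insert None (Some ` T)) W"
      proof (rule cgpI)
        fix a :: "'i option \<Rightarrow> real"
        define aX where "aX y = a (Some y) * cos \<theta> - (if y = x then a None * sin \<theta> else 0)" for y
        define aY where "aY y = a (Some y) * sin \<theta> + (if y = x then a None * cos \<theta> else 0)" for y
        have "(\<Sum>i\<in>insert None (Some ` T). a i * W i p) = (\<Sum>y\<in>T. aX y * X y (fst p)) + (\<Sum>y\<in>T. aY y * Y y (snd p))" for p
        proof -
          have "(\<Sum>i\<in>insert None (Some ` T). a i * W i p) = a None * Z' \<theta> x p + (\<Sum>y\<in>T. a (Some y) * Z \<theta> y p)"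
            using T(1) by (subst sum.insert) (auto simp: sum.reindex W_def)
          also have "\<dots> = (\<Sum>y\<in>T. aX y * X y (fst p)) + (\<Sum>y\<in>T. aY y * Y y (snd p))"
            using T(1) x
            by (simp add: Z_def Z'_def aX_def aY_def left_diff_distrib distrib_right distrib_left right_diff_distrib
                sum.distrib sum_subtractf if_distrib[of "\<lambda>u. u * _"] mult.assoc cong: if_cong)
          finally show ?thesis .
        qed
        then show "gaussian_rv ?P (\<lambda>p. \<Sum>i\<in>insert None (Some ` T). a i * W i p)"
          using gaussian_rv_indep_sum(1)[OF cgp_gaussian_rv[OF X T(1), of aX] M.prob_space_axioms
              cgp_gaussian_rv[OF Y T(1), of aY] N.prob_space_axioms]
          by (simp add: split_beta')
      next
        show "W i \<in> borel_measurable ?P" if "i \<in> insert None (Some ` T)" for i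
          using that x unfolding W_def Z_def[abs_def] Z'_def[abs_def] by auto
      qed (use T P.prob_space_axioms in auto)
      \<comment> \<open>Independence and centring remove the two mixed products. The rest is
        \<open>H x y\<close> times \<open>sin \<theta> * cos \<theta>\<close>, which is nonnegative
        on the quarter circle; this is where the restriction of \<open>\<theta>\<close>
        enters.\<close>
      have cov: "(\<integral>p. W None p * W (Some y) p \<partial>?P) = \<kappa> * H x y" if y: "y \<in> T" for y
      proof -
        have h: "W None p * W (Some y) p = (cos \<theta> * cos \<theta>) * (X y (fst p) * Y x (snd p)) + \<kappa> * (Y x (snd p) * Y y (snd p))
            - \<kappa> * (X x (fst p) * X y (fst p)) - (sin \<theta> * sin \<theta>) * (X x (fst p) * Y y (snd p))" for p
          by (simp add: W_def Z_def Z'_def \<kappa>_def algebra_simps)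
        show ?thesis
          unfolding h using x y iX iY gaussian_rv_mean[OF gX] cgp_integrable_mult[OF X T(1), of x y] cgp_integrable_mult[OF Y T(1), of x y]
          by (simp add: P.integral_times_fst_snd P.integrable_times_fst_snd H_def C_def D_def
              P.integral_fst_component[of "\<lambda>\<omega>. X x \<omega> * X y \<omega>"] P.integral_snd_component[of "\<lambda>\<xi>. Y x \<xi> * Y y \<xi>"]
              P.integrable_fst_component[of "\<lambda>\<omega>. X x \<omega> * X y \<omega>"] P.integrable_snd_component[of "\<lambda>\<xi>. Y x \<xi> * Y y \<xi>"] right_diff_distrib)
      qed
      have restr: "soft_weight \<beta> T x' (restrict z T) = soft_weight \<beta> T x' z" if "x' \<in> T" for x' z
        using that by (simp add: soft_weight_def)
      let ?c = "\<lambda>y. \<integral>p. W None p * W (Some y) p \<partial>?P"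
      have der: "((\<lambda>t. soft_weight \<beta> T x (\<lambda>y. z y + t * ?c y)) has_real_derivative B x (\<lambda>y. z y + t * ?c y)) (at t)" for z t
        using DERIV_soft_weight[OF T(1) x, of \<beta> z ?c t] x cov by (simp add: B_def cong: sum.cong)
      have "(\<integral>p. W None p * soft_weight \<beta> T x (\<lambda>y. W (Some y) p) \<partial>?P) = (\<integral>p. B x (\<lambda>y. W (Some y) p) \<partial>?P)"
      proof (rule gaussian_ibp[OF W T(1), where B=1])
        show "soft_weight \<beta> T x \<in> borel_measurable (PiM T (\<lambda>_. borel))" using x by measurable
        show "B x \<in> borel_measurable (PiM T (\<lambda>_. borel))" unfolding B_def[abs_def] using x by measurable
        show "soft_weight \<beta> T x (restrict z T) = soft_weight \<beta> T x z" for z using x restr by simp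
        show "B x (restrict z T) = B x z" for z using x restr by (simp add: B_def cong: sum.cong)
        show "((\<lambda>t. soft_weight \<beta> T x (\<lambda>y. z y + t * ?c y)) has_real_derivative B x (\<lambda>y. z y + t * ?c y)) (at t)" for z t
          by (rule der)
        show "isCont (\<lambda>t. B x (\<lambda>y. z y + t * ?c y)) t" for z t
          unfolding B_def soft_weight_def using sum_exp_pos[OF T, of "\<lambda>y. \<beta> * (z y + t * ?c y)"]
          by (intro continuous_intros) auto
        show "\<bar>soft_weight \<beta> T x z\<bar> \<le> 1" for z using soft_weight_nonneg[of \<beta> T x z] soft_weight_le_1[OF T(1) x] by simp
        show "\<bar>B x z\<bar> \<le> \<beta> * (\<bar>\<kappa> * H x x\<bar> + (\<Sum>y\<in>T. \<bar>\<kappa> * H x y\<bar>))" for z by (rule Bbound[OF x])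
      qed
      then show ?thesis by (simp add: W_def mult.commute)
    qed
    have Bint: "integrable ?P (\<lambda>p. B x (\<lambda>y. Z \<theta> y p))" if x: "x \<in> T" for x
    proof (rule P.integrable_const_bound)
      show "AE p in ?P. norm (B x (\<lambda>y. Z \<theta> y p)) \<le> \<beta> * (\<bar>\<kappa> * H x x\<bar> + (\<Sum>y\<in>T. \<bar>\<kappa> * H x y\<bar>))"
        using Bbound[OF x] by simp
      show "(\<lambda>p. B x (\<lambda>y. Z \<theta> y p)) \<in> borel_measurable ?P"
        unfolding B_def soft_weight_def Z_def using x by measurable
    qed
    have "(\<integral>p. G \<theta> p \<partial>?P) = (\<Sum>x\<in>T. \<integral>p. B x (\<lambda>y. Z \<theta> y p) \<partial>?P)"
      unfolding G_def using G_int ibp by (subst Bochner_Integration.integral_sum) auto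
    also have "\<dots> = (\<integral>p. (\<Sum>x\<in>T. B x (\<lambda>y. Z \<theta> y p)) \<partial>?P)"
      using Bint by (subst Bochner_Integration.integral_sum) auto
    also have "\<dots> \<ge> 0"
    proof (rule Bochner_Integration.integral_nonneg)
      fix p
      let ?w = "\<lambda>x. soft_weight \<beta> T x (\<lambda>y. Z \<theta> y p)"
      have "(\<Sum>x\<in>T. B x (\<lambda>y. Z \<theta> y p)) = \<beta> * \<kappa> * (\<Sum>x\<in>T. ?w x * (H x x - (\<Sum>y\<in>T. ?w y * H x y)))"
        by (simp add: B_def sum_distrib_left right_diff_distrib mult_ac)
      also have "\<dots> \<ge> 0" using \<beta> \<kappa> soft_weight_quadratic_nonneg[OF T, of H] H by (intro mult_nonneg_nonneg) auto
      finally show "0 \<le> (\<Sum>x\<in>T. B x (\<lambda>y. Z \<theta> y p))" .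
    qed
    finally show ?thesis .
  qed

  have ftc: "(\<integral>\<theta>. G \<theta> p * indicator {0..pi/2} \<theta> \<partial>lborel) = log_sum_exp \<beta> T (\<lambda>x. Y x (snd p)) - log_sum_exp \<beta> T (\<lambda>x. X x (fst p))" for p
  proof -
    have "(\<integral>\<theta>. G \<theta> p * indicator {0..pi/2} \<theta> \<partial>lborel)
        = log_sum_exp \<beta> T (\<lambda>x. Z (pi/2) x p) - log_sum_exp \<beta> T (\<lambda>x. Z 0 x p)"
    proof (rule integral_FTC_Icc_real)
      fix \<theta>
      show "((\<lambda>\<theta>. log_sum_exp \<beta> T (\<lambda>x. Z \<theta> x p)) has_real_derivative G \<theta> p) (at \<theta>)"
        unfolding G_def by (rule DERIV_log_sum_exp[OF T \<beta>]) (auto simp: Z_def Z'_def intro!: derivative_eq_intros)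
      show "isCont (\<lambda>\<theta>. G \<theta> p) \<theta>"
        unfolding G_def soft_weight_def Z_def Z'_def
        using sum_exp_pos[OF T, of "\<lambda>y. \<beta> * (cos \<theta> * X y (fst p) + sin \<theta> * Y y (snd p))"]
        by (intro continuous_intros) auto
    qed auto
    then show ?thesis by (simp add: Z_def)
  qed
  \<comment> \<open>Dominates \<open>G \<theta>\<close> uniformly in \<open>\<theta>\<close> and so
    justifies exchanging the integrals over the path and over the product space.\<close>
  define E where "E p = (\<Sum>x\<in>T. \<bar>X x (fst p)\<bar> + \<bar>Y x (snd p)\<bar>)" for p
  interpret L: pair_sigma_finite lborel ?P ..
  have Gint: "integrable (lborel \<Otimes>\<^sub>M ?P) (\<lambda>(\<theta>, p). G \<theta> p * indicator {0..pi/2} \<theta>)"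
  proof (rule Bochner_Integration.integrable_bound)
    have "integrable ?P E"
      unfolding E_def using iX iY
      by (intro Bochner_Integration.integrable_sum Bochner_Integration.integrable_add integrable_abs
          P.integrable_fst_component P.integrable_snd_component) auto
    moreover have "integrable lborel (indicator {0..pi/2} :: real \<Rightarrow> real)" by simp
    ultimately show "integrable (lborel \<Otimes>\<^sub>M ?P) (\<lambda>q. indicator {0..pi/2} (fst q) * E (snd q))"
      by (intro L.integrable_times_fst_snd)
    show "(\<lambda>(\<theta>, p). G \<theta> p * indicator {0..pi/2} \<theta>) \<in> borel_measurable (lborel \<Otimes>\<^sub>M ?P)"
      unfolding G_def soft_weight_def Z_def Z'_def by measurable
    have GE: "\<bar>G \<theta> p\<bar> \<le> E p" for \<theta> p
    proof -
      have "\<bar>G \<theta> p\<bar> \<le> (\<Sum>x\<in>T. \<bar>soft_weight \<beta> T x (\<lambda>y. Z \<theta> y p) * Z' \<theta> x p\<bar>)"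
        unfolding G_def by (rule sum_abs)
      also have "\<dots> \<le> E p" unfolding E_def
      proof (rule sum_mono)
        fix x assume x: "x \<in> T"
        let ?w = "soft_weight \<beta> T x (\<lambda>y. Z \<theta> y p)"
        have "\<bar>?w * Z' \<theta> x p\<bar> \<le> \<bar>Z' \<theta> x p\<bar>"
          using soft_weight_nonneg[of \<beta> T x "\<lambda>y. Z \<theta> y p"] soft_weight_le_1[OF T(1) x, of \<beta> "\<lambda>y. Z \<theta> y p"]
          by (simp add: abs_mult mult_left_le_one_le)
        also have "\<dots> \<le> \<bar>cos \<theta> * Y x (snd p)\<bar> + \<bar>sin \<theta> * X x (fst p)\<bar>" unfolding Z'_def by (rule abs_triangle_ineq4)
        also have "\<dots> \<le> \<bar>Y x (snd p)\<bar> + \<bar>X x (fst p)\<bar>"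
          by (intro add_mono) (auto simp: abs_mult mult_left_le_one_le)
        finally show "\<bar>?w * Z' \<theta> x p\<bar> \<le> \<bar>X x (fst p)\<bar> + \<bar>Y x (snd p)\<bar>" by simp
      qed
      finally show ?thesis .
    qed
    show "AE q in lborel \<Otimes>\<^sub>M ?P. norm (case q of (\<theta>, p) \<Rightarrow> G \<theta> p * indicator {0..pi/2} \<theta>)
        \<le> norm (indicator {0..pi/2} (fst q) * E (snd q))"
    proof (rule AE_I2)
      fix q :: "real \<times> 'a \<times> 'b"
      show "norm (case q of (\<theta>, p) \<Rightarrow> G \<theta> p * indicator {0..pi/2} \<theta>) \<le> norm (indicator {0..pi/2} (fst q) * E (snd q))"
        using order_trans[OF GE abs_ge_self] by (auto simp: split_beta split: split_indicator)
    qed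
  qed
  have "0 \<le> (\<integral>\<theta>. (\<integral>p. G \<theta> p * indicator {0..pi/2} \<theta> \<partial>?P) \<partial>lborel)"
  proof (rule Bochner_Integration.integral_nonneg)
    show "0 \<le> (\<integral>p. G \<theta> p * indicator {0..pi/2} \<theta> \<partial>?P)" for \<theta> :: real
      using nonneg[of \<theta>] by (cases "\<theta> \<in> {0..pi/2}") auto
  qed
  also have "\<dots> = (\<integral>p. (\<integral>\<theta>. G \<theta> p * indicator {0..pi/2} \<theta> \<partial>lborel) \<partial>?P)"
    by (rule L.Fubini_integral[OF Gint, symmetric])
  also have "\<dots> = (\<integral>p. log_sum_exp \<beta> T (\<lambda>x. Y x (snd p)) - log_sum_exp \<beta> T (\<lambda>x. X x (fst p)) \<partial>?P)"
    by (simp add: ftc)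
  also have "\<dots> = (\<integral>\<xi>. log_sum_exp \<beta> T (\<lambda>x. Y x \<xi>) \<partial>N) - (\<integral>\<omega>. log_sum_exp \<beta> T (\<lambda>x. X x \<omega>) \<partial>M)"
    using P.integrable_fst_component[OF lX] P.integral_fst_component[OF lX]
      P.integrable_snd_component[OF lY] P.integral_snd_component[OF lY] by simp
  finally show "(\<integral>\<omega>. log_sum_exp \<beta> T (\<lambda>x. X x \<omega>) \<partial>M) \<le> (\<integral>\<xi>. log_sum_exp \<beta> T (\<lambda>x. Y x \<xi>) \<partial>N)" by simp
qed

text \<open>The smoothed comparison holds at every \<open>\<beta> > 0\<close>, and its error
  \<open>ln (card T) / \<beta>\<close> is the same for all processes on \<open>T\<close>, so
  \<open>\<beta>\<close> can be chosen after the tolerance \<open>e\<close>.\<close>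

theorem sudakov_fernique:
  fixes X :: "'i \<Rightarrow> 'a \<Rightarrow> real" and Y :: "'i \<Rightarrow> 'b \<Rightarrow> real"
  assumes X: "centered_gaussian_process M T X" and Y: "centered_gaussian_process N T Y"
    and T: "finite T" "T \<noteq> {}"
    and dist: "\<And>x y. x \<in> T \<Longrightarrow> y \<in> T \<Longrightarrow> (\<integral>\<omega>. (X x \<omega> - X y \<omega>)\<^sup>2 \<partial>M) \<le> (\<integral>\<xi>. (Y x \<xi> - Y y \<xi>)\<^sup>2 \<partial>N)"
  shows "(\<integral>\<omega>. Max ((\<lambda>x. X x \<omega>) ` T) \<partial>M) \<le> (\<integral>\<xi>. Max ((\<lambda>x. Y x \<xi>) ` T) \<partial>N)"
proof (rule field_le_epsilon)
  fix e :: real assume e: "e > 0"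
  interpret M: prob_space M by (rule cgp_prob_space[OF X])
  interpret N: prob_space N by (rule cgp_prob_space[OF Y])
  have iX: "integrable M (\<lambda>\<omega>. Max ((\<lambda>x. X x \<omega>) ` T))"
    using T cgp_gaussian_rv_one[OF X T(1)] gaussian_rv_integrable_self by (intro integrable_Max) blast+
  have iY: "integrable N (\<lambda>\<omega>. Max ((\<lambda>x. Y x \<omega>) ` T))"
    using T cgp_gaussian_rv_one[OF Y T(1)] gaussian_rv_integrable_self by (intro integrable_Max) blast+
  \<comment> \<open>The summand 1 keeps \<open>\<beta>\<close> positive when \<open>T\<close> is a
    single point.\<close>
  define \<beta> where "\<beta> = (ln (card T) + 1) / e"
  have c: "ln (real (card T)) \<ge> 0" using T by (simp add: card_gt_0_iff Suc_le_eq)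
  then have \<beta>: "\<beta> > 0" using e by (simp add: \<beta>_def)
  have \<beta>e: "ln (card T) / \<beta> \<le> e" using c e by (simp add: \<beta>_def field_simps)
  note s = sudakov_fernique_smooth[OF X Y T \<beta> dist]
  have "(\<integral>\<omega>. Max ((\<lambda>x. X x \<omega>) ` T) \<partial>M) \<le> (\<integral>\<omega>. log_sum_exp \<beta> T (\<lambda>x. X x \<omega>) \<partial>M)"
    by (intro integral_mono iX s log_sum_exp_bounds[OF T \<beta>]) auto
  also have "\<dots> \<le> (\<integral>\<xi>. log_sum_exp \<beta> T (\<lambda>x. Y x \<xi>) \<partial>N)" by (rule s(3)) auto
  also have "\<dots> \<le> (\<integral>\<xi>. Max ((\<lambda>x. Y x \<xi>) ` T) + ln (card T) / \<beta> \<partial>N)"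
    using iY by (intro integral_mono s log_sum_exp_bounds[OF T \<beta>]) auto
  also have "\<dots> = (\<integral>\<xi>. Max ((\<lambda>x. Y x \<xi>) ` T) \<partial>N) + ln (card T) / \<beta>" using iY by (simp add: N.prob_space)
  finally show "(\<integral>\<omega>. Max ((\<lambda>x. X x \<omega>) ` T) \<partial>M) \<le> (\<integral>\<xi>. Max ((\<lambda>x. Y x \<xi>) ` T) \<partial>N) + e"
    using \<beta>e by linarith
qed

section \<open>The super-Sudakov inequality\<close>

text \<open>For centred Gaussian variables the mean absolute value is \<open>sqrt (2 / pi)\<close>
  times the standard deviation, so the triangle inequality for standard deviations follows from the
  pointwise one for absolute values.\<close>

lemma gaussian_sd_triangle:
  assumes V: "gaussian_rv M V" and W: "gaussian_rv M W" and VW: "gaussian_rv M (\<lambda>\<omega>. V \<omega> + W \<omega>)"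
  shows "sqrt (\<integral>\<omega>. (V \<omega> + W \<omega>)\<^sup>2 \<partial>M) \<le> sqrt (\<integral>\<omega>. (V \<omega>)\<^sup>2 \<partial>M) + sqrt (\<integral>\<omega>. (W \<omega>)\<^sup>2 \<partial>M)"
proof -
  have "(\<integral>\<omega>. \<bar>V \<omega> + W \<omega>\<bar> \<partial>M) \<le> (\<integral>\<omega>. \<bar>V \<omega>\<bar> + \<bar>W \<omega>\<bar> \<partial>M)"
    using gaussian_rv_integrable_self[OF V] gaussian_rv_integrable_self[OF W]
    by (intro integral_mono abs_triangle_ineq) auto
  also have "\<dots> = (\<integral>\<omega>. \<bar>V \<omega>\<bar> \<partial>M) + (\<integral>\<omega>. \<bar>W \<omega>\<bar> \<partial>M)"
    using gaussian_rv_integrable_self[OF V] gaussian_rv_integrable_self[OF W] by simp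
  finally have "sqrt (2 / pi) * sqrt (\<integral>\<omega>. (V \<omega> + W \<omega>)\<^sup>2 \<partial>M)
      \<le> sqrt (2 / pi) * (sqrt (\<integral>\<omega>. (V \<omega>)\<^sup>2 \<partial>M) + sqrt (\<integral>\<omega>. (W \<omega>)\<^sup>2 \<partial>M))"
    by (simp add: gaussian_rv_abs_mean V W VW distrib_left del: real_sqrt_divide)
  then show ?thesis by (subst (asm) mult_le_cancel_left_pos) auto
qed

lemma prob_space_PiM_std_normal: "prob_space (PiM I (\<lambda>_. std_normal_distribution))"
  by (intro prob_space_PiM prob_space_normal_density) auto

lemma gaussian_rv_PiM_std_normal:
  fixes b :: "'k \<Rightarrow> real"
  assumes K: "finite K"
  shows "gaussian_rv (PiM K (\<lambda>_. std_normal_distribution)) (\<lambda>\<xi>. \<Sum>k\<in>K. b k * \<xi> k)"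
    and "(\<integral>\<xi>. (\<Sum>k\<in>K. b k * \<xi> k)\<^sup>2 \<partial>PiM K (\<lambda>_. std_normal_distribution)) = (\<Sum>k\<in>K. (b k)\<^sup>2)"
proof -
  let ?N = "PiM K (\<lambda>_. std_normal_distribution)"
  interpret S: prob_space std_normal_distribution by (rule prob_space_normal_density) simp
  interpret PS: product_sigma_finite "\<lambda>_::'k. std_normal_distribution" ..
  have [measurable]: "(\<lambda>\<xi>. \<Sum>k\<in>K. b k * \<xi> k) \<in> borel_measurable ?N"
  proof (intro borel_measurable_sum borel_measurable_times borel_measurable_const)
    fix k assume "k \<in> K"
    then show "(\<lambda>\<xi>. \<xi> k) \<in> borel_measurable ?N"
      using measurable_component_singleton[of k K "\<lambda>_. std_normal_distribution"] by simp
  qed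
  have ch: "(CLINT \<xi>|?N. iexp (t * (\<Sum>k\<in>K. b k * \<xi> k))) = of_real (exp (- (t\<^sup>2 * (\<Sum>k\<in>K. (b k)\<^sup>2)) / 2))" for t
  proof -
    have "(CLINT \<xi>|?N. iexp (t * (\<Sum>k\<in>K. b k * \<xi> k))) = (CLINT \<xi>|?N. (\<Prod>k\<in>K. iexp (t * b k * \<xi> k)))"
      using K by (simp add: sum_distrib_left exp_sum mult.assoc)
    also have "\<dots> = (\<Prod>k\<in>K. (CLINT x|std_normal_distribution. iexp (t * b k * x)))"
      by (rule PS.product_integral_prod[OF K]) (rule S.integrable_const_bound[where B=1], simp_all)
    also have "\<dots> = (\<Prod>k\<in>K. of_real (exp (- ((t * b k)\<^sup>2) / 2)))"
    proof (rule prod.cong[OF refl])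
      fix k show "(CLINT x|std_normal_distribution. iexp (t * b k * x)) = of_real (exp (- ((t * b k)\<^sup>2) / 2))"
        using fun_cong[OF char_std_normal_distribution, of "t * b k"] unfolding char_def by simp
    qed
    also have "\<dots> = of_real (exp (\<Sum>k\<in>K. - ((t * b k)\<^sup>2) / 2))"
      using K by (simp add: exp_sum)
    also have "(\<Sum>k\<in>K. - ((t * b k)\<^sup>2) / 2) = - (t\<^sup>2 * (\<Sum>k\<in>K. (b k)\<^sup>2)) / 2"
      by (simp add: power_mult_distrib sum_distrib_left sum_negf sum_divide_distrib)
    finally show ?thesis .
  qed
  show g: "gaussian_rv ?N (\<lambda>\<xi>. \<Sum>k\<in>K. b k * \<xi> k)"
    by (rule gaussian_rvI_char[OF prob_space_PiM_std_normal _ _ ch]) (auto intro: sum_nonneg)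
  have "complex_of_real (exp (- (\<Sum>k\<in>K. (b k)\<^sup>2) / 2)) = of_real (exp (- (\<integral>\<xi>. (\<Sum>k\<in>K. b k * \<xi> k)\<^sup>2 \<partial>?N) / 2))"
    using ch[of 1] gaussian_rv_char[OF g, of 1] by simp
  then show "(\<integral>\<xi>. (\<Sum>k\<in>K. b k * \<xi> k)\<^sup>2 \<partial>?N) = (\<Sum>k\<in>K. (b k)\<^sup>2)"
    by (simp only: of_real_eq_iff exp_inj_iff)
qed

definition expected_max :: "'a measure \<Rightarrow> ('i \<Rightarrow> 'a \<Rightarrow> real) \<Rightarrow> 'i set \<Rightarrow> real" where
  "expected_max M X A = (\<integral>\<omega>. Max ((\<lambda>x. X x \<omega>) ` A) \<partial>M)"

text \<open>The comparison process adds to the recentred pieces an independent copy of the process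
  \<open>s \<mapsto> \<Sum>k. \<plusminus>\<xi> k\<close> on the discrete cube \<open>Pow {..<n}\<close>, whose maximum is \<open>\<Sum>k. \<bar>\<xi> k\<bar>\<close>.
  Hence neither concentration nor bounds on maxima of independent Gaussians are needed.\<close>

lemma super_sudakov:
  fixes X :: "'i \<Rightarrow> 'a \<Rightarrow> real" and A :: "nat set \<Rightarrow> 'i set"
  assumes X: "centered_gaussian_process M T X" and T: "finite T"
    and n: "n > 0" and e: "e \<ge> 0"
    and c: "\<And>s. s \<subseteq> {..<n} \<Longrightarrow> c s \<in> T" and A: "\<And>s. s \<subseteq> {..<n} \<Longrightarrow> A s \<subseteq> T" "\<And>s. s \<subseteq> {..<n} \<Longrightarrow> A s \<noteq> {}"
    and sep: "\<And>s s'. s \<subseteq> {..<n} \<Longrightarrow> s' \<subseteq> {..<n} \<Longrightarrow> s \<noteq> s' \<Longrightarrow> e \<le> sqrt (\<integral>\<omega>. (X (c s) \<omega> - X (c s') \<omega>)\<^sup>2 \<partial>M)"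
    and close: "\<And>s x. s \<subseteq> {..<n} \<Longrightarrow> x \<in> A s \<Longrightarrow> sqrt (\<integral>\<omega>. (X x \<omega> - X (c s) \<omega>)\<^sup>2 \<partial>M) \<le> e / 8"
    and g: "\<And>s. s \<subseteq> {..<n} \<Longrightarrow> g \<le> expected_max M X (A s)"
  shows "g + e * sqrt n / 5 \<le> expected_max M X (\<Union>s\<in>Pow {..<n}. A s)"
proof -
  interpret M: prob_space M by (rule cgp_prob_space[OF X])
  define N where "N = PiM {..<n} (\<lambda>_. std_normal_distribution)"
  interpret N: prob_space N unfolding N_def by (rule prob_space_PiM_std_normal)
  interpret P: pair_prob_space M N ..
  \<comment> \<open>The comparison limits the size of the cube: recentred points contribute at most
    \<open>(e / 4)\<^sup>2\<close> to a squared distance, the cube at most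
    \<open>4 * a\<^sup>2 * n = 4 / 9 * e\<^sup>2\<close>, and the sum stays below
    \<open>(3 / 4 * e)\<^sup>2\<close>. The maximum over the cube then has mean
    \<open>a * n * sqrt (2 / pi)\<close>, which is at least \<open>e * sqrt n / 5\<close>.\<close>
  define a where "a = e / (3 * sqrt n)"
  have a: "a \<ge> 0" "a * n = e * sqrt n / 3" "a\<^sup>2 * n = e\<^sup>2 / 9"
    using e n by (auto simp: a_def field_simps power2_eq_square)
  define sg where "sg s k = (if k \<in> s then 1 else - 1 :: real)" for s and k :: nat
  define h where "h s \<xi> = a * (\<Sum>k<n. sg s k * \<xi> k)" for s \<xi>
  have gN: "gaussian_rv N (\<lambda>\<xi>. \<Sum>k<n. b k * \<xi> k)" "(\<integral>\<xi>. (\<Sum>k<n. b k * \<xi> k)\<^sup>2 \<partial>N) = (\<Sum>k<n. (b k)\<^sup>2)" for b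
    unfolding N_def by (rule gaussian_rv_PiM_std_normal; simp)+
  \<comment> \<open>Pairs remember the piece a point is taken from, so pieces may overlap, as they
    can for \<open>e = 0\<close>.\<close>
  define PI where "PI = Sigma (Pow {..<n}) A"
  have "\<exists>x. x \<in> A {}" using A(2)[of "{}"] by blast
  then have PI: "finite PI" "PI \<noteq> {}"
    using A(1) finite_subset[OF _ T] unfolding PI_def by (auto intro!: finite_SigmaI)
  have PIT: "fst p \<subseteq> {..<n} \<and> snd p \<in> A (fst p) \<and> snd p \<in> T \<and> c (fst p) \<in> T" if "p \<in> PI" for p
  proof -
    have p: "fst p \<subseteq> {..<n}" "snd p \<in> A (fst p)" using that by (auto simp: PI_def)
    then show ?thesis using A(1)[OF p(1)] c[OF p(1)] by blast
  qed
  define Y where "Y p q = X (snd p) (fst q) - X (c (fst p)) (fst q) + h (fst p) (snd q)" for p q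
  have gX: "gaussian_rv M (\<lambda>\<omega>. \<Sum>p\<in>F. b p * (X (u p) \<omega> - X (v p) \<omega>))"
    if F: "finite F" "\<And>p. p \<in> F \<Longrightarrow> u p \<in> T \<and> v p \<in> T" for F :: "'c set" and b u v
  proof -
    have "(\<Sum>p\<in>F. b p * (X (u p) \<omega> - X (v p) \<omega>))
        = (\<Sum>x\<in>T. (\<Sum>p\<in>F. b p * ((if x = u p then 1 else 0) - (if x = v p then 1 else 0))) * X x \<omega>)" for \<omega>
    proof -
      have "(\<Sum>x\<in>T. (\<Sum>p\<in>F. b p * ((if x = u p then 1 else 0) - (if x = v p then 1 else 0))) * X x \<omega>)
          = (\<Sum>p\<in>F. b p * (\<Sum>x\<in>T. ((if x = u p then 1 else 0) - (if x = v p then 1 else 0)) * X x \<omega>))"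
        by (simp add: sum_distrib_left sum_distrib_right mult.assoc sum.swap[of _ T F])
      also have "\<dots> = (\<Sum>p\<in>F. b p * (X (u p) \<omega> - X (v p) \<omega>))"
        using F(2) T by (intro sum.cong refl arg_cong2[where f="(*)"])
          (simp add: left_diff_distrib sum_subtractf if_distrib[of "\<lambda>x. x * _"] cong: if_cong)
      finally show ?thesis by simp
    qed
    then show ?thesis
      using cgp_gaussian_rv[OF X T, of "\<lambda>x. \<Sum>p\<in>F. b p * ((if x = u p then 1 else 0) - (if x = v p then 1 else 0))"]
      by simp
  qed
  have gX1: "gaussian_rv M (\<lambda>\<omega>. X x \<omega> - X y \<omega>)" if "x \<in> T" "y \<in> T" for x y
    using that by (rule cgp_gaussian_diff[OF X T])
  have gX2: "gaussian_rv M (\<lambda>\<omega>. (X x \<omega> - X y \<omega>) + (X x' \<omega> - X y' \<omega>))" if "x \<in> T" "y \<in> T" "x' \<in> T" "y' \<in> T" for x y x' y'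
    using gX[of "UNIV :: bool set" "\<lambda>i. if i then x' else x" "\<lambda>i. if i then y' else y" "\<lambda>_. 1"] that
    by (simp add: UNIV_bool)
  define dd where "dd x y = sqrt (\<integral>\<omega>. (X x \<omega> - X y \<omega>)\<^sup>2 \<partial>M)" for x y
  have dd_plus: "sqrt (\<integral>\<omega>. ((X x \<omega> - X y \<omega>) + (X x' \<omega> - X y' \<omega>))\<^sup>2 \<partial>M) \<le> dd x y + dd x' y'"
    if "x \<in> T" "y \<in> T" "x' \<in> T" "y' \<in> T" for x y x' y'
    unfolding dd_def by (rule gaussian_sd_triangle[OF gX1[OF that(1,2)] gX1[OF that(3,4)] gX2[OF that]])
  have dd_triangle: "dd x z \<le> dd x y + dd y z" if "x \<in> T" "y \<in> T" "z \<in> T" for x y z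
    using dd_plus[OF that(1,2,2,3)] by (simp add: dd_def)
  have dd_sym: "dd x y = dd y x" for x y by (simp add: dd_def power2_commute)
  have gH: "gaussian_rv N (\<lambda>\<xi>. \<Sum>p\<in>F. b p * h (u p) \<xi>)" if "finite F" for F :: "'c set" and b u
  proof -
    have "(\<Sum>p\<in>F. b p * h (u p) \<xi>) = (\<Sum>k<n. (\<Sum>p\<in>F. b p * a * sg (u p) k) * \<xi> k)" for \<xi>
      by (simp add: h_def sum_distrib_left sum_distrib_right mult.assoc sum.swap[of _ F])
    then show ?thesis using gN(1)[of "\<lambda>k. \<Sum>p\<in>F. b p * a * sg (u p) k"] by simp
  qed
  have gh1: "gaussian_rv N (h s)" for s using gH[of "{()}" "\<lambda>_. 1" "\<lambda>_. s"] by simp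
  have gh2: "gaussian_rv N (\<lambda>\<xi>. h s \<xi> - h s' \<xi>)" for s s'
    using gH[of "UNIV :: bool set" "\<lambda>i. if i then 1 else -1" "\<lambda>i. if i then s else s'"]
    by (simp add: UNIV_bool)
  have Yg: "gaussian_rv (M \<Otimes>\<^sub>M N) (\<lambda>q. \<Sum>p\<in>PI. b p * Y p q)" for b
  proof -
    have "(\<Sum>p\<in>PI. b p * Y p q)
        = (\<Sum>p\<in>PI. b p * (X (snd p) (fst q) - X (c (fst p)) (fst q))) + (\<Sum>p\<in>PI. b p * h (fst p) (snd q))" for q
      by (simp add: Y_def distrib_left sum.distrib)
    then show ?thesis
      using gaussian_rv_indep_sum(1)[OF gX[OF PI(1), of snd "\<lambda>p. c (fst p)" b] M.prob_space_axioms gH[OF PI(1), of b fst] N.prob_space_axioms] PIT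
      by (simp add: split_beta')
  qed
  have Y1: "gaussian_rv (M \<Otimes>\<^sub>M N) (Y p)" if "p \<in> PI" for p
    using gaussian_rv_indep_sum(1)[OF gX1 M.prob_space_axioms gh1 N.prob_space_axioms, of "snd p" "c (fst p)" "fst p"] PIT[OF that]
    by (simp add: split_beta' Y_def[abs_def])
  have Y: "centered_gaussian_process (M \<Otimes>\<^sub>M N) PI Y"
    by (rule cgpI) (use P.prob_space_axioms PI Yg Y1 in \<open>auto dest: gaussian_rv_measurable\<close>)
  define X' where "X' p = X (snd p)" for p :: "nat set \<times> 'i"
  have X': "centered_gaussian_process M PI X'"
    by (rule cgp_linear[OF X T PI(1), where L="\<lambda>p x. if x = snd p then 1 else 0"])
       (use PIT T in \<open>simp add: X'_def if_distrib[of "\<lambda>x. x * _"] cong: if_cong\<close>)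
  have dist: "(\<integral>q. (Y p q - Y p' q)\<^sup>2 \<partial>(M \<Otimes>\<^sub>M N)) \<le> (\<integral>\<omega>. (X' p \<omega> - X' p' \<omega>)\<^sup>2 \<partial>M)" if p: "p \<in> PI" "p' \<in> PI" for p p'
  proof -
    define s s' x x' where "s = fst p" "s' = fst p'" "x = snd p" "x' = snd p'"
    note ss = this
    have T4: "x \<in> T" "c s \<in> T" "x' \<in> T" "c s' \<in> T" and s: "s \<subseteq> {..<n}" "s' \<subseteq> {..<n}" "x \<in> A s" "x' \<in> A s'"
      using PIT[OF p(1)] PIT[OF p(2)] by (auto simp: ss)
    define U where "U \<omega> = (X x \<omega> - X (c s) \<omega>) + (X (c s') \<omega> - X x' \<omega>)" for \<omega>
    have U: "gaussian_rv M U" unfolding U_def[abs_def] using T4 by (intro gX2)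
    have "(\<integral>q. (Y p q - Y p' q)\<^sup>2 \<partial>(M \<Otimes>\<^sub>M N)) = (\<integral>q. (U (fst q) + (h s (snd q) - h s' (snd q)))\<^sup>2 \<partial>(M \<Otimes>\<^sub>M N))"
      by (intro Bochner_Integration.integral_cong refl arg_cong[where f="\<lambda>u. u\<^sup>2"]) (simp add: Y_def U_def ss)
    also have "\<dots> = (\<integral>\<omega>. (U \<omega>)\<^sup>2 \<partial>M) + (\<integral>\<xi>. (h s \<xi> - h s' \<xi>)\<^sup>2 \<partial>N)"
      by (rule gaussian_rv_indep_sum(2)[OF U M.prob_space_axioms gh2 N.prob_space_axioms])
    finally have eq: "(\<integral>q. (Y p q - Y p' q)\<^sup>2 \<partial>(M \<Otimes>\<^sub>M N)) = (\<integral>\<omega>. (U \<omega>)\<^sup>2 \<partial>M) + (\<integral>\<xi>. (h s \<xi> - h s' \<xi>)\<^sup>2 \<partial>N)" .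
    show ?thesis
    proof (cases "s = s'")
      case True
      then show ?thesis unfolding eq by (simp add: U_def X'_def ss)
    next
      case False
      have "(\<integral>\<xi>. (h s \<xi> - h s' \<xi>)\<^sup>2 \<partial>N) = (\<integral>\<xi>. (\<Sum>k<n. a * (sg s k - sg s' k) * \<xi> k)\<^sup>2 \<partial>N)"
        by (simp add: h_def sum_distrib_left sum_subtractf algebra_simps)
      also have "\<dots> = (\<Sum>k<n. (a * (sg s k - sg s' k))\<^sup>2)" by (rule gN(2))
      also have "\<dots> \<le> (\<Sum>k<n. a\<^sup>2 * 4)"
        by (intro sum_mono) (auto simp: sg_def power_mult_distrib)
      also have "\<dots> = 4 * (a\<^sup>2 * n)" by simp
      also have "\<dots> = 4 / 9 * e\<^sup>2" unfolding a(3) by simp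
      finally have 1: "(\<integral>\<xi>. (h s \<xi> - h s' \<xi>)\<^sup>2 \<partial>N) \<le> 4 / 9 * e\<^sup>2" .
      have "sqrt (\<integral>\<omega>. (U \<omega>)\<^sup>2 \<partial>M) \<le> dd x (c s) + dd (c s') x'"
        unfolding U_def by (rule dd_plus[OF T4(1,2,4,3)])
      also have "\<dots> \<le> e / 8 + e / 8"
        using close[OF s(1,3)] close[OF s(2,4)] dd_sym[of "c s'" x'] by (simp add: dd_def)
      finally have "(sqrt (\<integral>\<omega>. (U \<omega>)\<^sup>2 \<partial>M))\<^sup>2 \<le> (e / 4)\<^sup>2" by (intro power_mono) auto
      then have 2: "(\<integral>\<omega>. (U \<omega>)\<^sup>2 \<partial>M) \<le> (e / 4)\<^sup>2" by simp
      have "e \<le> dd (c s) (c s')" unfolding dd_def by (rule sep[OF s(1,2) False])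
      also have "\<dots> \<le> dd (c s) x + dd x (c s')" by (rule dd_triangle[OF T4(2,1,4)])
      also have "\<dots> \<le> dd (c s) x + (dd x x' + dd x' (c s'))" using dd_triangle[OF T4(1,3,4)] by simp
      finally have "3 / 4 * e \<le> dd x x'"
        using close[OF s(1,3), folded dd_def] close[OF s(2,4), folded dd_def] dd_sym[of "c s" x] by linarith
      then have "(3 / 4 * e)\<^sup>2 \<le> (dd x x')\<^sup>2" using e by (intro power_mono) auto
      then have 3: "(3 / 4 * e)\<^sup>2 \<le> (\<integral>\<omega>. (X' p \<omega> - X' p' \<omega>)\<^sup>2 \<partial>M)" by (simp add: X'_def ss dd_def)
      have "(e / 4)\<^sup>2 + 4 / 9 * e\<^sup>2 \<le> (3 / 4 * e)\<^sup>2"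
        using zero_le_power2[of e] unfolding power_mult_distrib power_divide by simp
      then show ?thesis unfolding eq using 1 2 3 by linarith
    qed
  qed
  have "expected_max M X (\<Union>s\<in>Pow {..<n}. A s) = (\<integral>\<omega>. Max ((\<lambda>p. X' p \<omega>) ` PI) \<partial>M)"
  proof -
    have "(\<lambda>x. X x \<omega>) ` (\<Union>s\<in>Pow {..<n}. A s) = (\<lambda>p. X' p \<omega>) ` PI" for \<omega>
    proof (intro equalityI subsetI)
      fix u assume "u \<in> (\<lambda>x. X x \<omega>) ` (\<Union>s\<in>Pow {..<n}. A s)"
      then obtain s x where "s \<in> Pow {..<n}" "x \<in> A s" "u = X x \<omega>" by blast
      then show "u \<in> (\<lambda>p. X' p \<omega>) ` PI"
        by (intro image_eqI[of _ _ "(s, x)"]) (simp_all add: PI_def X'_def)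
    next
      fix u assume "u \<in> (\<lambda>p. X' p \<omega>) ` PI"
      then obtain p where p: "p \<in> PI" "u = X' p \<omega>" by blast
      then show "u \<in> (\<lambda>x. X x \<omega>) ` (\<Union>s\<in>Pow {..<n}. A s)"
        using PIT[OF p(1)] unfolding p(2) X'_def by blast
    qed
    then show ?thesis by (simp add: expected_max_def)
  qed
  also have "\<dots> \<ge> (\<integral>q. Max ((\<lambda>p. Y p q) ` PI) \<partial>(M \<Otimes>\<^sub>M N))"
    by (rule sudakov_fernique[OF Y X' PI dist])
  finally have SF: "(\<integral>q. Max ((\<lambda>p. Y p q) ` PI) \<partial>(M \<Otimes>\<^sub>M N)) \<le> expected_max M X (\<Union>s\<in>Pow {..<n}. A s)" .
  have Yint: "integrable (M \<Otimes>\<^sub>M N) (\<lambda>(\<omega>, \<xi>). Max ((\<lambda>p. Y p (\<omega>, \<xi>)) ` PI))"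
    using integrable_Max[OF PI, of "M \<Otimes>\<^sub>M N" Y] gaussian_rv_integrable_self[OF Y1] by (simp add: split_beta')
  have X1int: "integrable M (X x)" if "x \<in> T" for x
    by (rule gaussian_rv_integrable_self[OF cgp_gaussian_rv_one[OF X T that]])
  have abs\<xi>: "integrable N (\<lambda>\<xi>. \<bar>\<xi> k\<bar>)" "(\<integral>\<xi>. \<bar>\<xi> k\<bar> \<partial>N) = sqrt (2 / pi)" if k: "k < n" for k
  proof -
    have "(\<Sum>j<n. (if j = k then 1 else 0) * \<xi> j) = \<xi> k" for \<xi> :: "nat \<Rightarrow> real"
      using k by (simp add: if_distrib[of "\<lambda>x. x * _"] cong: if_cong)
    then have g: "gaussian_rv N (\<lambda>\<xi>. \<xi> k)" and v: "(\<integral>\<xi>. (\<xi> k)\<^sup>2 \<partial>N) = 1"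
      using gN[of "\<lambda>j. if j = k then 1 else 0"] k by (simp_all add: if_distrib[of "\<lambda>x. x\<^sup>2"] cong: if_cong)
    show "integrable N (\<lambda>\<xi>. \<bar>\<xi> k\<bar>)" using gaussian_rv_integrable_self[OF g] by simp
    show "(\<integral>\<xi>. \<bar>\<xi> k\<bar> \<partial>N) = sqrt (2 / pi)" using gaussian_rv_abs_mean[OF g] v by simp
  qed
  have inner: "g + a * (\<Sum>k<n. \<bar>\<xi> k\<bar>) \<le> (\<integral>\<omega>. Max ((\<lambda>p. Y p (\<omega>, \<xi>)) ` PI) \<partial>M)" for \<xi>
  proof -
    \<comment> \<open>For fixed \<open>\<xi>\<close> the best vertex of the cube is the sign pattern
      of \<open>\<xi>\<close>. Keeping only the piece \<open>A s\<close> is enough, and subtracting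
      \<open>X (c s)\<close> there costs nothing on average because it is centred.\<close>
    define s where "s = {k. k < n \<and> \<xi> k \<ge> 0}"
    have s: "s \<subseteq> {..<n}" by (auto simp: s_def)
    have fA: "finite (A s)" using A[OF s] T finite_subset by blast
    have hs: "h s \<xi> = a * (\<Sum>k<n. \<bar>\<xi> k\<bar>)"
      unfolding h_def by (intro arg_cong[where f="\<lambda>u. a * u"] sum.cong) (auto simp: sg_def s_def)
    have "integrable M (X x)" if "x \<in> A s" for x using A[OF s] X1int that by blast
    then have iA: "integrable M (\<lambda>\<omega>. Max ((\<lambda>x. X x \<omega>) ` A s))" using A(2)[OF s] fA by (intro integrable_Max)
    have "g + h s \<xi> \<le> expected_max M X (A s) + h s \<xi>" using g[OF s] by simp
    also have "\<dots> = (\<integral>\<omega>. Max ((\<lambda>x. X x \<omega>) ` A s) - X (c s) \<omega> + h s \<xi> \<partial>M)"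
      using iA X1int[OF c[OF s]] gaussian_rv_mean[OF cgp_gaussian_rv_one[OF X T c[OF s]]]
      by (simp add: expected_max_def M.prob_space)
    also have "\<dots> \<le> (\<integral>\<omega>. Max ((\<lambda>p. Y p (\<omega>, \<xi>)) ` PI) \<partial>M)"
    proof (rule integral_mono)
      show "integrable M (\<lambda>\<omega>. Max ((\<lambda>x. X x \<omega>) ` A s) - X (c s) \<omega> + h s \<xi>)" using iA X1int[OF c[OF s]] by simp
      show "integrable M (\<lambda>\<omega>. Max ((\<lambda>p. Y p (\<omega>, \<xi>)) ` PI))"
        using PIT X1int by (intro integrable_Max[OF PI]) (simp add: Y_def)
      fix \<omega>
      have "Max ((\<lambda>x. X x \<omega>) ` A s) \<in> (\<lambda>x. X x \<omega>) ` A s" using fA A(2)[OF s] by (intro Max_in) auto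
      then obtain x where x: "x \<in> A s" "Max ((\<lambda>x. X x \<omega>) ` A s) = X x \<omega>" by auto
      then have "Max ((\<lambda>x. X x \<omega>) ` A s) - X (c s) \<omega> + h s \<xi> = Y (s, x) (\<omega>, \<xi>)" by (simp add: Y_def)
      also have "\<dots> \<le> Max ((\<lambda>p. Y p (\<omega>, \<xi>)) ` PI)" using PI x s by (intro Max_ge) (auto simp: PI_def)
      finally show "Max ((\<lambda>x. X x \<omega>) ` A s) - X (c s) \<omega> + h s \<xi> \<le> Max ((\<lambda>p. Y p (\<omega>, \<xi>)) ` PI)" .
    qed
    finally show ?thesis by (simp add: hs)
  qed
  have "e * sqrt n / 5 = (a * n) * (3 / 5)" using a(2) by simp
  also have "\<dots> \<le> (a * n) * sqrt (2 / pi)" using three_fifths_le_sqrt_2_over_pi a by (intro mult_left_mono) auto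
  finally have "g + e * sqrt n / 5 \<le> g + a * (\<Sum>k<n. \<integral>\<xi>. \<bar>\<xi> k\<bar> \<partial>N)" using abs\<xi>(2) by (simp add: mult_ac)
  also have "\<dots> = (\<integral>\<xi>. g + a * (\<Sum>k<n. \<bar>\<xi> k\<bar>) \<partial>N)"
  proof -
    have "integrable N (\<lambda>\<xi>. \<Sum>k<n. \<bar>\<xi> k\<bar>)" using abs\<xi>(1) by (intro Bochner_Integration.integrable_sum) auto
    moreover have "(\<integral>\<xi>. (\<Sum>k<n. \<bar>\<xi> k\<bar>) \<partial>N) = (\<Sum>k<n. \<integral>\<xi>. \<bar>\<xi> k\<bar> \<partial>N)"
      using abs\<xi>(1) by (intro Bochner_Integration.integral_sum) auto
    ultimately show ?thesis by (simp add: N.prob_space)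
  qed
  also have "\<dots> \<le> (\<integral>\<xi>. (\<integral>\<omega>. Max ((\<lambda>p. Y p (\<omega>, \<xi>)) ` PI) \<partial>M) \<partial>N)"
  proof (rule integral_mono[OF _ _ inner])
    show "integrable N (\<lambda>\<xi>. g + a * (\<Sum>k<n. \<bar>\<xi> k\<bar>))"
      using abs\<xi>(1) by (intro Bochner_Integration.integrable_add integrable_mult_right Bochner_Integration.integrable_sum) auto
    show "integrable N (\<lambda>\<xi>. \<integral>\<omega>. Max ((\<lambda>p. Y p (\<omega>, \<xi>)) ` PI) \<partial>M)" using P.integrable_snd[OF Yint] .
  qed
  also have "\<dots> = (\<integral>q. Max ((\<lambda>p. Y p q) ` PI) \<partial>(M \<Otimes>\<^sub>M N))" using P.integral_snd[OF Yint] by (simp add: split_beta')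
  finally show ?thesis using SF by linarith
qed

section \<open>Majorizing measures from the growth condition\<close>

lemma prob_bind_pmf_ge:
  "pmf w i * measure_pmf.prob (\<mu> i) S \<le> measure_pmf.prob (bind_pmf w \<mu>) S"
proof -
  have "ennreal (pmf w i * measure_pmf.prob (\<mu> i) S) = (\<integral>\<^sup>+j. emeasure (measure_pmf (\<mu> i)) S * indicator {i} j \<partial>measure_pmf w)"
    by (subst nn_integral_cmult_indicator)
       (auto simp: measure_pmf.emeasure_eq_measure measure_pmf_single ennreal_mult' mult.commute)
  also have "\<dots> \<le> (\<integral>\<^sup>+j. emeasure (measure_pmf (\<mu> j)) S \<partial>measure_pmf w)"
    by (intro nn_integral_mono) (auto split: split_indicator)
  also have "\<dots> = ennreal (measure_pmf.prob (bind_pmf w \<mu>) S)"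
    unfolding measure_pmf.emeasure_eq_measure[symmetric] emeasure_bind_pmf ..
  finally show ?thesis by simp
qed

text \<open>Draw a dyadic block \<open>n\<close> with probability \<open>2 ^ -(n + 1)\<close>, then
  one of its \<open>2 ^ n\<close> indices uniformly; an index in the block gets mass
  \<open>2 ^ -(2 * n + 1)\<close>. Counting from \<open>Suc i\<close> puts index 0 into block
  0.\<close>

lemma dyadic_weights: "\<exists>w :: nat pmf. \<forall>i n. 2 ^ n \<le> Suc i \<longrightarrow> Suc i < 2 ^ Suc n \<longrightarrow> (1 / 2) ^ (2 * n + 1) \<le> pmf w i"
proof (intro exI allI impI)
  let ?B = "\<lambda>n. {2 ^ n - 1..<2 ^ Suc n - 1 :: nat}"
  let ?w = "bind_pmf (geometric_pmf (1 / 2)) (\<lambda>n. pmf_of_set (?B n))"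
  fix i n :: nat assume i: "2 ^ n \<le> Suc i" "Suc i < 2 ^ Suc n"
  then have iB: "i \<in> ?B n" by auto
  have c: "card (?B n) = 2 ^ n" by simp
  have "(1 / 2) ^ (2 * n + 1) = pmf (geometric_pmf (1 / 2)) n * measure_pmf.prob (pmf_of_set (?B n)) {i}"
    using iB c by (subst measure_pmf_single, subst pmf_of_set) (auto simp: power_add power_mult power2_eq_square power_mult_distrib field_simps)
  also have "\<dots> \<le> pmf ?w i"
    using prob_bind_pmf_ge[of "geometric_pmf (1 / 2)" n "\<lambda>n. pmf_of_set (?B n)" "{i}"] by (simp add: measure_pmf_single)
  finally show "(1 / 2) ^ (2 * n + 1) \<le> pmf ?w i" .
qed

lemma sqrt_log_inv_one [simp]: "sqrt_log_inv 1 = 0"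
  by (simp add: sqrt_log_inv_def)

lemma measurable_sqrt_log_inv [measurable]: "sqrt_log_inv \<in> borel_measurable borel"
  unfolding sqrt_log_inv_def[abs_def] by measurable

text \<open>The logarithm of the inverse weight is \<open>(2 * n + 1) * ln 2\<close>, at most
  \<open>2 * n + 1\<close>; subadditivity of the root separates it from the entropy of
  \<open>q\<close>, and \<open>sqrt (2 * n + 1)\<close> is at most \<open>2 * sqrt n + 1\<close>.
  For \<open>q = 0\<close> the right-hand side is infinite.\<close>

lemma sqrt_log_inv_weight:
  assumes w: "(1 / 2) ^ (2 * n + 1) * q \<le> p" and q: "0 \<le> q" "q \<le> 1" and p: "p \<le> 1"
  shows "sqrt_log_inv p \<le> ennreal (2 * sqrt n + 1) + sqrt_log_inv q"
proof (cases "q = 0")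
  case False
  then have q0: "q > 0" using q by simp
  define v where "v = (1 / 2 :: real) ^ (2 * n + 1)"
  have v: "v > 0" by (simp add: v_def)
  have p0: "p > 0" using w q0 v by (intro less_le_trans[OF _ w]) (auto simp: v_def)
  have "ln (1 / v) = (2 * n + 1) * ln 2" 
  proof -
    have "1 / v = 2 ^ (2 * n + 1)" by (simp add: v_def power_one_over)
    then show ?thesis by (simp only: ln_realpow)
  qed
  also have "\<dots> \<le> real (2 * n + 1) * 1" using ln_2_less_1 by (intro mult_left_mono) auto
  finally have lv: "ln (1 / v) \<le> 2 * n + 1" by simp
  have s: "sqrt (2 * real n + 1) \<le> 2 * sqrt n + 1"
    by (rule real_le_lsqrt) (auto simp: power2_sum power_mult_distrib)
  have "ln (1 / p) \<le> ln (1 / (v * q))"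
    using w[folded v_def] p0 q0 v by (simp add: ln_div)
  also have "\<dots> = ln (1 / v) + ln (1 / q)" using v q0 by (simp add: ln_div ln_mult)
  finally have "sqrt (ln (1 / p)) \<le> sqrt ((2 * n + 1) + ln (1 / q))" using lv by (intro real_sqrt_le_mono) simp
  also have "\<dots> \<le> sqrt (2 * n + 1) + sqrt (ln (1 / q))"
    using q q0 by (intro sqrt_add_le_add_sqrt) (auto simp: ln_div)
  also have "\<dots> \<le> (2 * sqrt n + 1) + sqrt (ln (1 / q))" using s by (simp add: add.commute)
  finally have "sqrt (ln (1 / p)) \<le> (2 * sqrt n + 1) + sqrt (ln (1 / q))" .
  then show ?thesis using p0 q0 q by (simp add: sqrt_log_inv_def ln_div flip: ennreal_plus) 
qed (simp add: sqrt_log_inv_def)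

text \<open>Applied to the distances of a finite index set, this supplies the scale at which both
  the recursion over partitions and the chaining terminate.\<close>

lemma finite_nonneg_gap:
  fixes D :: "real set"
  assumes "finite D" "\<And>v. v \<in> D \<Longrightarrow> 0 \<le> v"
  obtains \<delta> where "\<delta> > 0" "\<And>v. v \<in> D \<Longrightarrow> v < \<delta> \<Longrightarrow> v = 0"
proof -
  let ?\<delta> = "Min (insert 1 {v \<in> D. v > 0})"
  have "?\<delta> > 0" using assms(1) by (subst Min_gr_iff) auto
  moreover have "v = 0" if "v \<in> D" "v < ?\<delta>" for v
  proof (rule ccontr)
    assume "v \<noteq> 0"
    then have "?\<delta> \<le> v" using assms that by (intro Min_le) force+
    then show False using that by simp
  qed
  ultimately show thesis by (rule that)
qed

text \<open>The growth condition abstracts the super-Sudakov inequality. Indexing the pieces by the subsets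
  of \<open>{..<n}\<close> makes \<open>sqrt n\<close> play the role of the root of the logarithm of their number.\<close>

locale growth_functional =
  fixes T :: "'i set" and d :: "'i \<Rightarrow> 'i \<Rightarrow> real" and G :: "'i set \<Rightarrow> real"
  assumes finite_T: "finite T"
    and d_refl: "x \<in> T \<Longrightarrow> d x x = 0"
    and d_sym: "x \<in> T \<Longrightarrow> y \<in> T \<Longrightarrow> d x y = d y x"
    and d_triangle: "x \<in> T \<Longrightarrow> y \<in> T \<Longrightarrow> z \<in> T \<Longrightarrow> d x z \<le> d x y + d y z"
    and d_nonneg: "0 \<le> d x y"
    and G_mono: "A \<noteq> {} \<Longrightarrow> A \<subseteq> B \<Longrightarrow> B \<subseteq> T \<Longrightarrow> G A \<le> G B"
    and G_nonneg: "A \<noteq> {} \<Longrightarrow> A \<subseteq> T \<Longrightarrow> 0 \<le> G A"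
    and growth: "\<And>n e c (P :: nat set \<Rightarrow> 'i set) g. n > 0 \<Longrightarrow> e \<ge> 0 \<Longrightarrow>
      (\<And>s. s \<subseteq> {..<n} \<Longrightarrow> c s \<in> T \<and> P s \<noteq> {} \<and> P s \<subseteq> {y\<in>T. d (c s) y \<le> e / 8} \<and> g \<le> G (P s)) \<Longrightarrow>
      (\<And>s s'. s \<subseteq> {..<n} \<Longrightarrow> s' \<subseteq> {..<n} \<Longrightarrow> s \<noteq> s' \<Longrightarrow> e \<le> d (c s) (c s')) \<Longrightarrow>
      g + e * sqrt n / 5 \<le> G (\<Union>s\<in>Pow {..<n}. P s)"
begin

definition dball :: "'i \<Rightarrow> real \<Rightarrow> 'i set" where
  "dball x r = {y\<in>T. d x y \<le> r}"

text \<open>The cut-off is \<open>2 * r\<close> because points of a set of radius \<open>r\<close>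
  are at most that far apart: for a measure carried by such a set, seen from one of its points, the
  integrand vanishes beyond.\<close>

definition entropy_int :: "real \<Rightarrow> 'i pmf \<Rightarrow> 'i \<Rightarrow> ennreal" where
  "entropy_int r \<mu> x = (\<integral>\<^sup>+\<epsilon>\<in>{0..2 * r}. sqrt_log_inv (measure_pmf.prob \<mu> (dball x \<epsilon>)) \<partial>lborel)"

lemma dball_self: "x \<in> T \<Longrightarrow> 0 \<le> r \<Longrightarrow> x \<in> dball x r"
  by (simp add: dball_def d_refl)

lemma measurable_prob_dball [measurable]: "(\<lambda>\<epsilon>. measure_pmf.prob \<mu> (dball x \<epsilon>)) \<in> borel_measurable borel"
proof -
  have "measure_pmf.prob \<mu> (dball x \<epsilon>) = (\<Sum>y\<in>T. if d x y \<le> \<epsilon> then pmf \<mu> y else 0)" for \<epsilon>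
    using finite_T by (simp add: measure_measure_pmf_finite dball_def sum.inter_filter)
  then show ?thesis by simp
qed

text \<open>Among the stages \<open>0..i\<close> there are at least \<open>2 ^ n\<close>, which are
  labelled by the subsets of \<open>{..<n}\<close>. Their centres are more than \<open>r\<close>
  apart, and each stage owns a piece of radius \<open>r / 8\<close> and value at least
  \<open>g\<close>, so the growth condition applies to the union of these pieces inside
  \<open>A\<close>.\<close>

lemma greedy_gain:
  assumes r: "r \<ge> 0" and A: "A \<subseteq> T"
    and R: "\<And>j. j \<le> i \<Longrightarrow> R j \<noteq> {}" "\<And>j. R j \<subseteq> A" "\<And>j k. j \<le> k \<Longrightarrow> R k \<subseteq> R j"
    and c: "\<And>j. j \<le> i \<Longrightarrow> c j \<in> R j"
    and far: "\<And>j k. j < k \<Longrightarrow> k \<le> i \<Longrightarrow> r < d (c j) (c k)"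
    and g: "\<And>j. j \<le> i \<Longrightarrow> g \<le> G (R j \<inter> dball (c j) (r / 8))"
    and n: "2 ^ n \<le> Suc i"
  shows "g + r * sqrt n / 5 \<le> G A"
proof (cases "n = 0")
  \<comment> \<open>The growth condition asks for \<open>n > 0\<close>; for \<open>n = 0\<close> a
    single piece and monotonicity suffice.\<close>
  case True
  have "c 0 \<in> R 0 \<inter> dball (c 0) (r / 8)" using c[of 0] R(2)[of 0] A r by (auto intro!: dball_self)
  then have "G (R 0 \<inter> dball (c 0) (r / 8)) \<le> G A" using A R(2)[of 0] by (intro G_mono) auto
  then show ?thesis using g[of 0] True by simp
next
  case False
  obtain h where h: "bij_betw h (Pow {..<n}) {..<2 ^ n :: nat}"
    using finite_same_card_bij[of "Pow {..<n}" "{..<2 ^ n :: nat}"] by (auto simp: card_Pow)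
  have hi: "h s \<le> i" if "s \<subseteq> {..<n}" for s
  proof -
    have "h s < 2 ^ n" using bij_betwE[OF h] that by blast
    then show ?thesis using n by linarith
  qed
  have cT: "c j \<in> T" if "j \<le> i" for j using c[OF that] R(2)[of j] A by blast
  have "g + r * sqrt n / 5 \<le> G (\<Union>s\<in>Pow {..<n}. R (h s) \<inter> dball (c (h s)) (r / 8))"
  proof (rule growth)
    fix s assume s: "s \<subseteq> {..<n}"
    have "c (h s) \<in> R (h s) \<inter> dball (c (h s)) (r / 8)"
      using c[OF hi[OF s]] cT[OF hi[OF s]] r by (auto intro!: dball_self)
    then show "c (h s) \<in> T \<and> R (h s) \<inter> dball (c (h s)) (r / 8) \<noteq> {} \<and>
        R (h s) \<inter> dball (c (h s)) (r / 8) \<subseteq> {y \<in> T. d (c (h s)) y \<le> r / 8} \<and> g \<le> G (R (h s) \<inter> dball (c (h s)) (r / 8))"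
      using cT[OF hi[OF s]] g[OF hi[OF s]] by (auto simp: dball_def)
  next
    fix s s' assume s: "s \<subseteq> {..<n}" "s' \<subseteq> {..<n}" "s \<noteq> s'"
    then have "h s \<noteq> h s'" using h by (auto simp: bij_betw_def inj_on_def)
    then consider "h s < h s'" | "h s' < h s" by linarith
    then show "r \<le> d (c (h s)) (c (h s'))"
    proof cases
      case 1 then show ?thesis using far hi[OF s(2)] by fastforce
    next
      case 2 then show ?thesis using far[OF 2 hi[OF s(1)]] d_sym[OF cT cT] hi s by fastforce
    qed
  qed (use False r in auto)
  also have "\<dots> \<le> G A"
  proof (rule G_mono)
    have "c (h {}) \<in> R (h {}) \<inter> dball (c (h {})) (r / 8)"
      using c[OF hi] cT[OF hi] r by (auto intro!: dball_self)
    then show "(\<Union>s\<in>Pow {..<n}. R (h s) \<inter> dball (c (h s)) (r / 8)) \<noteq> {}" by blast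
  qed (use R(2) A in auto)
  finally show ?thesis .
qed

text \<open>Besides \<open>G A\<close>, the induction tracks a bound \<open>a\<close> for the pieces of \<open>A\<close> one scale below:
  the growth condition controls the pieces of the greedy cells, not the cells themselves, so the
  gain is only collected two scales further down.\<close>

lemma ex_measure_step:
  assumes r: "r > 0" and A: "A \<subseteq> T" "A \<noteq> {}"
    and a: "\<And>x. x \<in> A \<Longrightarrow> G (A \<inter> dball x (r / 8)) \<le> a"
    and IH: "\<And>B c b. B \<subseteq> T \<Longrightarrow> B \<noteq> {} \<Longrightarrow> c \<in> T \<Longrightarrow> B \<subseteq> dball c (r / 8) \<Longrightarrow>
      (\<And>x. x \<in> B \<Longrightarrow> G (B \<inter> dball x (r / 64)) \<le> b) \<Longrightarrow>
      \<exists>\<mu>. set_pmf \<mu> \<subseteq> B \<and> (\<forall>x\<in>B. entropy_int (r / 8) \<mu> x \<le> ennreal (160 * (G B + b) + 3 * (r / 8)))"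
  shows "\<exists>\<mu>. set_pmf \<mu> \<subseteq> A \<and> (\<forall>x\<in>A. entropy_int r \<mu> x \<le> ennreal (160 * (G A + a) + 3 * r))"
proof -
  have fA: "finite A" using A finite_T finite_subset by blast
  \<comment> \<open>The centre maximises \<open>G\<close> at radius \<open>r / 64\<close>, whereas
    the removed cell has radius \<open>r / 8\<close>. Hence the value at the centre bounds all
    pieces of the cell at that smaller radius, and these values do not increase from stage to
    stage.\<close>
  have "\<exists>x. S \<subseteq> A \<longrightarrow> S \<noteq> {} \<longrightarrow> x \<in> S \<and> (\<forall>y\<in>S. G (S \<inter> dball y (r / 64)) \<le> G (S \<inter> dball x (r / 64)))" for S
  proof (cases "S \<subseteq> A \<and> S \<noteq> {}")
    case True
    then have "finite S" using fA finite_subset by blast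
    then show ?thesis
      using True ex_min_if_finite[of "(\<lambda>y. - G (S \<inter> dball y (r / 64))) ` S"] by (auto simp: not_less) 
  qed auto
  then obtain sel where sel: "S \<subseteq> A \<Longrightarrow> S \<noteq> {} \<Longrightarrow> sel S \<in> S"
      "S \<subseteq> A \<Longrightarrow> S \<noteq> {} \<Longrightarrow> y \<in> S \<Longrightarrow> G (S \<inter> dball y (r / 64)) \<le> G (S \<inter> dball (sel S) (r / 64))" for S y
    by metis
  define R where "R i = ((\<lambda>S. S - dball (sel S) (r / 8)) ^^ i) A" for i
  have R0: "R 0 = A" and RS: "R (Suc i) = R i - dball (sel (R i)) (r / 8)" for i by (simp_all add: R_def)
  have Rdec: "R k \<subseteq> R j" if "j \<le> k" for j k
    using that by (induction rule: dec_induct) (auto simp: RS)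
  have RA: "R j \<subseteq> A" for j using Rdec[of 0 j] R0 by simp
  define c where "c i = sel (R i)" for i
  define C where "C i = R i \<inter> dball (c i) (r / 8)" for i
  define g where "g i = G (R i \<inter> dball (c i) (r / 64))" for i
  have cR: "c i \<in> R i" and cT: "c i \<in> T" and cC: "c i \<in> C i" if "R i \<noteq> {}" for i
    using sel(1)[OF RA that] RA[of i] A r by (auto simp: c_def C_def intro!: dball_self)
  have gmax: "G (R i \<inter> dball y (r / 64)) \<le> g i" if "y \<in> R i" for i y
    using sel(2)[OF RA _ that] that by (auto simp: g_def c_def)
  have cover: "\<exists>i. x \<in> C i" if x: "x \<in> A" for x
  proof (rule ccontr)
    assume "\<not> ?thesis"
    then have no: "x \<notin> C i" for i by simp
    have xR: "x \<in> R i" for i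
    proof (induction i)
      case 0 show ?case by (simp add: R0 x)
    next
      case (Suc i) then show ?case using no[of i] by (auto simp: RS C_def c_def)
    qed
    \<comment> \<open>Every stage removes at least its own centre, so a point cannot survive
      \<open>Suc (card A)\<close> stages.\<close>
    have "card (R i) + i \<le> card A" for i
    proof (induction i)
      case 0 show ?case by (simp add: R0)
    next
      case (Suc i)
      have "R (Suc i) \<subset> R i" using cC[of i] xR[of i] by (auto simp: RS C_def c_def)
      then have "card (R (Suc i)) < card (R i)" using RA fA finite_subset psubset_card_mono by metis
      then show ?case using Suc by simp
    qed
    from this[of "Suc (card A)"] show False by simp
  qed
  have Csub: "C i \<subseteq> T" "C i \<subseteq> A" for i using RA A by (auto simp: C_def)
  \<comment> \<open>The recursion enters the cell with the bound \<open>b = g i\<close>, which is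
    what the greedy choice guarantees.\<close>
  have "\<exists>\<mu>. R i \<noteq> {} \<longrightarrow> set_pmf \<mu> \<subseteq> C i \<and> (\<forall>x\<in>C i. entropy_int (r / 8) \<mu> x \<le> ennreal (160 * (G (C i) + g i) + 3 * (r / 8)))" for i
  proof (cases "R i = {}")
    case False
    have "\<exists>\<mu>. set_pmf \<mu> \<subseteq> C i \<and> (\<forall>x\<in>C i. entropy_int (r / 8) \<mu> x \<le> ennreal (160 * (G (C i) + g i) + 3 * (r / 8)))"
    proof (rule IH[OF Csub(1) _ cT[OF False]])
      show "C i \<noteq> {}" using cC[OF False] by auto
      show "C i \<subseteq> dball (c i) (r / 8)" by (auto simp: C_def)
      fix x assume x: "x \<in> C i"
      then have xT: "x \<in> T" and xR: "x \<in> R i" using Csub by (auto simp: C_def)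
      have "G (C i \<inter> dball x (r / 64)) \<le> G (R i \<inter> dball x (r / 64))"
        using x dball_self[OF xT, of "r / 64"] r RA A by (intro G_mono) (auto simp: C_def)
      also have "\<dots> \<le> g i" by (rule gmax[OF xR])
      finally show "G (C i \<inter> dball x (r / 64)) \<le> g i" .
    qed
    then show ?thesis by blast
  qed auto
  then obtain \<mu> where \<mu>: "\<And>i. R i \<noteq> {} \<Longrightarrow> set_pmf (\<mu> i) \<subseteq> C i"
      "\<And>i x. R i \<noteq> {} \<Longrightarrow> x \<in> C i \<Longrightarrow> entropy_int (r / 8) (\<mu> i) x \<le> ennreal (160 * (G (C i) + g i) + 3 * (r / 8))"
    by metis
  obtain w :: "nat pmf" where w: "\<And>i n. 2 ^ n \<le> Suc i \<Longrightarrow> Suc i < 2 ^ Suc n \<Longrightarrow> (1 / 2) ^ (2 * n + 1) \<le> pmf w i"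
    using dyadic_weights by blast
  \<comment> \<open>\<open>w\<close> gives mass to every natural number, including stages at which
    nothing remains. Those reuse \<open>\<mu> 0\<close>, so the mixture stays in
    \<open>A\<close>.\<close>
  define \<nu> where "\<nu> i = (if R i \<noteq> {} then \<mu> i else \<mu> 0)" for i
  define m where "m = bind_pmf w \<nu>"
  have "set_pmf (\<nu> i) \<subseteq> A" for i
    using \<mu>(1)[of i] \<mu>(1)[of 0] Csub(2)[of i] Csub(2)[of 0] R0 A(2) by (auto simp: \<nu>_def)
  then have mA: "set_pmf m \<subseteq> A" by (auto simp: m_def)
  have "entropy_int r m x \<le> ennreal (160 * (G A + a) + 3 * r)" if x: "x \<in> A" for x
  proof -
    obtain i where i: "x \<in> C i" using cover[OF x] by blast
    then have Ri: "R i \<noteq> {}" by (auto simp: C_def)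
    have xT: "x \<in> T" using x A by auto
    obtain n where n: "2 ^ n \<le> Suc i" "Suc i < 2 ^ Suc n"
      using ex_power_ivl1[of 2 "Suc i"] by auto
    define s where "s = 2 * sqrt (real n) + 1"
    have s0: "s \<ge> 0" by (simp add: s_def)
    have pw: "(1 / 2) ^ (2 * n + 1) * measure_pmf.prob (\<mu> i) S \<le> measure_pmf.prob m S" for S
    proof -
      have "(1 / 2) ^ (2 * n + 1) * measure_pmf.prob (\<mu> i) S \<le> pmf w i * measure_pmf.prob (\<mu> i) S"
        using w[OF n] by (intro mult_right_mono) auto
      also have "\<dots> \<le> measure_pmf.prob m S" using prob_bind_pmf_ge[of w i \<nu> S] Ri by (simp add: m_def \<nu>_def)
      finally show ?thesis .
    qed
    have full: "measure_pmf.prob (\<mu> i) (dball x \<epsilon>) = 1" if \<epsilon>: "\<epsilon> > 2 * (r / 8)" for \<epsilon>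
    proof -
      have "C i \<subseteq> dball x \<epsilon>"
      proof
        fix y assume y: "y \<in> C i"
        then have yT: "y \<in> T" using Csub by auto
        have "d x y \<le> d x (c i) + d (c i) y" by (rule d_triangle[OF xT cT[OF Ri] yT])
        also have "\<dots> \<le> r / 8 + r / 8" using i y d_sym[OF xT cT[OF Ri]] by (auto simp: C_def dball_def)
        finally show "y \<in> dball x \<epsilon>" using \<epsilon> yT by (simp add: dball_def)
      qed
      then show ?thesis using \<mu>(1)[OF Ri] by (subst measure_pmf.prob_eq_1) (auto simp: AE_measure_pmf_iff)
    qed
    let ?f = "\<lambda>\<epsilon>. sqrt_log_inv (measure_pmf.prob (\<mu> i) (dball x \<epsilon>))"
    \<comment> \<open>Mixing costs \<open>s\<close> over the whole interval, while the entropy of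
      \<open>\<mu> i\<close> is felt only up to \<open>2 * (r / 8)\<close>, since beyond that radius
      the ball contains the whole cell.\<close>
    have "entropy_int r m x \<le> (\<integral>\<^sup>+\<epsilon>. ennreal s * indicator {0..2 * r} \<epsilon> + ?f \<epsilon> * indicator {0..2 * (r / 8)} \<epsilon> \<partial>lborel)"
      unfolding entropy_int_def
    proof (rule nn_integral_mono)
      fix \<epsilon>
      have "sqrt_log_inv (measure_pmf.prob m (dball x \<epsilon>)) \<le> ennreal s + ?f \<epsilon>"
        unfolding s_def by (rule sqrt_log_inv_weight[OF pw]) auto
      then show "sqrt_log_inv (measure_pmf.prob m (dball x \<epsilon>)) * indicator {0..2 * r} \<epsilon>
        \<le> ennreal s * indicator {0..2 * r} \<epsilon> + ?f \<epsilon> * indicator {0..2 * (r / 8)} \<epsilon>"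
        using full[of \<epsilon>] by (cases "\<epsilon> > 2 * (r / 8)") (auto split: split_indicator)
    qed
    also have "\<dots> = ennreal s * emeasure lborel {0..2 * r} + entropy_int (r / 8) (\<mu> i) x"
      unfolding entropy_int_def by (subst nn_integral_add) (auto simp: nn_integral_cmult_indicator)
    also have "\<dots> \<le> ennreal (s * (2 * r)) + ennreal (160 * (G (C i) + g i) + 3 * (r / 8))"
      using \<mu>(2)[OF Ri i] s0 r by (intro add_mono) (simp_all add: ennreal_mult)
    also have "\<dots> = ennreal (s * (2 * r) + (160 * (G (C i) + g i) + 3 * (r / 8)))"
    proof -
      have "0 \<le> G (C i)" using i Csub by (intro G_nonneg) auto
      moreover have "0 \<le> g i" unfolding g_def using cR[OF Ri] cT[OF Ri] RA[of i] A r dball_self[of "c i" "r / 64"]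
        by (intro G_nonneg) auto
      ultimately show ?thesis using s0 r by (subst ennreal_plus) auto
    qed
    also have "\<dots> \<le> ennreal (160 * (G A + a) + 3 * r)"
    proof (rule ennreal_leI)
      have Rne: "R j \<noteq> {}" if "j \<le> i" for j using Rdec[OF that] Ri by auto
      have "G (C i) \<le> G (A \<inter> dball (c i) (r / 8))" using i RA[of i] A by (intro G_mono) (auto simp: C_def)
      also have "\<dots> \<le> a" using cR[OF Ri] RA[of i] by (intro a) auto
      finally have 1: "G (C i) \<le> a" .
      have "g i + r / 8 * sqrt n / 5 \<le> G A"
      proof (rule greedy_gain[where R=R and c=c and i=i])
        show "r / 8 < d (c j) (c k)" if "j < k" "k \<le> i" for j k
        proof -
          have "c k \<in> R (Suc j)" using cR[OF Rne[OF that(2)]] Rdec[of "Suc j" k] that by auto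
          then show ?thesis using cT[OF Rne[OF that(2)]] by (auto simp: RS c_def dball_def)
        qed
        show "g i \<le> G (R j \<inter> dball (c j) (r / 8 / 8))" if "j \<le> i" for j
        proof -
          have "g i \<le> G (R j \<inter> dball (c i) (r / 64))" unfolding g_def
            using Rdec[OF that] cR[OF Ri] cT[OF Ri] dball_self[of "c i" "r / 64"] r RA[of j] A by (intro G_mono) auto
          also have "\<dots> \<le> g j" using Rdec[OF that] cR[OF Ri] by (intro gmax) auto
          finally show ?thesis by (simp add: g_def)
        qed
      qed (use r A RA Rdec Rne cR n in auto)
      then have 2: "160 * (g i + r / 8 * sqrt n / 5) \<le> 160 * G A" by simp
      \<comment> \<open>The constant 160 makes the greedy gain \<open>r * sqrt n / 40\<close> cancel
        the part \<open>4 * r * sqrt n\<close> of the mixing cost. The leftover \<open>2 * r\<close>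
        and the \<open>3 * (r / 8)\<close> from the smaller scale fit into
        \<open>3 * r\<close>.\<close>
      have "160 * (r / 8 * sqrt n / 5) = 4 * (r * sqrt n)" "s * (2 * r) = 4 * (r * sqrt n) + 2 * r"
        by (simp_all add: s_def algebra_simps)
      then show "s * (2 * r) + (160 * (G (C i) + g i) + 3 * (r / 8)) \<le> 160 * (G A + a) + 3 * r"
        using 1 2 r by (simp add: distrib_left)
    qed
    finally show ?thesis .
  qed
  then show ?thesis using mA by blast
qed

text \<open>Induction from the finest scale upwards. At scale \<open>r0\<close> all distances within
  \<open>A\<close> are zero, so a point mass has no entropy; each further step multiplies the radius
  by 8.\<close>

lemma ex_measure_scale:
  assumes r0: "r0 > 0" and disc: "\<And>x y. x \<in> T \<Longrightarrow> y \<in> T \<Longrightarrow> d x y \<le> 2 * r0 \<Longrightarrow> d x y = 0"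
    and A: "A \<subseteq> T" "A \<noteq> {}" "c \<in> T" "A \<subseteq> dball c (8 ^ k * r0)"
    and a: "\<And>x. x \<in> A \<Longrightarrow> G (A \<inter> dball x (8 ^ k * r0 / 8)) \<le> a"
  shows "\<exists>\<mu>. set_pmf \<mu> \<subseteq> A \<and> (\<forall>x\<in>A. entropy_int (8 ^ k * r0) \<mu> x \<le> ennreal (160 * (G A + a) + 3 * (8 ^ k * r0)))"
  using A a
proof (induction k arbitrary: A c a)
  case 0
  then obtain y where y: "y \<in> A" by auto
  have "entropy_int r0 (return_pmf y) x = 0" if x: "x \<in> A" for x
  proof -
    have "d x y \<le> d x c + d c y" using 0 x y by (intro d_triangle) auto
    also have "\<dots> \<le> 2 * r0" 
    proof -
      have "d c x \<le> r0" "d c y \<le> r0" using 0 x y by (auto simp: dball_def)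
      moreover have "d x c = d c x" using 0 x by (intro d_sym) auto
      ultimately show ?thesis by simp
    qed
    finally have "d x y = 0" using 0 x y by (intro disc) auto
    then have "y \<in> dball x \<epsilon>" if "\<epsilon> \<ge> 0" for \<epsilon> using that y 0 by (auto simp: dball_def)
    then have z: "sqrt_log_inv (measure_pmf.prob (return_pmf y) (dball x \<epsilon>)) * indicator {0..2 * r0} \<epsilon> = 0" for \<epsilon>
      by (auto split: split_indicator simp: measure_return_pmf)
    show ?thesis unfolding entropy_int_def z by simp
  qed
  then show ?case using y by (intro exI[of _ "return_pmf y"]) auto
next
  case (Suc k)
  show ?case
  proof (rule ex_measure_step)
    fix B c b assume B: "B \<subseteq> T" "B \<noteq> {}" "c \<in> T" "B \<subseteq> dball c (8 ^ Suc k * r0 / 8)"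
      and b: "\<And>x. x \<in> B \<Longrightarrow> G (B \<inter> dball x (8 ^ Suc k * r0 / 64)) \<le> b"
    show "\<exists>\<mu>. set_pmf \<mu> \<subseteq> B \<and> (\<forall>x\<in>B. entropy_int (8 ^ Suc k * r0 / 8) \<mu> x
        \<le> ennreal (160 * (G B + b) + 3 * (8 ^ Suc k * r0 / 8)))"
      using Suc.IH[of B c b] B b by (simp add: mult.commute)
  qed (use Suc.prems r0 in auto)
qed

text \<open>\<open>G T\<close> bounds its own pieces by monotonicity and thus serves also as the
  bound \<open>a\<close>, which doubles 160 to 320. The exponent \<open>k\<close> is chosen so that
  \<open>2 * r / 8 ^ k\<close> is below the smallest positive distance.\<close>

theorem ex_measure:
  assumes r: "r > 0" and c: "c \<in> T" "T \<subseteq> dball c r"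
  shows "\<exists>\<mu>. set_pmf \<mu> \<subseteq> T \<and> (\<forall>x\<in>T. entropy_int r \<mu> x \<le> ennreal (320 * G T + 3 * r))"
proof -
  obtain \<delta> where \<delta>: "\<delta> > 0" and gap: "\<And>v. v \<in> (\<lambda>(x, y). d x y) ` (T \<times> T) \<Longrightarrow> v < \<delta> \<Longrightarrow> v = 0"
    by (rule finite_nonneg_gap[of "(\<lambda>(x, y). d x y) ` (T \<times> T)"]) (use finite_T d_nonneg in auto)
  have \<delta>d: "d x y = 0" if "x \<in> T" "y \<in> T" "d x y < \<delta>" for x y
    using gap[of "d x y"] that by auto
  obtain k where k: "2 * r / \<delta> < 8 ^ k" using real_arch_pow[of 8 "2 * r / \<delta>"] by auto
  define r0 where "r0 = r / 8 ^ k"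
  have r0: "r0 > 0" "8 ^ k * r0 = r" "2 * r0 < \<delta>" using r k \<delta> by (auto simp: r0_def field_simps)
  have "G (T \<inter> dball x (r / 8)) \<le> G T" if "x \<in> T" for x
    using that r dball_self[of x "r / 8"] by (intro G_mono) auto
  then have "\<exists>\<mu>. set_pmf \<mu> \<subseteq> T \<and> (\<forall>x\<in>T. entropy_int r \<mu> x \<le> ennreal (160 * (G T + G T) + 3 * r))"
    using ex_measure_scale[of r0 T c k "G T"] r0 \<delta>d c by auto
  then show ?thesis by simp
qed

end

section \<open>The lower bound for the expected supremum\<close>

lemma gp_dist_eq: "gp_dist M X x y = sqrt (\<integral>\<omega>. (X x \<omega> - X y \<omega>)\<^sup>2 \<partial>M)"
  by (simp add: gp_dist_def)

lemma gp_dist_triangle: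
  assumes X: "centered_gaussian_process M T X" "finite T" and "x \<in> T" "y \<in> T" "z \<in> T"
  shows "gp_dist M X x z \<le> gp_dist M X x y + gp_dist M X y z"
  using gaussian_sd_triangle[of M "\<lambda>\<omega>. X x \<omega> - X y \<omega>" "\<lambda>\<omega>. X y \<omega> - X z \<omega>"] cgp_gaussian_diff[OF X] assms(3-5)
  by (simp add: gp_dist_eq)

lemma gp_dist_sym: "gp_dist M X x y = gp_dist M X y x"
  by (simp add: gp_dist_eq power2_commute)

lemma cgp_integrable:
  "centered_gaussian_process M T X \<Longrightarrow> finite T \<Longrightarrow> x \<in> T \<Longrightarrow> integrable M (X x)"
  by (rule gaussian_rv_integrable_self[OF cgp_gaussian_rv_one])

lemma cgp_integrable_Max:
  assumes "centered_gaussian_process M T X" "finite T" "A \<subseteq> T" "A \<noteq> {}"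
  shows "integrable M (\<lambda>\<omega>. Max ((\<lambda>x. X x \<omega>) ` A))"
  using assms finite_subset[OF assms(3,2)] by (intro integrable_Max cgp_integrable[of M T]) auto

lemma growth_functional_expected_max:
  assumes X: "centered_gaussian_process M T X" and T: "finite T"
  shows "growth_functional T (gp_dist M X) (expected_max M X)"
proof
  show "gp_dist M X x z \<le> gp_dist M X x y + gp_dist M X y z" if "x \<in> T" "y \<in> T" "z \<in> T" for x y z
    using gp_dist_triangle[OF X T that] .
  show mono: "expected_max M X A \<le> expected_max M X B" if "A \<noteq> {}" "A \<subseteq> B" "B \<subseteq> T" for A B
    unfolding expected_max_def using that finite_subset[OF that(3) T]
    by (intro integral_mono cgp_integrable_Max[OF X T] Max_mono) auto
  show "0 \<le> expected_max M X A" if A: "A \<noteq> {}" "A \<subseteq> T" for A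
  proof -
    obtain x where x: "x \<in> A" using A by auto
    then have "expected_max M X {x} \<le> expected_max M X A" using A by (intro mono) auto
    moreover have "expected_max M X {x} = 0"
      using gaussian_rv_mean[OF cgp_gaussian_rv_one[OF X T]] x A by (auto simp: expected_max_def)
    ultimately show ?thesis by simp
  qed
  fix n :: nat and e g :: real and c and P :: "nat set \<Rightarrow> 'b set"
  assume n: "n > 0" "e \<ge> 0"
    and P: "\<And>s. s \<subseteq> {..<n} \<Longrightarrow> c s \<in> T \<and> P s \<noteq> {} \<and> P s \<subseteq> {y \<in> T. gp_dist M X (c s) y \<le> e / 8} \<and> g \<le> expected_max M X (P s)"
    and sep: "\<And>s s'. s \<subseteq> {..<n} \<Longrightarrow> s' \<subseteq> {..<n} \<Longrightarrow> s \<noteq> s' \<Longrightarrow> e \<le> gp_dist M X (c s) (c s')"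
  show "g + e * sqrt n / 5 \<le> expected_max M X (\<Union>s\<in>Pow {..<n}. P s)"
  proof (rule super_sudakov[OF X T n])
    show "c s \<in> T" "P s \<subseteq> T" "P s \<noteq> {}" "g \<le> expected_max M X (P s)" if "s \<subseteq> {..<n}" for s
      using P[OF that] by auto
    show "e \<le> sqrt (\<integral>\<omega>. (X (c s) \<omega> - X (c s') \<omega>)\<^sup>2 \<partial>M)" if "s \<subseteq> {..<n}" "s' \<subseteq> {..<n}" "s \<noteq> s'" for s s'
      using sep[OF that] by (simp add: gp_dist_eq)
    show "sqrt (\<integral>\<omega>. (X x \<omega> - X (c s) \<omega>)\<^sup>2 \<partial>M) \<le> e / 8" if "s \<subseteq> {..<n}" "x \<in> P s" for s x
      using P[OF that(1)] that(2) gp_dist_sym[of M X "c s" x] unfolding gp_dist_eq by auto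
  qed
qed (use T in \<open>auto simp: gp_dist_eq power2_commute\<close>)

lemma gp_sd_nonneg: "0 \<le> gp_sd M X x"
  by (simp add: gp_sd_def)

section \<open>Radius and expected maximum of an anchored process\<close>

context
  fixes M :: "'a measure" and T :: "'i set" and X :: "'i \<Rightarrow> 'a \<Rightarrow> real" and x0 :: 'i
  assumes anch: "anchored_gaussian_process M T X x0"
begin

lemma anchored: "finite T" "x0 \<in> T" "T \<noteq> {}" "centered_gaussian_process M T X" "AE \<omega> in M. X x0 \<omega> = 0" "prob_space M"
  using anch by (auto simp: anchored_gaussian_process_def centered_gaussian_process_def)

lemma anchored_measurable: "x \<in> T \<Longrightarrow> X x \<in> borel_measurable M"
  using anchored by (intro cgp_measurable)

lemma gp_sd_eq_dist: "x \<in> T \<Longrightarrow> gp_sd M X x = gp_dist M X x x0"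
proof -
  assume x: "x \<in> T"
  note [measurable] = anchored_measurable
  have "(\<integral>\<omega>. (X x \<omega>)\<^sup>2 \<partial>M) = (\<integral>\<omega>. (X x \<omega> - X x0 \<omega>)\<^sup>2 \<partial>M)"
    using x anchored(2,5) by (intro integral_cong_AE) auto
  then show ?thesis by (simp add: gp_sd_def gp_dist_eq)
qed

lemma gp_sd_le_radius: "x \<in> T \<Longrightarrow> gp_sd M X x \<le> gp_radius M T X"
  unfolding gp_radius_def using anchored(1) by (intro cSUP_upper) auto

lemma gp_radius_nonneg: "0 \<le> gp_radius M T X"
  using gp_sd_le_radius[OF anchored(2)] gp_sd_nonneg[of M X x0] by linarith

lemma expected_sup_eq: "expected_sup M T X = ennreal (expected_max M X T)"
  using anchored by (simp add: expected_sup_def expected_max_def cSup_eq_Max)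

text \<open>Almost surely \<open>\<bar>X x \<omega>\<bar> + X x \<omega>\<close> is twice the larger
  of \<open>X x \<omega>\<close> and \<open>X x0 \<omega>\<close>. Its mean is that of
  \<open>\<bar>X x \<omega>\<bar>\<close>, at least \<open>3 / 5\<close> of the standard deviation,
  and 2 divided by \<open>3 / 5\<close> is \<open>10 / 3\<close>.\<close>

lemma gp_radius_le_expected_max: "gp_radius M T X \<le> 10 / 3 * expected_max M X T"
  unfolding gp_radius_def
proof (rule cSUP_least[OF anchored(3)])
  fix x assume x: "x \<in> T"
  note [measurable] = anchored_measurable
  have g: "gaussian_rv M (X x)" by (rule cgp_gaussian_rv_one[OF anchored(4,1) x])
  have i: "integrable M (X x)" by (rule gaussian_rv_integrable_self[OF g])
  have "3 / 5 * gp_sd M X x \<le> sqrt (2 / pi) * gp_sd M X x"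
    using three_fifths_le_sqrt_2_over_pi gp_sd_nonneg by (rule mult_right_mono)
  also have "\<dots> = (\<integral>\<omega>. \<bar>X x \<omega>\<bar> \<partial>M)" by (simp add: gaussian_rv_abs_mean[OF g] gp_sd_def)
  also have "\<dots> = (\<integral>\<omega>. \<bar>X x \<omega>\<bar> + X x \<omega> \<partial>M)" using i gaussian_rv_mean[OF g] by simp
  also have "\<dots> \<le> (\<integral>\<omega>. 2 * Max ((\<lambda>x. X x \<omega>) ` T) \<partial>M)"
  proof (rule integral_mono_AE)
    show "integrable M (\<lambda>\<omega>. 2 * Max ((\<lambda>x. X x \<omega>) ` T))"
      using cgp_integrable_Max[OF anchored(4,1) subset_refl anchored(3)] by simp
    show "AE \<omega> in M. \<bar>X x \<omega>\<bar> + X x \<omega> \<le> 2 * Max ((\<lambda>x. X x \<omega>) ` T)"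
      using anchored(5)
    proof eventually_elim
      case (elim \<omega>)
      have "X x \<omega> \<le> Max ((\<lambda>x. X x \<omega>) ` T)" "X x0 \<omega> \<le> Max ((\<lambda>x. X x \<omega>) ` T)"
        using anchored x by (auto intro!: Max_ge)
      then show ?case using elim by (cases "X x \<omega> \<ge> 0") auto
    qed
  qed (use i in simp)
  finally show "gp_sd M X x \<le> 10 / 3 * expected_max M X T" by (simp add: expected_max_def)
qed

text \<open>Balls of radius above \<open>2 * R\<close> contain all of \<open>T\<close>, so
  \<open>gp_Phi\<close> is bounded by the entropy integral cut off at \<open>2 * R\<close>, whatever
  the upper limit \<open>4 * gp_sd M X x\<close>. The total \<open>4 * R + 320 * E\<close> with
  \<open>R\<close> at most \<open>10 / 3 * E\<close> gives 334.\<close>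

lemma radius_plus_inf_Phi_le: "radius_plus_inf_Phi M T X \<le> ennreal 334 * expected_sup M T X"
proof -
  interpret growth_functional T "gp_dist M X" "expected_max M X"
    using anchored by (intro growth_functional_expected_max)
  define R where "R = gp_radius M T X"
  define E where "E = expected_max M X T"
  have R0: "R \<ge> 0" and RE: "R \<le> 10 / 3 * E" and E0: "E \<ge> 0"
    using gp_radius_nonneg gp_radius_le_expected_max G_nonneg[of T] anchored by (auto simp: R_def E_def)
  have dball: "dball = gp_ball M T X" by (intro ext) (simp add: dball_def gp_ball_def)
  have "\<exists>\<mu>\<in>prob_measures_on T. gp_Phi_sup M T X \<mu> \<le> ennreal (320 * E + 3 * R)"
  proof (cases "R = 0")
    \<comment> \<open>The recursion starts from a positive radius. At radius 0 every interval of
      integration is a single point.\<close>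
    case True
    have "gp_sd M X x = 0" if "x \<in> T" for x using gp_sd_le_radius[OF that] gp_sd_nonneg[of M X x] True R_def by simp
    then have "gp_Phi M T X (return_pmf x0) x = 0" if "x \<in> T" for x
      using that by (simp add: gp_Phi_def nn_integral_cmult_indicator nn_integral_null_set null_sets_def)
    then have "gp_Phi_sup M T X (return_pmf x0) = 0" using anchored(3) by (simp add: gp_Phi_sup_def)
    then show ?thesis using anchored(2) by (intro bexI[of _ "return_pmf x0"]) (auto simp: prob_measures_on_def)
  next
    case False
    then have R: "R > 0" using R0 by simp
    have TB: "T \<subseteq> dball x0 R"
    proof
      fix x assume x: "x \<in> T"
      then show "x \<in> dball x0 R"
        using gp_sd_le_radius[OF x] gp_sd_eq_dist[OF x] by (simp add: dball_def R_def gp_dist_sym)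
    qed
    obtain \<mu> where \<mu>: "set_pmf \<mu> \<subseteq> T" "\<And>x. x \<in> T \<Longrightarrow> entropy_int R \<mu> x \<le> ennreal (320 * E + 3 * R)"
      using ex_measure[OF R anchored(2) TB] unfolding E_def by blast
    have "gp_Phi M T X \<mu> x \<le> ennreal (320 * E + 3 * R)" if x: "x \<in> T" for x
    proof -
      have "gp_Phi M T X \<mu> x \<le> entropy_int R \<mu> x"
        unfolding gp_Phi_def entropy_int_def dball
      proof (rule nn_integral_mono)
        fix \<epsilon> :: real
        have "T \<subseteq> gp_ball M T X x \<epsilon>" if e: "\<epsilon> > 2 * R"
        proof
          fix y assume y: "y \<in> T"
          have "gp_dist M X x y \<le> gp_dist M X x x0 + gp_dist M X x0 y" by (rule d_triangle[OF x anchored(2) y])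
          also have "\<dots> \<le> R + R"
            using gp_sd_le_radius[OF x] gp_sd_le_radius[OF y] gp_sd_eq_dist[OF x] gp_sd_eq_dist[OF y]
            by (simp add: R_def gp_dist_sym)
          finally show "y \<in> gp_ball M T X x \<epsilon>" using e y by (simp add: gp_ball_def)
        qed
        then have "measure_pmf.prob \<mu> (gp_ball M T X x \<epsilon>) = 1" if "\<epsilon> > 2 * R"
          using that \<mu>(1) by (subst measure_pmf.prob_eq_1) (auto simp: AE_measure_pmf_iff)
        then show "sqrt_log_inv (measure_pmf.prob \<mu> (gp_ball M T X x \<epsilon>)) * indicator {0..4 * gp_sd M X x} \<epsilon>
          \<le> sqrt_log_inv (measure_pmf.prob \<mu> (gp_ball M T X x \<epsilon>)) * indicator {0..2 * R} \<epsilon>"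
          by (cases "\<epsilon> > 2 * R") (auto split: split_indicator)
      qed
      also have "\<dots> \<le> ennreal (320 * E + 3 * R)" by (rule \<mu>(2)[OF x])
      finally show ?thesis .
    qed
    then have "gp_Phi_sup M T X \<mu> \<le> ennreal (320 * E + 3 * R)" unfolding gp_Phi_sup_def by (rule SUP_least)
    then show ?thesis using \<mu>(1) by (intro bexI[of _ \<mu>]) (auto simp: prob_measures_on_def)
  qed
  then obtain \<mu> where \<mu>: "\<mu> \<in> prob_measures_on T" "gp_Phi_sup M T X \<mu> \<le> ennreal (320 * E + 3 * R)" by blast
  have "(INF \<mu>\<in>prob_measures_on T. gp_Phi_sup M T X \<mu>) \<le> ennreal (320 * E + 3 * R)"
    using \<mu> by (rule INF_lower2)
  then have "radius_plus_inf_Phi M T X \<le> ennreal R + ennreal (320 * E + 3 * R)"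
    unfolding radius_plus_inf_Phi_def R_def by (rule add_left_mono)
  also have "\<dots> = ennreal (4 * R + 320 * E)" using R0 E0 by (simp flip: ennreal_plus)
  also have "\<dots> \<le> ennreal (334 * E)" using RE E0 by (intro ennreal_leI) simp
  also have "\<dots> = ennreal 334 * expected_sup M T X" using E0 by (simp add: expected_sup_eq E_def ennreal_mult)
  finally show ?thesis .
qed

end

section \<open>The upper bound for the expected supremum\<close>

text \<open>Separates a deterministic level \<open>L\<close> from a random size \<open>E\<close>.
  Only \<open>E > L\<close> needs an argument: there \<open>E = L * v\<close>, and the extra
  \<open>sqrt (ln v)\<close> is at most \<open>v\<close>.\<close>

lemma sqrt_ln_le_add:
  assumes "1 \<le> L" "1 \<le> E"
  shows "sqrt (ln E) \<le> sqrt (ln L) + E / L"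
proof (cases "E \<le> L")
  case True
  then have "sqrt (ln E) \<le> sqrt (ln L)" using assms by simp
  moreover have "0 \<le> E / L" using assms by simp
  ultimately show ?thesis by linarith
next
  case False
  define v where "v = E / L"
  have v: "1 \<le> v" "E = L * v" using False assms by (simp_all add: v_def)
  have "ln v \<le> v - 1" using v by (intro ln_le_minus_one) auto
  also have "\<dots> \<le> v\<^sup>2" 
  proof -
    have "v * 1 \<le> v * v" using v by (intro mult_left_mono) auto
    then show ?thesis unfolding power2_eq_square by linarith
  qed
  finally have lv: "sqrt (ln v) \<le> v" using v by (intro real_le_lsqrt) auto
  have "sqrt (ln E) = sqrt (ln L + ln v)" using v assms by (simp add: ln_mult)
  also have "\<dots> \<le> sqrt (ln L) + sqrt (ln v)" using v assms by (intro sqrt_add_le_add_sqrt) auto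
  finally show ?thesis using lv by (simp add: v_def)
qed

text \<open>Write \<open>\<bar>t\<bar>\<close> as \<open>2 * e\<close> times the root of the
  logarithm of \<open>exp (t\<^sup>2 / (4 * e\<^sup>2))\<close>, the quantity whose mean is bounded
  when \<open>t\<close> is Gaussian with standard deviation \<open>e\<close>, and separate it from
  \<open>L\<close>.\<close>

lemma abs_le_exp_square:
  fixes t e L :: real
  assumes e: "0 \<le> e" and 0: "e = 0 \<Longrightarrow> t = 0" and L: "1 \<le> L"
  shows "\<bar>t\<bar> \<le> 2 * e * (sqrt (ln L) + exp (t\<^sup>2 / (4 * e\<^sup>2)) / L)"
proof (cases "e = 0")
  case False
  have "t\<^sup>2 / (4 * e\<^sup>2) = (\<bar>t\<bar> / (2 * e))\<^sup>2" by (simp add: power_divide power_mult_distrib)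
  then have "\<bar>t\<bar> = 2 * e * sqrt (ln (exp (t\<^sup>2 / (4 * e\<^sup>2))))" using e False by simp
  also have "\<dots> \<le> 2 * e * (sqrt (ln L) + exp (t\<^sup>2 / (4 * e\<^sup>2)) / L)"
    using e L by (intro mult_left_mono sqrt_ln_le_add) auto
  finally show ?thesis .
qed (use 0 in simp)

text \<open>The level is \<open>L = 1 / m\<close> with \<open>m\<close> the total weight. The
  exponential terms then carry a factor \<open>m\<close>, which cancels the normalisation of the
  average; the mass enters only through \<open>sqrt (ln (1 / m))\<close>.\<close>

lemma weighted_average_bound:
  fixes w v e :: "'k \<Rightarrow> real"
  assumes I: "finite I" and w: "\<And>i. i \<in> I \<Longrightarrow> 0 \<le> w i" and m: "0 < (\<Sum>i\<in>I. w i)" "(\<Sum>i\<in>I. w i) \<le> 1"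
    and e: "\<And>i. i \<in> I \<Longrightarrow> 0 \<le> e i" "\<And>i. i \<in> I \<Longrightarrow> e i \<le> D" "\<And>i. i \<in> I \<Longrightarrow> e i = 0 \<Longrightarrow> v i = 0"
    and Q: "(\<Sum>i\<in>I. w i * exp ((v i)\<^sup>2 / (4 * (e i)\<^sup>2))) \<le> Q"
  shows "\<bar>(\<Sum>i\<in>I. w i * v i) / (\<Sum>i\<in>I. w i)\<bar> \<le> 2 * D * (sqrt (ln (1 / (\<Sum>i\<in>I. w i))) + Q)"
proof -
  define m where "m = (\<Sum>i\<in>I. w i)"
  have m01: "0 < m" "m \<le> 1" using m by (simp_all add: m_def)
  obtain i where "i \<in> I" using m by fastforce
  then have D: "D \<ge> 0" using e by force
  let ?E = "\<lambda>i. exp ((v i)\<^sup>2 / (4 * (e i)\<^sup>2))"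
  have v: "\<bar>v i\<bar> \<le> 2 * D * (sqrt (ln (1 / m)) + ?E i * m)" if i: "i \<in> I" for i
  proof -
    have "\<bar>v i\<bar> \<le> 2 * e i * (sqrt (ln (1 / m)) + ?E i / (1 / m))"
      using e i m01 by (intro abs_le_exp_square) auto
    also have "\<dots> \<le> 2 * D * (sqrt (ln (1 / m)) + ?E i / (1 / m))"
      using e i m01 by (intro mult_right_mono) (auto intro!: add_nonneg_nonneg)
    finally show ?thesis by simp
  qed
  have "\<bar>\<Sum>i\<in>I. w i * v i\<bar> \<le> (\<Sum>i\<in>I. w i * \<bar>v i\<bar>)"
    using w by (intro order_trans[OF sum_abs] sum_mono) (simp add: abs_mult)
  also have "\<dots> \<le> (\<Sum>i\<in>I. w i * (2 * D * (sqrt (ln (1 / m)) + ?E i * m)))"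
    using w v by (intro sum_mono mult_left_mono) auto
  also have "\<dots> = 2 * D * (sqrt (ln (1 / m)) * (\<Sum>i\<in>I. w i) + (\<Sum>i\<in>I. w i * ?E i) * m)"
    by (simp add: sum_distrib_left sum_distrib_right sum.distrib distrib_left mult_ac)
  also have "\<dots> \<le> 2 * D * (sqrt (ln (1 / m)) * m + Q * m)"
    using D Q m01 by (intro mult_left_mono add_mono mult_right_mono) (auto simp: m_def)
  also have "\<dots> = 2 * D * (sqrt (ln (1 / m)) + Q) * m" by (simp add: algebra_simps)
  finally show ?thesis using m01 by (simp add: m_def[symmetric] field_simps)
qed

text \<open>Chaining through the averages of \<open>u\<close> over the balls of radius \<open>4 \<sigma> x / 2 ^ k\<close> around \<open>x\<close>;
  the randomness only enters through \<open>Q\<close> and \<open>Q'\<close>, which do not depend on \<open>x\<close>.\<close>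

lemma chaining_pointwise:
  fixes T :: "'i set" and d :: "'i \<Rightarrow> 'i \<Rightarrow> real" and p u \<sigma> :: "'i \<Rightarrow> real"
  defines "m \<equiv> \<lambda>x r. \<Sum>y\<in>{y\<in>T. d x y \<le> r}. p y"
  assumes T: "finite T" and x: "x \<in> T" and p: "\<And>y. 0 \<le> p y" "(\<Sum>y\<in>T. p y) \<le> 1"
    and d: "\<And>y. 0 \<le> d x y" "\<And>y z. 0 \<le> d y z" "\<And>y z. y \<in> T \<Longrightarrow> z \<in> T \<Longrightarrow> d y z \<le> d x y + d x z"
    and \<sigma>: "\<And>y. 0 \<le> \<sigma> y" "\<And>y. y \<in> T \<Longrightarrow> \<sigma> y \<le> \<sigma> x + d x y"
    and u: "\<And>y z. y \<in> T \<Longrightarrow> z \<in> T \<Longrightarrow> d y z = 0 \<Longrightarrow> u y = u z" "\<And>y. y \<in> T \<Longrightarrow> \<sigma> y = 0 \<Longrightarrow> u y = 0"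
    and m: "\<And>r. 0 < r \<Longrightarrow> 0 < m x r"
    and \<phi>: "\<And>K. (\<Sum>k\<le>K. (4 * \<sigma> x / 2 ^ Suc k) * sqrt (ln (1 / m x (4 * \<sigma> x / 2 ^ k)))) \<le> \<phi>"
    and Q: "(\<Sum>y\<in>T. \<Sum>z\<in>T. p y * p z * exp ((u y - u z)\<^sup>2 / (4 * (d y z)\<^sup>2))) \<le> Q"
    and Q': "(\<Sum>y\<in>T. p y * exp ((u y)\<^sup>2 / (4 * (\<sigma> y)\<^sup>2))) \<le> Q'"
    and pos: "\<sigma> x > 0"
  shows "\<bar>u x\<bar> \<le> 23 * \<phi> + 24 * \<sigma> x * (Q + Q')"
proof -
  define r where "r k = 4 * \<sigma> x / 2 ^ k" for k :: nat
  have r: "r k > 0" and rS: "r (Suc k) = r k / 2" for k using pos by (simp_all add: r_def)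
  define B where "B k = {y\<in>T. d x y \<le> r k}" for k
  have fB: "finite (B k)" and BT: "B k \<subseteq> T" for k using T by (auto simp: B_def)
  define n where "n k = (\<Sum>y\<in>B k. p y)" for k
  have n: "0 < n k" "n k \<le> 1" for k
  proof -
    show "0 < n k" using m[OF r[of k]] by (simp add: n_def B_def m_def)
    have "n k \<le> (\<Sum>y\<in>T. p y)" unfolding n_def using T BT p by (intro sum_mono2) auto
    then show "n k \<le> 1" using p by simp
  qed
  define S where "S k = sqrt (ln (1 / n k))" for k
  have S0: "0 \<le> S k" for k using n[of k] by (simp add: S_def)
  define A where "A k = (\<Sum>y\<in>B k. p y * u y) / n k" for k
  define s where "s k = r (Suc k) * S k" for k
  have s0: "0 \<le> s k" for k using r[of "Suc k"] S0[of k] by (simp add: s_def)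
  have s\<phi>: "(\<Sum>k\<le>K. s k) \<le> \<phi>" for K
    using \<phi>[of K] by (simp add: s_def S_def n_def r_def B_def m_def)
  have Q0: "0 \<le> Q" using Q by (rule order_trans[rotated]) (auto intro!: sum_nonneg p mult_nonneg_nonneg)
  have Q'0: "0 \<le> Q'" using Q' by (rule order_trans[rotated]) (auto intro!: sum_nonneg p mult_nonneg_nonneg)
  \<comment> \<open>The difference of two averages is the average of \<open>u y - u z\<close> over
    the product of the balls, with distances at most \<open>3 / 2 * r k\<close>. The coefficients 6
    and 12 rewrite \<open>3 * r k\<close> as multiples of the interval lengths
    \<open>r (Suc k)\<close> and \<open>r (Suc (Suc k))\<close> occurring in \<open>s k\<close> and
    \<open>s (Suc k)\<close>.\<close>
  have step: "\<bar>A k - A (Suc k)\<bar> \<le> 6 * s k + 12 * s (Suc k) + 3 * r k * Q" for k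
  proof -
    let ?I = "B k \<times> B (Suc k)"
    let ?w = "\<lambda>i. p (fst i) * p (snd i)" and ?v = "\<lambda>i. u (fst i) - u (snd i)"
    have ws: "(\<Sum>i\<in>?I. ?w i) = n k * n (Suc k)"
      by (simp add: n_def sum_product sum.cartesian_product split_beta)
    have "(\<Sum>i\<in>?I. ?w i * ?v i) = (\<Sum>y\<in>B k. \<Sum>z\<in>B (Suc k). p y * u y * p z - p y * (p z * u z))"
      by (simp add: sum.cartesian_product split_beta algebra_simps)
    also have "\<dots> = (\<Sum>y\<in>B k. p y * u y) * n (Suc k) - n k * (\<Sum>z\<in>B (Suc k). p z * u z)"
      by (simp add: n_def sum_subtractf sum_product)
    finally have avg: "(\<Sum>i\<in>?I. ?w i * ?v i) / (\<Sum>i\<in>?I. ?w i) = A k - A (Suc k)"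
      using n[of k] n[of "Suc k"] by (simp add: ws A_def field_simps)
    have "\<bar>(\<Sum>i\<in>?I. ?w i * ?v i) / (\<Sum>i\<in>?I. ?w i)\<bar> \<le> 2 * (r k + r (Suc k)) * (sqrt (ln (1 / (\<Sum>i\<in>?I. ?w i))) + Q)"
    proof (rule weighted_average_bound[where e="\<lambda>i. d (fst i) (snd i)"])
      show "d (fst i) (snd i) \<le> r k + r (Suc k)" if "i \<in> ?I" for i
        using that d(3)[of "fst i" "snd i"] by (auto simp: B_def)
      show "?v i = 0" if "i \<in> ?I" "d (fst i) (snd i) = 0" for i
        using that u(1)[of "fst i" "snd i"] subsetD[OF BT[of k], of "fst i"] subsetD[OF BT[of "Suc k"], of "snd i"] by auto
      have "(\<Sum>i\<in>?I. ?w i * exp ((?v i)\<^sup>2 / (4 * (d (fst i) (snd i))\<^sup>2)))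
          \<le> (\<Sum>i\<in>T \<times> T. ?w i * exp ((?v i)\<^sup>2 / (4 * (d (fst i) (snd i))\<^sup>2)))"
        using T BT by (intro sum_mono2) (auto intro!: mult_nonneg_nonneg p)
      also have "\<dots> \<le> Q" using Q by (simp add: sum.cartesian_product split_beta)
      finally show "(\<Sum>i\<in>?I. ?w i * exp ((?v i)\<^sup>2 / (4 * (d (fst i) (snd i))\<^sup>2))) \<le> Q" .
    qed (use fB p d n[of k] n[of "Suc k"] ws in \<open>auto intro: mult_le_one\<close>)
    then have "\<bar>A k - A (Suc k)\<bar> \<le> 3 * r k * (sqrt (ln (1 / (n k * n (Suc k)))) + Q)"
      unfolding avg unfolding ws rS by simp
    also have "sqrt (ln (1 / (n k * n (Suc k)))) \<le> S k + S (Suc k)"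
    proof -
      have "ln (1 / (n k * n (Suc k))) = ln (1 / n k) + ln (1 / n (Suc k))"
        using n(1)[of k] n(1)[of "Suc k"] by (simp add: ln_div ln_mult)
      then show ?thesis unfolding S_def
        using n[of k] n[of "Suc k"] by (simp only:) (intro sqrt_add_le_add_sqrt, auto)
    qed
    finally have "\<bar>A k - A (Suc k)\<bar> \<le> 3 * r k * (S k + S (Suc k) + Q)" using r[of k] by simp
    also have "\<dots> = 6 * s k + 12 * s (Suc k) + 3 * r k * Q" by (simp add: s_def rS algebra_simps)
    finally show ?thesis .
  qed
  \<comment> \<open>Instead of another average, the value 0 is the reference: on the largest ball
    \<open>\<sigma> y\<close> is at most \<open>\<sigma> x + 4 * \<sigma> x\<close>. The factor 5 of
    \<open>s 0\<close> comes from \<open>r 1 = 2 * \<sigma> x\<close>.\<close>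
  have start: "\<bar>A 0\<bar> \<le> 5 * s 0 + 10 * \<sigma> x * Q'"
  proof -
    have "\<bar>(\<Sum>y\<in>B 0. p y * u y) / (\<Sum>y\<in>B 0. p y)\<bar> \<le> 2 * (5 * \<sigma> x) * (sqrt (ln (1 / (\<Sum>y\<in>B 0. p y))) + Q')"
    proof (rule weighted_average_bound[where e=\<sigma>])
      show "\<sigma> y \<le> 5 * \<sigma> x" if "y \<in> B 0" for y using that \<sigma>(2)[of y] by (auto simp: B_def r_def)
      have "(\<Sum>y\<in>B 0. p y * exp ((u y)\<^sup>2 / (4 * (\<sigma> y)\<^sup>2))) \<le> (\<Sum>y\<in>T. p y * exp ((u y)\<^sup>2 / (4 * (\<sigma> y)\<^sup>2)))"
        using T BT by (intro sum_mono2) (auto intro!: mult_nonneg_nonneg p)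
      then show "(\<Sum>y\<in>B 0. p y * exp ((u y)\<^sup>2 / (4 * (\<sigma> y)\<^sup>2))) \<le> Q'" using Q' by simp
      show "u y = 0" if "y \<in> B 0" "\<sigma> y = 0" for y using that u(2)[of y] subsetD[OF BT[of 0]] by auto
    qed (use fB p \<sigma> n[of 0] in \<open>auto simp: n_def\<close>)
    then have "\<bar>A 0\<bar> \<le> 10 * \<sigma> x * (S 0 + Q')" by (simp add: A_def n_def S_def)
    also have "\<dots> = 5 * s 0 + 10 * \<sigma> x * Q'" by (simp add: s_def r_def algebra_simps)
    finally show ?thesis .
  qed
  have tele: "\<bar>A K\<bar> \<le> \<bar>A 0\<bar> + (\<Sum>k<K. \<bar>A k - A (Suc k)\<bar>)" for K
  proof (induction K)
    case (Suc K)
    have "\<bar>A (Suc K)\<bar> \<le> \<bar>A K\<bar> + \<bar>A K - A (Suc K)\<bar>" by linarith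
    then show ?case using Suc by simp
  qed simp
  \<comment> \<open>A sufficiently small ball contains only points at distance 0 from
    \<open>x\<close>, where \<open>u\<close> has the value \<open>u x\<close>; the telescope
    therefore ends after finitely many steps.\<close>
  obtain K where K: "A K = u x"
  proof -
    obtain \<delta> where \<delta>: "\<delta> > 0" and gap: "\<And>v. v \<in> d x ` T \<Longrightarrow> v < \<delta> \<Longrightarrow> v = 0"
      by (rule finite_nonneg_gap[of "d x ` T"]) (use T d(1) in auto)
    obtain K where "4 * \<sigma> x / \<delta> < 2 ^ K" using real_arch_pow[of 2 "4 * \<sigma> x / \<delta>"] by auto
    then have K: "r K < \<delta>" using \<delta> by (simp add: r_def field_simps)
    have ux: "u y = u x" if y: "y \<in> B K" for y
    proof -
      have yT: "y \<in> T" and dy: "d x y < \<delta>" using y K by (auto simp: B_def)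
      have "d x y = 0" using gap[of "d x y"] yT dy by simp
      then show ?thesis using u(1)[OF x yT] by simp
    qed
    have "(\<Sum>y\<in>B K. p y * u y) = n K * u x"
      unfolding n_def sum_distrib_right by (intro sum.cong) (auto simp: ux)
    then have "A K = u x" using n(1)[of K] by (simp add: A_def)
    then show thesis by (rule that)
  qed
  have geo: "(\<Sum>k<K. r k) \<le> 8 * \<sigma> x"
  proof -
    have "(\<Sum>k<K. r k) = 8 * \<sigma> x - 2 * r K" by (induction K) (simp_all add: r_def rS)
    then show ?thesis using r[of K] by simp
  qed
  have "(\<Sum>k<K. s k) \<le> (\<Sum>k\<le>K. s k)" by (intro sum_mono2) (auto simp: s0)
  then have sum1: "(\<Sum>k<K. s k) \<le> \<phi>" using s\<phi>[of K] by simp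
  have "(\<Sum>k<K. s (Suc k)) \<le> s 0 + (\<Sum>k<K. s (Suc k))" using s0[of 0] by simp
  also have "\<dots> = (\<Sum>k\<le>K. s k)" by (rule sum.atMost_shift[symmetric])
  finally have sum2: "(\<Sum>k<K. s (Suc k)) \<le> \<phi>" using s\<phi>[of K] by simp
  have sum0: "s 0 \<le> \<phi>" using s\<phi>[of 0] by simp
  have "\<bar>u x\<bar> \<le> \<bar>A 0\<bar> + (\<Sum>k<K. \<bar>A k - A (Suc k)\<bar>)" using tele[of K] K by simp
  also have "\<dots> \<le> (5 * s 0 + 10 * \<sigma> x * Q') + (\<Sum>k<K. 6 * s k + 12 * s (Suc k) + 3 * r k * Q)"
    by (intro add_mono start sum_mono step)
  also have "\<dots> = 5 * s 0 + 10 * \<sigma> x * Q' + 6 * (\<Sum>k<K. s k) + 12 * (\<Sum>k<K. s (Suc k)) + 3 * (\<Sum>k<K. r k) * Q"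
    by (simp add: sum.distrib sum_distrib_left sum_distrib_right)
  \<comment> \<open>The entropy coefficients are \<open>5 + 6 + 12 = 23\<close>; the coefficient 24
    is 3 times the geometric sum \<open>8 * \<sigma> x\<close>.\<close>
  also have "\<dots> \<le> 5 * \<phi> + 10 * \<sigma> x * Q' + 6 * \<phi> + 12 * \<phi> + 3 * (8 * \<sigma> x) * Q"
    using sum0 sum1 sum2 geo Q0 Q'0 pos by (intro add_mono mult_right_mono mult_left_mono) auto
  also have "\<dots> \<le> 23 * \<phi> + 24 * \<sigma> x * (Q + Q')"
    using pos Q'0 by (simp add: distrib_left mult_right_mono)
  finally show ?thesis .
qed

text \<open>A lower Riemann sum over the intervals \<open>(a / 2 ^ Suc k, a / 2 ^ k]\<close>: each
  term is the length times the value at the right endpoint, the smallest one for a nonincreasing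
  \<open>f\<close>.\<close>

lemma dyadic_lower_sum:
  fixes f :: "real \<Rightarrow> ennreal"
  assumes [measurable]: "f \<in> borel_measurable borel" and f: "\<And>a b. a \<le> b \<Longrightarrow> f b \<le> f a" and a: "0 < a"
  shows "(\<Sum>k\<le>K. ennreal (a / 2 ^ Suc k) * f (a / 2 ^ k)) \<le> (\<integral>\<^sup>+\<epsilon>\<in>{0..a}. f \<epsilon> \<partial>lborel)"
  using a
proof (induction K arbitrary: a)
  have top: "ennreal (a / 2) * f a \<le> (\<integral>\<^sup>+\<epsilon>\<in>{a / 2<..a}. f \<epsilon> \<partial>lborel)" if "0 < a" for a
  proof -
    have "ennreal (a / 2) * f a = (\<integral>\<^sup>+\<epsilon>. f a * indicator {a / 2<..a} \<epsilon> \<partial>lborel)"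
      using that by (subst nn_integral_cmult_indicator) (auto simp: mult.commute)
    also have "\<dots> \<le> (\<integral>\<^sup>+\<epsilon>\<in>{a / 2<..a}. f \<epsilon> \<partial>lborel)"
      by (intro nn_integral_mono) (auto intro: f split: split_indicator)
    finally show ?thesis .
  qed
  {
    case 0
    have "(\<integral>\<^sup>+\<epsilon>\<in>{a / 2<..a}. f \<epsilon> \<partial>lborel) \<le> (\<integral>\<^sup>+\<epsilon>\<in>{0..a}. f \<epsilon> \<partial>lborel)"
      using 0 by (intro nn_integral_mono) (auto split: split_indicator)
    then show ?case using top[OF 0] by simp
  next
    case (Suc K)
    have "(\<Sum>k\<le>Suc K. ennreal (a / 2 ^ Suc k) * f (a / 2 ^ k))
        = ennreal (a / 2) * f a + (\<Sum>k\<le>K. ennreal ((a / 2) / 2 ^ Suc k) * f ((a / 2) / 2 ^ k))"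
      by (subst sum.atMost_Suc_shift) simp
    also have "\<dots> \<le> (\<integral>\<^sup>+\<epsilon>\<in>{a / 2<..a}. f \<epsilon> \<partial>lborel) + (\<integral>\<^sup>+\<epsilon>\<in>{0..a / 2}. f \<epsilon> \<partial>lborel)"
    proof (intro add_mono top)
      show "(\<Sum>k\<le>K. ennreal ((a / 2) / 2 ^ Suc k) * f ((a / 2) / 2 ^ k)) \<le> (\<integral>\<^sup>+\<epsilon>\<in>{0..a / 2}. f \<epsilon> \<partial>lborel)"
        by (rule Suc.IH) (use Suc.prems in simp)
    qed (use Suc.prems in simp)
    also have "\<dots> = (\<integral>\<^sup>+\<epsilon>. f \<epsilon> * indicator {a / 2<..a} \<epsilon> + f \<epsilon> * indicator {0..a / 2} \<epsilon> \<partial>lborel)"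
      by (rule nn_integral_add[symmetric]) auto
    also have "\<dots> = (\<integral>\<^sup>+\<epsilon>\<in>{0..a}. f \<epsilon> \<partial>lborel)"
      using Suc.prems by (intro nn_integral_cong) (auto split: split_indicator)
    finally show ?case .
  }
qed

lemma sqrt_log_inv_antimono:
  assumes "0 \<le> q" "q \<le> p" "p \<le> 1"
  shows "sqrt_log_inv p \<le> sqrt_log_inv q"
  using assms by (auto simp: sqrt_log_inv_def intro!: ennreal_leI divide_left_mono)

section \<open>The entropy integral as a real dyadic sum\<close>

context
  fixes M :: "'a measure" and T :: "'i set" and X :: "'i \<Rightarrow> 'a \<Rightarrow> real" and x0 :: 'i
  assumes anch: "anchored_gaussian_process M T X x0"
begin

text \<open>A ball of positive radius with mass 0 would make some term of the dyadic lower sum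
  infinite, contradicting finiteness of the integral. Hence all masses are positive and the
  extended-real sum becomes a real one.\<close>

lemma gp_Phi_chaining:
  assumes \<mu>: "set_pmf \<mu> \<subseteq> T" and x: "x \<in> T" and pos: "gp_sd M X x > 0" and \<phi>: "gp_Phi M T X \<mu> x \<le> ennreal \<phi>" "0 \<le> \<phi>"
  defines "m \<equiv> \<lambda>r. \<Sum>y\<in>{y\<in>T. gp_dist M X x y \<le> r}. pmf \<mu> y"
  shows "0 < r \<Longrightarrow> 0 < m r"
    and "(\<Sum>k\<le>K. (4 * gp_sd M X x / 2 ^ Suc k) * sqrt (ln (1 / m (4 * gp_sd M X x / 2 ^ k)))) \<le> \<phi>"
proof -
  note a = anchored[OF anch]
  let ?s = "4 * gp_sd M X x"
  interpret growth_functional T "gp_dist M X" "expected_max M X"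
    using a by (intro growth_functional_expected_max)
  have dball: "dball = gp_ball M T X" by (intro ext) (simp add: dball_def gp_ball_def)
  define f where "f \<epsilon> = sqrt_log_inv (measure_pmf.prob \<mu> (gp_ball M T X x \<epsilon>))" for \<epsilon>
  have pm: "measure_pmf.prob \<mu> (gp_ball M T X x \<epsilon>) = m \<epsilon>" for \<epsilon>
    using a(1) by (simp add: gp_ball_def m_def measure_measure_pmf_finite)
  have m0: "0 \<le> m \<epsilon>" "m \<epsilon> \<le> 1" for \<epsilon> by (simp_all flip: pm)
  have mm: "m \<epsilon> \<le> m \<epsilon>'" if "\<epsilon> \<le> \<epsilon>'" for \<epsilon> \<epsilon>'
    unfolding pm[symmetric] using that by (intro measure_pmf.finite_measure_mono) (auto simp: gp_ball_def)
  have [measurable]: "f \<in> borel_measurable borel" unfolding f_def[abs_def] dball[symmetric] by measurable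
  have f: "f b \<le> f a" if "a \<le> b" for a b
    unfolding f_def pm using that m0 mm by (intro sqrt_log_inv_antimono) auto
  have Phi: "gp_Phi M T X \<mu> x = (\<integral>\<^sup>+\<epsilon>\<in>{0..?s}. f \<epsilon> \<partial>lborel)" by (simp add: gp_Phi_def f_def)
  have le: "(\<Sum>k\<le>K. ennreal (?s / 2 ^ Suc k) * f (?s / 2 ^ k)) \<le> ennreal \<phi>" for K
    using dyadic_lower_sum[of f ?s K] f pos \<phi> Phi by simp
  show mpos: "0 < m r" if "0 < r" for r
  proof (rule ccontr)
    assume "\<not> 0 < m r"
    then have mr: "m r = 0" using m0[of r] by simp
    obtain k where "?s / r < 2 ^ k" using real_arch_pow[of 2 "?s / r"] by auto
    then have "?s / 2 ^ k \<le> r" using that by (simp add: field_simps)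
    then have "m (?s / 2 ^ k) = 0" using mm[of "?s / 2 ^ k" r] mr m0 by (simp add: antisym)
    then have "f (?s / 2 ^ k) = \<infinity>" by (simp add: f_def pm sqrt_log_inv_def)
    then have "\<infinity> \<le> ennreal (?s / 2 ^ Suc k) * f (?s / 2 ^ k)" using pos by (simp add: ennreal_mult_top)
    also have "\<dots> \<le> (\<Sum>k\<le>k. ennreal (?s / 2 ^ Suc k) * f (?s / 2 ^ k))" by (rule member_le_sum) auto
    also note le[of k]
    finally show False by (simp add: top_unique)
  qed
  have fe: "f \<epsilon> = ennreal (sqrt (ln (1 / m \<epsilon>)))" if "0 < \<epsilon>" for \<epsilon>
    using mpos[OF that] by (simp add: f_def pm sqrt_log_inv_def)
  have t: "0 \<le> ?s / 2 ^ Suc k" "0 < ?s / 2 ^ k" "0 \<le> sqrt (ln (1 / m (?s / 2 ^ k)))" for k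
    using pos mpos[of "?s / 2 ^ k"] m0[of "?s / 2 ^ k"] by simp_all
  have "ennreal (\<Sum>k\<le>K. (?s / 2 ^ Suc k) * sqrt (ln (1 / m (?s / 2 ^ k))))
      = (\<Sum>k\<le>K. ennreal ((?s / 2 ^ Suc k) * sqrt (ln (1 / m (?s / 2 ^ k)))))"
    using t by (intro sum_ennreal[symmetric] mult_nonneg_nonneg)
  also have "\<dots> = (\<Sum>k\<le>K. ennreal (?s / 2 ^ Suc k) * f (?s / 2 ^ k))"
    by (simp only: fe[OF t(2)] ennreal_mult[OF t(1,3)])
  also have "\<dots> \<le> ennreal \<phi>" by (rule le)
  finally have "ennreal (\<Sum>k\<le>K. (?s / 2 ^ Suc k) * sqrt (ln (1 / m (?s / 2 ^ k)))) \<le> ennreal \<phi>" .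
  then show "(\<Sum>k\<le>K. (?s / 2 ^ Suc k) * sqrt (ln (1 / m (?s / 2 ^ k)))) \<le> \<phi>"
    by (simp only: ennreal_le_iff[OF \<phi>(2)])
qed

end

section \<open>From the pointwise bound to the expectation\<close>

context
  fixes M :: "'a measure" and T :: "'i set" and X :: "'i \<Rightarrow> 'a \<Rightarrow> real" and x0 :: 'i
  assumes anch: "anchored_gaussian_process M T X x0"
begin

text \<open>With \<open>3 / 2\<close> in place of \<open>sqrt 2\<close>, the two random sums
  contribute \<open>24 * R * (3 / 2 + 3 / 2) = 72 * R\<close>. The functional contributes only
  \<open>23 * \<phi>\<close>, so the radius determines the constant.\<close>

lemma expected_sup_abs_le_Phi_sup:
  assumes \<mu>: "\<mu> \<in> prob_measures_on T"
  shows "expected_sup_abs M T X \<le> ennreal 72 * (ennreal (gp_radius M T X) + gp_Phi_sup M T X \<mu>)"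
proof (cases "gp_Phi_sup M T X \<mu>")
  case top
  then show ?thesis by (simp add: ennreal_mult_top)
next
  case (real \<phi>)
  note a = anchored[OF anch]
  interpret prob_space M by (rule a(6))
  note [measurable] = anchored_measurable[OF anch]
  define R where "R = gp_radius M T X"
  define p where "p = pmf \<mu>"
  have p1: "(\<Sum>y\<in>T. p y) = 1" using \<mu> a(1) by (simp add: p_def prob_measures_on_def sum_pmf_eq_1)
  have R0: "0 \<le> R" using gp_radius_nonneg[OF anch] by (simp add: R_def)
  have \<phi>: "gp_Phi M T X \<mu> x \<le> ennreal \<phi>" if "x \<in> T" for x
    using that unfolding real(2)[symmetric] gp_Phi_sup_def by (intro SUP_upper)
  define Q where "Q \<omega> = (\<Sum>y\<in>T. \<Sum>z\<in>T. p y * p z * exp ((X y \<omega> - X z \<omega>)\<^sup>2 / (4 * (gp_dist M X y z)\<^sup>2)))" for \<omega>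
  define Q' where "Q' \<omega> = (\<Sum>y\<in>T. p y * exp ((X y \<omega>)\<^sup>2 / (4 * (gp_sd M X y)\<^sup>2)))" for \<omega>
  have [measurable]: "Q \<in> borel_measurable M" "Q' \<in> borel_measurable M"
    unfolding Q_def[abs_def] Q'_def[abs_def] by measurable
  have Q0: "0 \<le> Q \<omega>" "0 \<le> Q' \<omega>" for \<omega>
    unfolding Q_def Q'_def p_def by (auto intro!: sum_nonneg mult_nonneg_nonneg)
  have nnE: "(\<integral>\<^sup>+\<omega>. ennreal (c * exp ((V \<omega>)\<^sup>2 / (4 * (sqrt (\<integral>\<omega>. (V \<omega>)\<^sup>2 \<partial>M))\<^sup>2))) \<partial>M) \<le> ennreal (c * (3 / 2))"
    if V: "gaussian_rv M V" and c: "0 \<le> c" for c V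
  proof -
    have [measurable]: "V \<in> borel_measurable M" using V by (rule gaussian_rv_measurable)
    have "(\<integral>\<^sup>+\<omega>. ennreal (c * exp ((V \<omega>)\<^sup>2 / (4 * (sqrt (\<integral>\<omega>. (V \<omega>)\<^sup>2 \<partial>M))\<^sup>2))) \<partial>M)
        = ennreal c * (\<integral>\<^sup>+\<omega>. ennreal (exp ((V \<omega>)\<^sup>2 / (4 * (\<integral>\<omega>. (V \<omega>)\<^sup>2 \<partial>M)))) \<partial>M)"
      using c by (subst nn_integral_cmult[symmetric]) (auto simp: ennreal_mult)
    also have "\<dots> \<le> ennreal c * ennreal (sqrt 2)" by (intro mult_left_mono gaussian_rv_exp_square[OF V]) (auto simp: prob_space_axioms)
    also have "\<dots> \<le> ennreal c * ennreal (3 / 2)" by (intro mult_left_mono ennreal_leI real_le_lsqrt) (auto simp: power2_eq_square)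
    also have "\<dots> = ennreal (c * (3 / 2))" using c by (subst ennreal_mult) auto
    finally show ?thesis .
  qed
  have EQ: "(\<integral>\<^sup>+\<omega>. ennreal (Q \<omega>) \<partial>M) \<le> ennreal (3 / 2)"
  proof -
    have "(\<integral>\<^sup>+\<omega>. ennreal (Q \<omega>) \<partial>M)
        = (\<Sum>y\<in>T. \<Sum>z\<in>T. \<integral>\<^sup>+\<omega>. ennreal (p y * p z * exp ((X y \<omega> - X z \<omega>)\<^sup>2 / (4 * (gp_dist M X y z)\<^sup>2))) \<partial>M)"
      unfolding Q_def by (simp add: nn_integral_sum sum_nonneg p_def flip: sum_ennreal)
    also have "\<dots> \<le> (\<Sum>y\<in>T. \<Sum>z\<in>T. ennreal (p y * p z * (3 / 2)))"
      unfolding gp_dist_eq by (intro sum_mono nnE cgp_gaussian_diff[OF a(4,1)]) (auto simp: p_def)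
    also have "\<dots> = ennreal (\<Sum>y\<in>T. \<Sum>z\<in>T. p y * p z * (3 / 2))"
      by (simp add: sum_nonneg p_def)
    also have "(\<Sum>y\<in>T. \<Sum>z\<in>T. p y * p z * (3 / 2)) = (\<Sum>y\<in>T. p y) * (\<Sum>y\<in>T. p y) * (3 / 2)"
      by (simp only: sum_product) (simp only: sum_distrib_right)
    finally show ?thesis by (simp add: p1)
  qed
  have EQ': "(\<integral>\<^sup>+\<omega>. ennreal (Q' \<omega>) \<partial>M) \<le> ennreal (3 / 2)"
  proof -
    have "(\<integral>\<^sup>+\<omega>. ennreal (Q' \<omega>) \<partial>M) = (\<Sum>y\<in>T. \<integral>\<^sup>+\<omega>. ennreal (p y * exp ((X y \<omega>)\<^sup>2 / (4 * (gp_sd M X y)\<^sup>2))) \<partial>M)"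
      unfolding Q'_def by (simp add: nn_integral_sum sum_nonneg p_def flip: sum_ennreal)
    also have "\<dots> \<le> (\<Sum>y\<in>T. ennreal (p y * (3 / 2)))"
      unfolding gp_sd_def by (intro sum_mono nnE cgp_gaussian_rv_one[OF a(4,1)]) (auto simp: p_def)
    also have "\<dots> = ennreal (\<Sum>y\<in>T. p y * (3 / 2))"
      by (simp add: p_def)
    also have "(\<Sum>y\<in>T. p y * (3 / 2)) = (\<Sum>y\<in>T. p y) * (3 / 2)" by (simp only: sum_distrib_right)
    finally show ?thesis by (simp add: p1)
  qed
  \<comment> \<open>Chaining identifies points at distance 0. For the process this holds almost
    surely, and finiteness of \<open>T\<close> gives one exceptional null set for all pairs.\<close>
  have ae1: "AE \<omega> in M. \<forall>y\<in>T. \<forall>z\<in>T. gp_dist M X y z = 0 \<longrightarrow> X y \<omega> = X z \<omega>"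
  proof (intro AE_finite_allI[OF a(1)])
    fix y z assume "y \<in> T" "z \<in> T"
    then show "AE \<omega> in M. gp_dist M X y z = 0 \<longrightarrow> X y \<omega> = X z \<omega>"
      using gaussian_rv_AE_0[OF cgp_gaussian_diff[OF a(4,1)], of y z] by (cases "gp_dist M X y z = 0") (auto simp: gp_dist_eq)
  qed
  have ae2: "AE \<omega> in M. \<forall>y\<in>T. gp_sd M X y = 0 \<longrightarrow> X y \<omega> = 0"
  proof (intro AE_finite_allI[OF a(1)])
    fix y assume "y \<in> T"
    then show "AE \<omega> in M. gp_sd M X y = 0 \<longrightarrow> X y \<omega> = 0"
      using gaussian_rv_AE_0[OF cgp_gaussian_rv_one[OF a(4,1)], of y] by (cases "gp_sd M X y = 0") (auto simp: gp_sd_def)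
  qed
  have bound: "AE \<omega> in M. Max ((\<lambda>x. \<bar>X x \<omega>\<bar>) ` T) \<le> 23 * \<phi> + 24 * R * (Q \<omega> + Q' \<omega>)"
    using ae1 ae2
  proof eventually_elim
    case (elim \<omega>)
    have "\<bar>X x \<omega>\<bar> \<le> 23 * \<phi> + 24 * R * (Q \<omega> + Q' \<omega>)" if x: "x \<in> T" for x
    proof (cases "gp_sd M X x = 0")
      case True
      then show ?thesis using elim x real R0 Q0[of \<omega>] by simp
    next
      case False
      then have pos: "gp_sd M X x > 0" using gp_sd_nonneg[of M X x] by simp
      have \<mu>T: "set_pmf \<mu> \<subseteq> T" using \<mu> by (simp add: prob_measures_on_def)
      note ch = gp_Phi_chaining[OF anch \<mu>T x pos \<phi>[OF x] real(1)]
      have "\<bar>X x \<omega>\<bar> \<le> 23 * \<phi> + 24 * gp_sd M X x * (Q \<omega> + Q' \<omega>)"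
      proof (rule chaining_pointwise[OF a(1) x, where p=p and d="gp_dist M X" and u="\<lambda>y. X y \<omega>"])
        show "gp_dist M X y z \<le> gp_dist M X x y + gp_dist M X x z" if "y \<in> T" "z \<in> T" for y z
          using gp_dist_triangle[OF a(4,1) that(1) x that(2)] gp_dist_sym[of M X y x] by simp
        show "gp_sd M X y \<le> gp_sd M X x + gp_dist M X x y" if "y \<in> T" for y
          using gp_dist_triangle[OF a(4,1) that x a(2)] gp_dist_sym[of M X y x]
            gp_sd_eq_dist[OF anch that] gp_sd_eq_dist[OF anch x] by simp
        show "(\<Sum>y\<in>T. \<Sum>z\<in>T. p y * p z * exp ((X y \<omega> - X z \<omega>)\<^sup>2 / (4 * (gp_dist M X y z)\<^sup>2))) \<le> Q \<omega>"
          by (simp add: Q_def)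
        show "(\<Sum>y\<in>T. p y * exp ((X y \<omega>)\<^sup>2 / (4 * (gp_sd M X y)\<^sup>2))) \<le> Q' \<omega>"
          by (simp add: Q'_def)
        show "X y \<omega> = X z \<omega>" if "y \<in> T" "z \<in> T" "gp_dist M X y z = 0" for y z using elim(1) that by blast
        show "X y \<omega> = 0" if "y \<in> T" "gp_sd M X y = 0" for y using elim(2) that by blast
        show "0 < (\<Sum>y\<in>{y\<in>T. gp_dist M X x y \<le> r}. p y)" if "0 < r" for r
          unfolding p_def by (rule ch(1)[OF that])
        show "(\<Sum>k\<le>K. 4 * gp_sd M X x / 2 ^ Suc k
            * sqrt (ln (1 / (\<Sum>y\<in>{y\<in>T. gp_dist M X x y \<le> 4 * gp_sd M X x / 2 ^ k}. p y)))) \<le> \<phi>" for K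
          unfolding p_def by (rule ch(2))
        show "0 \<le> gp_dist M X y z" for y z by (simp add: gp_dist_eq)
      qed (use pos p1 in \<open>simp_all add: p_def gp_dist_eq gp_sd_nonneg\<close>)
      also have "\<dots> \<le> 23 * \<phi> + 24 * R * (Q \<omega> + Q' \<omega>)"
        using gp_sd_le_radius[OF anch x] Q0[of \<omega>] unfolding R_def
        by (intro add_left_mono mult_right_mono mult_left_mono add_nonneg_nonneg) auto
      finally show ?thesis .
    qed
    then show ?case using a by simp
  qed
  have "expected_sup_abs M T X = ennreal (\<integral>\<omega>. Max ((\<lambda>x. \<bar>X x \<omega>\<bar>) ` T) \<partial>M)"
    using a by (simp add: expected_sup_abs_def cSup_eq_Max)
  also have "\<dots> = (\<integral>\<^sup>+\<omega>. ennreal (Max ((\<lambda>x. \<bar>X x \<omega>\<bar>) ` T)) \<partial>M)"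
  proof (rule nn_integral_eq_integral[symmetric])
    show "integrable M (\<lambda>\<omega>. Max ((\<lambda>x. \<bar>X x \<omega>\<bar>) ` T))"
      using cgp_integrable[OF a(4,1)] by (intro integrable_Max a) auto
    show "AE \<omega> in M. 0 \<le> Max ((\<lambda>x. \<bar>X x \<omega>\<bar>) ` T)"
      using a by (intro AE_I2) (auto simp: Max_ge_iff)
  qed
  also have "\<dots> \<le> (\<integral>\<^sup>+\<omega>. ennreal (23 * \<phi>) + ennreal (24 * R) * (ennreal (Q \<omega>) + ennreal (Q' \<omega>)) \<partial>M)"
  proof (rule nn_integral_mono_AE, rule eventually_mono[OF bound])
    fix \<omega> assume "Max ((\<lambda>x. \<bar>X x \<omega>\<bar>) ` T) \<le> 23 * \<phi> + 24 * R * (Q \<omega> + Q' \<omega>)"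
    then have "ennreal (Max ((\<lambda>x. \<bar>X x \<omega>\<bar>) ` T)) \<le> ennreal (23 * \<phi> + 24 * R * (Q \<omega> + Q' \<omega>))" by (rule ennreal_leI)
    also have "\<dots> = ennreal (23 * \<phi>) + ennreal (24 * R) * (ennreal (Q \<omega>) + ennreal (Q' \<omega>))"
      using real(1) R0 Q0[of \<omega>] by (simp add: ennreal_plus ennreal_mult)
    finally show "ennreal (Max ((\<lambda>x. \<bar>X x \<omega>\<bar>) ` T))
      \<le> ennreal (23 * \<phi>) + ennreal (24 * R) * (ennreal (Q \<omega>) + ennreal (Q' \<omega>))" .
  qed
  also have "\<dots> = ennreal (23 * \<phi>) + ennreal (24 * R) * ((\<integral>\<^sup>+\<omega>. ennreal (Q \<omega>) \<partial>M) + (\<integral>\<^sup>+\<omega>. ennreal (Q' \<omega>) \<partial>M))"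
    by (simp add: nn_integral_add nn_integral_cmult emeasure_space_1)
  also have "\<dots> \<le> ennreal (23 * \<phi>) + ennreal (24 * R) * (ennreal (3 / 2) + ennreal (3 / 2))"
    by (intro add_left_mono mult_left_mono add_mono EQ EQ') auto
  also have "ennreal (24 * R) * (ennreal (3 / 2) + ennreal (3 / 2)) = ennreal (72 * R)"
  proof -
    have "ennreal (3 / 2) + ennreal (3 / 2) = ennreal 3" by (subst ennreal_plus[symmetric]) auto
    then have "ennreal (24 * R) * (ennreal (3 / 2) + ennreal (3 / 2)) = ennreal (24 * R * 3)"
      using R0 by (simp only: ennreal_mult)
    then show ?thesis by (simp add: mult.commute)
  qed
  also have "ennreal (23 * \<phi>) + ennreal (72 * R) = ennreal (23 * \<phi> + 72 * R)"
    using real(1) R0 by (intro ennreal_plus[symmetric]) auto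
  also have "\<dots> \<le> ennreal (72 * (R + \<phi>))" using real(1) R0 by (intro ennreal_leI) simp
  also have "\<dots> = ennreal 72 * (ennreal R + gp_Phi_sup M T X \<mu>)" using real R0 by (simp add: ennreal_mult)
  finally show ?thesis by (simp add: R_def)
qed

text \<open>To pass to the infimum over \<open>\<mu>\<close>, the radius is moved to the other side
  by truncated subtraction, which leaves a lower bound for \<open>gp_Phi_sup\<close> alone. Dividing
  by 72 beforehand keeps that constant out of the infimum.\<close>

lemma expected_sup_abs_le: "expected_sup_abs M T X \<le> ennreal 72 * radius_plus_inf_Phi M T X"
proof -
  define s where "s = (\<integral>\<omega>. (SUP x\<in>T. \<bar>X x \<omega>\<bar>) \<partial>M)"
  have es: "expected_sup_abs M T X = ennreal 72 * ennreal (s / 72)"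
    unfolding expected_sup_abs_def s_def by (subst ennreal_mult'[symmetric]) auto
  have "ennreal (s / 72) - ennreal (gp_radius M T X) \<le> gp_Phi_sup M T X \<mu>" if "\<mu> \<in> prob_measures_on T" for \<mu>
  proof -
    have "ennreal 72 * ennreal (s / 72) \<le> ennreal 72 * (ennreal (gp_radius M T X) + gp_Phi_sup M T X \<mu>)"
      using expected_sup_abs_le_Phi_sup[OF that] es by simp
    then have "ennreal (s / 72) \<le> ennreal (gp_radius M T X) + gp_Phi_sup M T X \<mu>"
      by (subst (asm) ennreal_mult_le_mult_iff) auto
    then show ?thesis by (simp add: ennreal_minus_le_iff)
  qed
  then have "ennreal (s / 72) - ennreal (gp_radius M T X) \<le> (INF \<mu>\<in>prob_measures_on T. gp_Phi_sup M T X \<mu>)"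
    by (rule INF_greatest)
  then have "ennreal (s / 72) \<le> radius_plus_inf_Phi M T X"
    by (simp add: radius_plus_inf_Phi_def ennreal_minus_le_iff)
  then show ?thesis unfolding es by (intro mult_left_mono) auto
qed

lemma expected_sup_le_expected_sup_abs: "expected_sup M T X \<le> expected_sup_abs M T X"
proof -
  note a = anchored[OF anch]
  have "(\<integral>\<omega>. Max ((\<lambda>x. X x \<omega>) ` T) \<partial>M) \<le> (\<integral>\<omega>. Max ((\<lambda>x. \<bar>X x \<omega>\<bar>) ` T) \<partial>M)"
  proof (rule integral_mono)
    show "Max ((\<lambda>x. X x \<omega>) ` T) \<le> Max ((\<lambda>x. \<bar>X x \<omega>\<bar>) ` T)" for \<omega>
    proof (rule Max.boundedI)
      fix v assume "v \<in> (\<lambda>x. X x \<omega>) ` T"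
      then obtain x where "x \<in> T" "v = X x \<omega>" by blast
      then show "v \<le> Max ((\<lambda>x. \<bar>X x \<omega>\<bar>) ` T)"
        using a(1) by (intro order_trans[OF abs_ge_self[of v]] Max_ge) auto
    qed (use a in auto)
  qed (use cgp_integrable[OF a(4,1)] in \<open>auto intro!: integrable_Max a\<close>)
  then show ?thesis using a by (simp add: expected_sup_def expected_sup_abs_def cSup_eq_Max ennreal_leI)
qed

end

section \<open>Independence of the underlying types\<close>

text \<open>The coordinate process under the law of the relabelled family is a copy of
  \<open>X\<close> on fixed types. Distances, radius, functional and expected suprema depend only on
  the joint law, so all of them carry over.\<close>

lemma anchored_process_nat_model:
  fixes M :: "'a measure" and T :: "'i set" and X :: "'i \<Rightarrow> 'a \<Rightarrow> real" and x0 :: 'i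
  assumes anch: "anchored_gaussian_process M T X x0"
  obtains M' :: "(nat \<Rightarrow> real) measure" and T' :: "nat set" and X' :: "nat \<Rightarrow> (nat \<Rightarrow> real) \<Rightarrow> real" and x0' :: nat
  where "anchored_gaussian_process M' T' X' x0'"
    and "radius_plus_inf_Phi M' T' X' = radius_plus_inf_Phi M T X"
    and "expected_sup M' T' X' = expected_sup M T X"
    and "expected_sup_abs M' T' X' = expected_sup_abs M T X"
proof -
  note a = anchored[OF anch]
  interpret prob_space M by (rule a(6))
  note mX[measurable] = anchored_measurable[OF anch]
  obtain h :: "'i \<Rightarrow> nat" where h: "inj_on h T" using finite_imp_inj_to_nat_seg[OF a(1)] by blast
  define T' where "T' = h ` T"
  define k where "k = inv_into T h"
  have kh: "k (h x) = x" if "x \<in> T" for x using that h by (simp add: k_def)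
  have hk: "h (k n) = n" and kT: "k n \<in> T" if "n \<in> T'" for n
    using that kh by (auto simp: T'_def)
  \<comment> \<open>Coordinates outside \<open>T'\<close> are set to 0, so that \<open>W\<close>
    maps into the full space \<open>nat \<Rightarrow> real\<close>.\<close>
  define W where "W \<omega> = (\<lambda>n. if n \<in> T' then X (k n) \<omega> else 0)" for \<omega>
  let ?S = "PiM UNIV (\<lambda>_. borel) :: (nat \<Rightarrow> real) measure"
  have W[measurable]: "W \<in> M \<rightarrow>\<^sub>M ?S"
  proof (rule measurable_PiM_single')
    show "(\<lambda>\<omega>. W \<omega> n) \<in> borel_measurable M" for n
      unfolding W_def using kT mX by (cases "n \<in> T'") auto
  qed auto
  define M' where "M' = distr M ?S W"
  define X' where "X' n \<omega> = \<omega> n" for n and \<omega> :: "nat \<Rightarrow> real"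
  have X'm[measurable]: "X' n \<in> borel_measurable ?S" for n unfolding X'_def by measurable
  have X'W: "X' n (W \<omega>) = X (k n) \<omega>" if "n \<in> T'" for n \<omega> using that by (simp add: X'_def W_def)
  have X'Wh: "X' (h x) (W \<omega>) = X x \<omega>" if "x \<in> T" for x \<omega> using that kh by (simp add: X'W T'_def)
  have int: "(\<integral>\<omega>'. f \<omega>' \<partial>M') = (\<integral>\<omega>. f (W \<omega>) \<partial>M)" if "f \<in> borel_measurable ?S" for f :: "_ \<Rightarrow> real"
    unfolding M'_def by (rule integral_distr[OF W that])
  have anch': "anchored_gaussian_process M' T' X' (h x0)"
    unfolding anchored_gaussian_process_def centered_gaussian_process_def
  proof (intro conjI ballI allI impI)
    show "finite T'" "h x0 \<in> T'" using a by (auto simp: T'_def)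
    show "prob_space M'" unfolding M'_def by (rule prob_space_distr[OF W])
    show "X' n \<in> borel_measurable M'" for n unfolding M'_def by simp
    show "AE \<omega> in M'. X' (h x0) \<omega> = 0"
      unfolding M'_def using a by (subst AE_distr_iff[OF W]) (auto simp: X'Wh)
    fix F :: "nat set" and b :: "nat \<Rightarrow> real"
    assume F: "finite F \<and> F \<subseteq> T'"
    have "distr M' borel (\<lambda>\<omega>. \<Sum>n\<in>F. b n * X' n \<omega>) = distr M borel (\<lambda>\<omega>. \<Sum>n\<in>F. b n * X' n (W \<omega>))"
      unfolding M'_def by (subst distr_distr[OF _ W]) (auto simp: comp_def)
    also have "(\<lambda>\<omega>. \<Sum>n\<in>F. b n * X' n (W \<omega>)) = (\<lambda>\<omega>. \<Sum>x\<in>k ` F. b (h x) * X x \<omega>)"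
    proof
      fix \<omega>
      have "inj_on k F" using hk F by (metis inj_onI subsetD)
      then show "(\<Sum>n\<in>F. b n * X' n (W \<omega>)) = (\<Sum>x\<in>k ` F. b (h x) * X x \<omega>)"
        using F by (subst sum.reindex) (auto intro!: sum.cong simp: X'W hk subset_iff)
    qed
    finally have eq: "distr M' borel (\<lambda>\<omega>. \<Sum>n\<in>F. b n * X' n \<omega>) = distr M borel (\<lambda>\<omega>. \<Sum>x\<in>k ` F. b (h x) * X x \<omega>)" .
    have kF: "finite (k ` F) \<and> k ` F \<subseteq> T" using F kT by blast
    have all: "\<forall>F b. finite F \<and> F \<subseteq> T \<longrightarrow> (\<exists>s\<ge>0. distr M borel (\<lambda>\<omega>. \<Sum>x\<in>F. b x * X x \<omega>) = centered_normal s)"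
      using a(4) unfolding centered_gaussian_process_def by (elim conjE)
    have "\<exists>s\<ge>0. distr M borel (\<lambda>\<omega>. \<Sum>x\<in>k ` F. b (h x) * X x \<omega>) = centered_normal s"
      by (rule all[rule_format, OF kF])
    then show "\<exists>s\<ge>0. distr M' borel (\<lambda>\<omega>. \<Sum>n\<in>F. b n * X' n \<omega>) = centered_normal s"
      unfolding eq .
  qed
  have dist: "gp_dist M' X' (h x) (h y) = gp_dist M X x y" if "x \<in> T" "y \<in> T" for x y
    unfolding gp_dist_def using that by (subst int) (auto simp: X'Wh)
  have sd: "gp_sd M' X' (h x) = gp_sd M X x" if "x \<in> T" for x
    unfolding gp_sd_def using that by (subst int) (auto simp: X'Wh)
  have radius: "gp_radius M' T' X' = gp_radius M T X"
    unfolding gp_radius_def T'_def image_image by (intro SUP_cong refl sd)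
  have prob: "measure_pmf.prob (map_pmf h \<mu>) (gp_ball M' T' X' (h x) \<epsilon>) = measure_pmf.prob \<mu> (gp_ball M T X x \<epsilon>)"
    if \<mu>: "set_pmf \<mu> \<subseteq> T" and x: "x \<in> T" for \<mu> x \<epsilon>
  proof -
    have "h y \<in> gp_ball M' T' X' (h x) \<epsilon> \<longleftrightarrow> y \<in> gp_ball M T X x \<epsilon>" if "y \<in> T" for y
      using x that by (simp add: gp_ball_def T'_def dist)
    then have "h -` gp_ball M' T' X' (h x) \<epsilon> \<inter> set_pmf \<mu> = gp_ball M T X x \<epsilon> \<inter> set_pmf \<mu>"
      using \<mu> by auto
    then have "measure_pmf.prob \<mu> (h -` gp_ball M' T' X' (h x) \<epsilon>) = measure_pmf.prob \<mu> (gp_ball M T X x \<epsilon>)"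
      by (metis measure_Int_set_pmf)
    then show ?thesis by simp
  qed
  have Phi: "gp_Phi_sup M' T' X' (map_pmf h \<mu>) = gp_Phi_sup M T X \<mu>" if \<mu>: "set_pmf \<mu> \<subseteq> T" for \<mu>
    unfolding gp_Phi_sup_def T'_def image_image
    by (intro SUP_cong refl) (simp only: gp_Phi_def prob[OF \<mu>, unfolded T'_def] sd)
  \<comment> \<open>The relabelling is a bijection on measures as well, so both infima range over
    the same values.\<close>
  have "prob_measures_on T' = map_pmf h ` prob_measures_on T"
  proof (intro equalityI subsetI)
    fix \<nu> assume "\<nu> \<in> prob_measures_on T'"
    then have \<nu>: "set_pmf \<nu> \<subseteq> T'" by (simp add: prob_measures_on_def)
    have "map_pmf h (map_pmf k \<nu>) = map_pmf (\<lambda>n. n) \<nu>"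
      unfolding map_pmf_comp using \<nu> by (intro map_pmf_cong) (auto simp: hk)
    then have "\<nu> = map_pmf h (map_pmf k \<nu>)" by simp
    moreover have "map_pmf k \<nu> \<in> prob_measures_on T" using \<nu> kT by (auto simp: prob_measures_on_def)
    ultimately show "\<nu> \<in> map_pmf h ` prob_measures_on T" by blast
  qed (fastforce simp: prob_measures_on_def T'_def)
  then have "(INF \<nu>\<in>prob_measures_on T'. gp_Phi_sup M' T' X' \<nu>)
      = (INF \<mu>\<in>prob_measures_on T. gp_Phi_sup M' T' X' (map_pmf h \<mu>))"
    by (simp only: image_image)
  also have "\<dots> = (INF \<mu>\<in>prob_measures_on T. gp_Phi_sup M T X \<mu>)"
    by (intro INF_cong refl Phi) (simp add: prob_measures_on_def)
  finally have rad: "radius_plus_inf_Phi M' T' X' = radius_plus_inf_Phi M T X"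
    by (simp only: radius_plus_inf_Phi_def radius)
  have fT': "finite T'" using a by (simp add: T'_def)
  have "(\<lambda>\<omega>. SUP n\<in>T'. X' n \<omega>) \<in> borel_measurable ?S" "(\<lambda>\<omega>. SUP n\<in>T'. \<bar>X' n \<omega>\<bar>) \<in> borel_measurable ?S"
    using fT' by (auto intro!: borel_measurable_cSUP countable_finite)
  then have es: "expected_sup M' T' X' = expected_sup M T X" "expected_sup_abs M' T' X' = expected_sup_abs M T X"
    unfolding expected_sup_def expected_sup_abs_def T'_def image_image
    by (simp_all add: int image_image X'Wh cong: SUP_cong_simp)
  show ?thesis by (rule that[OF anch' rad es])
qed

section \<open>The three comparisons and their transfer to arbitrary types\<close>

theorem proposition1p2:
  shows
    "(\<exists>c C. 0 < c \<and> c < C \<and>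
       comparable TYPE(nat \<Rightarrow> real) TYPE(nat) c C radius_plus_inf_Phi expected_sup) \<and>
     (\<exists>c C. 0 < c \<and> c < C \<and>
       comparable TYPE(nat \<Rightarrow> real) TYPE(nat) c C expected_sup expected_sup_abs) \<and>
     (\<exists>c C. 0 < c \<and> c < C \<and>
       comparable TYPE(nat \<Rightarrow> real) TYPE(nat) c C radius_plus_inf_Phi expected_sup_abs) \<and>
     (\<forall>c C.
       (comparable TYPE(nat \<Rightarrow> real) TYPE(nat) c C radius_plus_inf_Phi expected_sup \<longrightarrow>
          comparable TYPE('a) TYPE('i) c C radius_plus_inf_Phi expected_sup) \<and>
       (comparable TYPE(nat \<Rightarrow> real) TYPE(nat) c C expected_sup expected_sup_abs \<longrightarrow>
          comparable TYPE('a) TYPE('i) c C expected_sup expected_sup_abs) \<and>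
       (comparable TYPE(nat \<Rightarrow> real) TYPE(nat) c C radius_plus_inf_Phi expected_sup_abs \<longrightarrow>
          comparable TYPE('a) TYPE('i) c C radius_plus_inf_Phi expected_sup_abs))"
proof (intro conjI allI impI)
  have lower: "ennreal (1 / 334) * radius_plus_inf_Phi M T X \<le> expected_sup M T X"
    if "anchored_gaussian_process M T X x0"
    for M :: "(nat \<Rightarrow> real) measure" and T :: "nat set" and X x0
  proof -
    have "ennreal (1 / 334) * radius_plus_inf_Phi M T X \<le> ennreal (1 / 334) * (ennreal 334 * expected_sup M T X)"
      by (intro mult_left_mono radius_plus_inf_Phi_le[OF that]) auto
    also have "\<dots> = ennreal (1 / 334 * 334) * expected_sup M T X"
      by (subst ennreal_mult) (auto simp: mult.assoc)
    finally show ?thesis by simp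
  qed
  have upper: "expected_sup_abs M T X \<le> ennreal 72 * radius_plus_inf_Phi M T X"
      and le: "expected_sup M T X \<le> expected_sup_abs M T X"
      and R: "radius_plus_inf_Phi M T X \<le> ennreal 334 * expected_sup M T X"
    if "anchored_gaussian_process M T X x0"
    for M :: "(nat \<Rightarrow> real) measure" and T :: "nat set" and X x0
    using expected_sup_abs_le[OF that] expected_sup_le_expected_sup_abs[OF that] radius_plus_inf_Phi_le[OF that] by auto
  show "\<exists>c C. 0 < c \<and> c < C \<and> comparable TYPE(nat \<Rightarrow> real) TYPE(nat) c C radius_plus_inf_Phi expected_sup"
    unfolding comparable_def using lower order_trans[OF le upper]
    by (intro exI[of _ "1 / 334"] exI[of _ 72]) auto
  show "\<exists>c C. 0 < c \<and> c < C \<and> comparable TYPE(nat \<Rightarrow> real) TYPE(nat) c C radius_plus_inf_Phi expected_sup_abs"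
    unfolding comparable_def using order_trans[OF lower le] upper
    by (intro exI[of _ "1 / 334"] exI[of _ 72]) auto
  \<comment> \<open>The absolute supremum is bounded by passing through the functional: the upper
    bound with 72 is followed by the lower bound with 334.\<close>
  have "expected_sup_abs M T X \<le> ennreal (72 * 334) * expected_sup M T X"
    if "anchored_gaussian_process M T X x0"
    for M :: "(nat \<Rightarrow> real) measure" and T :: "nat set" and X x0
  proof -
    have "expected_sup_abs M T X \<le> ennreal 72 * (ennreal 334 * expected_sup M T X)"
      by (rule order_trans[OF upper[OF that]], intro mult_left_mono R[OF that]) auto
    also have "\<dots> = ennreal (72 * 334) * expected_sup M T X"
      by (subst ennreal_mult) (auto simp: mult.assoc)
    finally show ?thesis .
  qed
  then show "\<exists>c C. 0 < c \<and> c < C \<and> comparable TYPE(nat \<Rightarrow> real) TYPE(nat) c C expected_sup expected_sup_abs"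
    unfolding comparable_def using le
    by (intro exI[of _ 1] exI[of _ "72 * 334"]) auto
next
  fix c C
  assume "comparable TYPE(nat \<Rightarrow> real) TYPE(nat) c C radius_plus_inf_Phi expected_sup"
  then show "comparable TYPE('a) TYPE('i) c C radius_plus_inf_Phi expected_sup"
    unfolding comparable_def by (metis anchored_process_nat_model)
next
  fix c C
  assume "comparable TYPE(nat \<Rightarrow> real) TYPE(nat) c C expected_sup expected_sup_abs"
  then show "comparable TYPE('a) TYPE('i) c C expected_sup expected_sup_abs"
    unfolding comparable_def by (metis anchored_process_nat_model)
next
  fix c C
  assume "comparable TYPE(nat \<Rightarrow> real) TYPE(nat) c C radius_plus_inf_Phi expected_sup_abs"
  then show "comparable TYPE('a) TYPE('i) c C radius_plus_inf_Phi expected_sup_abs"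
    unfolding comparable_def by (metis anchored_process_nat_model)
qed

end
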